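(* Assume (L), (W) and that $X$ is compact. Let $x_k$ be generated by the model-based iteration $$x_{k+1}=\operatorname*{argmin}_{y\in X}\Big\{f_{x_k}(y;S_k)+\varphi(y)+\frac{1}{2\alpha_k}\|y-x_k\|^2\Big\},\qquad S_k\stackrel{\text{i.i.d.}}{\sim}P,$$ started from $x_0\in X$, where the models $f_x(\cdot;s)$ satisfy conditions (C.i)--(C.iv) and the stepsizes $\alpha_k>0$ satisfy $\sum_k\alpha_k=\infty$ and $\sum_k\alpha_k^2<\infty$. Then with probability 1, $$\Big[\liminf_k F(x_k),\ \limsup_k F(x_k)\Big]\subset F(X^\star).$$
   Context: Setting. $P$ is a probability distribution on a sample space $\mathcal S$, and $S\sim P$. $X\subset\mathbb R^d$ is a nonempty closed convex set and $\varphi:\mathbb R^d\to\mathbb R$ is a closed convex function. For each $s\in\mathcal S$, $f(\cdot;s):\mathbb R^d\to\mathbb R$; $f(x)=\mathbb E_P[f(x;S)]$ is finite for every $x\in\mathbb R^d$, and $F(x)=f(x)+\varphi(x)$. All functions of $s$ involved are measurable. $\|\cdot\|$ is the Euclidean norm and $\mathbb B$ the unit ball. For a function $h:\mathbb R^d\to\mathbb R\cup\{+\infty\}$, $\partial h(x)=\{g: h(y)\ge h(x)+\langle g,y-x\rangle+o(\|y-x\|)\text{ as }y\to x\}$ is the Fréchet subdifferential (the usual subdifferential for convex $h$). (L) With $M_\epsilon(x;s)=\sup_{y\in X,\|y-x\|\le\epsilon}\ \sup_{g\in\partial f(y;s)}\|g\|$, there is $\epsilon_0>0$ such that $0<\epsilon\le\epsilon_0$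 implies $\mathbb E[M_\epsilon(x;S)^2]<\infty$ for all $x\in X$. (W) There is $\epsilon_0>0$ such that $0<\epsilon\le\epsilon_0$ implies that for all $x\in X$ there is $\lambda(s,x)\ge0$ such that $y\mapsto f(y;s)+\frac{\lambda(s,x)}2\|y-x_0\|^2$ is convex on $x+\epsilon\mathbb B$ for any $x_0\in\mathbb R^d$, and $\mathbb E[\lambda(S,x)]<\infty$. Models. For each $x\in X$ and $s\in\mathcal S$ one has a model $f_x(\cdot;s):\mathbb R^d\to\mathbb R\cup\{+\infty\}$ of $f(\cdot;s)$ at $x$; the argmin in the iteration is assumed attained (it is then unique) and measurable in $s$. Conditions: (C.i) $y\mapsto f_x(y;s)$ is convex and subdifferentiable on its domain. (C.ii) $f_x(x;s)=f(x;s)$. (C.iii) $\partial_y f_x(y;s)|_{y=x}\subset\partial f(x;s)$. (C.iv) There is $\epsilon_0>0$ such that $0<\epsilon\le\epsilon_0$ implies that for all $x_0\in X$ there is $\delta_\epsilon(x_0;s)\ge0$ with $f(y;s)\ge f_x(y;s)-\frac12\delta_\epsilon(x_0;s)\|y-x\|^2$ for all $x\in X\cap(x_0+\epsilon\mathbb B)$, $y\in x_0+\epsilon\mathbb B$, where $\mathbb E[\delta_\epsilon(x_0;S)]<\infty$. Stationary set: $X^\star=\{x\in X:\exists\, g\in\partial f(x)+\partial\varphi(x)\text{ with }\langle g,y-x\rangle\ge0\text{ for all }y\in X\}$, and $F(X^\star)=\{F(x):x\in X^\star\}$. *)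

theory Defs
  imports "HOL-Probability.Probability" "HOL-Library.Landau_Symbols"
begin

text \<open>Frechet subdifferential of an extended-real-valued function. As usual it is empty outside
  the domain of \<^term>\<open>h\<close>.\<close>

definition frechet_subdiff :: "('a::euclidean_space \<Rightarrow> ereal) \<Rightarrow> 'a \<Rightarrow> 'a set" where
  "frechet_subdiff h x =
     {g. \<bar>h x\<bar> \<noteq> \<infinity> \<and>
         (\<exists>r::'a \<Rightarrow> real. r \<in> o[at x](\<lambda>y. norm (y - x)) \<and>
            (\<forall>\<^sub>F y in at x. h y \<ge> h x + ereal (g \<bullet> (y - x) + r y)))}"

definition ereal_convex :: "('a::real_vector \<Rightarrow> ereal) \<Rightarrow> bool" where
  "ereal_convex h \<longleftrightarrow> convex {(y, t::real). h y \<le> ereal t}"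

definition closed_convex_fun :: "('a::euclidean_space \<Rightarrow> real) \<Rightarrow> bool" where
  "closed_convex_fun h \<longleftrightarrow> convex_on UNIV h \<and> closed {(y, t::real). h y \<le> t}"

definition risk :: "'s measure \<Rightarrow> ('a \<Rightarrow> 's \<Rightarrow> real) \<Rightarrow> 'a \<Rightarrow> real" where
  "risk P f x = (LINT s|P. f x s)"

definition objective :: "'s measure \<Rightarrow> ('a \<Rightarrow> 's \<Rightarrow> real) \<Rightarrow> ('a \<Rightarrow> real) \<Rightarrow> 'a \<Rightarrow> real" where
  "objective P f \<phi> x = risk P f x + \<phi> x"

text \<open>The local Lipschitz bound $M_\epsilon(x;s)$; as a supremum of norms it is taken in
  \<^typ>\<open>ennreal\<close>, so that the supremum over an empty set of subgradients is 0.\<close>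

definition local_lip ::
    "'a::euclidean_space set \<Rightarrow> ('a \<Rightarrow> 's \<Rightarrow> real) \<Rightarrow> real \<Rightarrow> 'a \<Rightarrow> 's \<Rightarrow> ennreal" where
  "local_lip X f \<epsilon> x s =
     (SUP y\<in>{y\<in>X. norm (y - x) \<le> \<epsilon>}. SUP g\<in>frechet_subdiff (\<lambda>z. ereal (f z s)) y. ennreal (norm g))"

definition cond_L :: "'s measure \<Rightarrow> 'a::euclidean_space set \<Rightarrow> ('a \<Rightarrow> 's \<Rightarrow> real) \<Rightarrow> bool" where
  "cond_L P X f \<longleftrightarrow>
     (\<exists>\<epsilon>0>0. \<forall>\<epsilon>. 0 < \<epsilon> \<and> \<epsilon> \<le> \<epsilon>0 \<longrightarrow>
        (\<forall>x\<in>X. local_lip X f \<epsilon> x \<in> borel_measurable P \<and>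
               (\<integral>\<^sup>+ s. (local_lip X f \<epsilon> x s)\<^sup>2 \<partial>P) < \<infinity>))"

definition cond_W :: "'s measure \<Rightarrow> 'a::euclidean_space set \<Rightarrow> ('a \<Rightarrow> 's \<Rightarrow> real) \<Rightarrow> bool" where
  "cond_W P X f \<longleftrightarrow>
     (\<exists>\<epsilon>0>0. \<forall>\<epsilon>. 0 < \<epsilon> \<and> \<epsilon> \<le> \<epsilon>0 \<longrightarrow>
        (\<forall>x\<in>X. \<exists>l::'s \<Rightarrow> real. integrable P l \<and>
           (\<forall>s\<in>space P. l s \<ge> 0 \<and>
              (\<forall>x0. convex_on (cball x \<epsilon>) (\<lambda>y. f y s + l s / 2 * (norm (y - x0))\<^sup>2)))))"

text \<open>A family of models: \<^term>\<open>m x y s\<close> is the value at \<^term>\<open>y\<close> of the model of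
  \<^term>\<open>\<lambda>y. f y s\<close> at \<^term>\<open>x\<close>. Model values lie in $\mathbb R\cup\{+\infty\}$ and are
  measurable in the sample.\<close>

definition model_family ::
    "'s measure \<Rightarrow> 'a::euclidean_space set \<Rightarrow> ('a \<Rightarrow> 'a \<Rightarrow> 's \<Rightarrow> ereal) \<Rightarrow> bool" where
  "model_family P X m \<longleftrightarrow>
     (\<forall>x\<in>X. \<forall>y. m x y \<in> borel_measurable P \<and> (\<forall>s\<in>space P. m x y s \<noteq> -\<infinity>))"

definition cond_Ci ::
    "'s measure \<Rightarrow> 'a::euclidean_space set \<Rightarrow> ('a \<Rightarrow> 'a \<Rightarrow> 's \<Rightarrow> ereal) \<Rightarrow> bool" where
  "cond_Ci P X m \<longleftrightarrow>
     (\<forall>x\<in>X. \<forall>s\<in>space P. ereal_convex (\<lambda>y. m x y s) \<and>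
        (\<forall>y. m x y s < \<infinity> \<longrightarrow> frechet_subdiff (\<lambda>z. m x z s) y \<noteq> {}))"

definition cond_Cii ::
    "'s measure \<Rightarrow> 'a::euclidean_space set \<Rightarrow> ('a \<Rightarrow> 's \<Rightarrow> real) \<Rightarrow> ('a \<Rightarrow> 'a \<Rightarrow> 's \<Rightarrow> ereal) \<Rightarrow> bool" where
  "cond_Cii P X f m \<longleftrightarrow> (\<forall>x\<in>X. \<forall>s\<in>space P. m x x s = ereal (f x s))"

definition cond_Ciii ::
    "'s measure \<Rightarrow> 'a::euclidean_space set \<Rightarrow> ('a \<Rightarrow> 's \<Rightarrow> real) \<Rightarrow> ('a \<Rightarrow> 'a \<Rightarrow> 's \<Rightarrow> ereal) \<Rightarrow> bool" where
  "cond_Ciii P X f m \<longleftrightarrow>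
     (\<forall>x\<in>X. \<forall>s\<in>space P.
        frechet_subdiff (\<lambda>y. m x y s) x \<subseteq> frechet_subdiff (\<lambda>y. ereal (f y s)) x)"

definition cond_Civ ::
    "'s measure \<Rightarrow> 'a::euclidean_space set \<Rightarrow> ('a \<Rightarrow> 's \<Rightarrow> real) \<Rightarrow> ('a \<Rightarrow> 'a \<Rightarrow> 's \<Rightarrow> ereal) \<Rightarrow> bool" where
  "cond_Civ P X f m \<longleftrightarrow>
     (\<exists>\<epsilon>0>0. \<forall>\<epsilon>. 0 < \<epsilon> \<and> \<epsilon> \<le> \<epsilon>0 \<longrightarrow>
        (\<forall>x0\<in>X. \<exists>\<delta>::'s \<Rightarrow> real. integrable P \<delta> \<and>
           (\<forall>s\<in>space P. \<delta> s \<ge> 0 \<and>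
              (\<forall>x\<in>X \<inter> cball x0 \<epsilon>. \<forall>y\<in>cball x0 \<epsilon>.
                 ereal (f y s) \<ge> m x y s - ereal (1 / 2 * \<delta> s * (norm (y - x))\<^sup>2)))))"

definition stationary_set ::
    "'s measure \<Rightarrow> 'a::euclidean_space set \<Rightarrow> ('a \<Rightarrow> 's \<Rightarrow> real) \<Rightarrow> ('a \<Rightarrow> real) \<Rightarrow> 'a set" where
  "stationary_set P X f \<phi> =
     {x\<in>X. \<exists>g\<in>{u + v | u v. u \<in> frechet_subdiff (\<lambda>z. ereal (risk P f z)) x \<and>
                             v \<in> frechet_subdiff (\<lambda>z. ereal (\<phi> z)) x}.
             \<forall>y\<in>X. g \<bullet> (y - x) \<ge> 0}"

definition is_model_step ::
    "'a::euclidean_space set \<Rightarrow> ('a \<Rightarrow> real) \<Rightarrow> ('a \<Rightarrow> 'a \<Rightarrow> 's \<Rightarrow> ereal) \<Rightarrow> real \<Rightarrow> 'a \<Rightarrow> 's \<Rightarrow> 'a \<Rightarrow> bool" where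
  "is_model_step X \<phi> m a x s x' \<longleftrightarrow>
     is_arg_min (\<lambda>y. m x y s + ereal (\<phi> y) + ereal (1 / (2 * a) * (norm (y - x))\<^sup>2)) (\<lambda>y. y \<in> X) x'"

text \<open>The sigma-algebra on \<^term>\<open>space \<Omega>\<close> generated by the first \<^term>\<open>k\<close> samples
  \<^term>\<open>S 0\<close>, \dots, \<^term>\<open>S (k - 1)\<close>.\<close>

definition sample_algebra ::
    "'w measure \<Rightarrow> 's measure \<Rightarrow> (nat \<Rightarrow> 'w \<Rightarrow> 's) \<Rightarrow> nat \<Rightarrow> 'w measure" where
  "sample_algebra \<Omega> P S k =
     vimage_algebra (space \<Omega>) (\<lambda>\<omega>. \<lambda>i\<in>{..<k}. S i \<omega>) (PiM {..<k} (\<lambda>_. P))"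

text \<open>The iterates of the model-based method driven by the samples \<^term>\<open>S\<close>. Every minimum is
  attained, and (measurability of the argmin) each \<^term>\<open>x k\<close> is a measurable function of the
  samples drawn before step \<^term>\<open>k\<close>. Measurability of the argmin in the current sample for each
  fixed base point alone would not make the iterates random variables.\<close>

definition model_based_iterates ::
    "'w measure \<Rightarrow> 's measure \<Rightarrow> 'a::euclidean_space set \<Rightarrow> ('a \<Rightarrow> real) \<Rightarrow> ('a \<Rightarrow> 'a \<Rightarrow> 's \<Rightarrow> ereal) \<Rightarrow>
     (nat \<Rightarrow> real) \<Rightarrow> 'a \<Rightarrow> (nat \<Rightarrow> 'w \<Rightarrow> 's) \<Rightarrow> (nat \<Rightarrow> 'w \<Rightarrow> 'a) \<Rightarrow> bool" where
  "model_based_iterates \<Omega> P X \<phi> m \<alpha> x0 S x \<longleftrightarrow>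
     (\<forall>\<omega>\<in>space \<Omega>. x 0 \<omega> = x0 \<and> (\<forall>k. is_model_step X \<phi> m (\<alpha> k) (x k \<omega>) (S k \<omega>) (x (Suc k) \<omega>))) \<and>
     (\<forall>k. x k \<in> borel_measurable (sample_algebra \<Omega> P S k))"

end

theory Submission
  imports Defs
begin

text \<open>
  The objective values \<^emph>\<open>converge\<close> almost surely, so the interval in the conclusion is a single
  point; what has to be found is one stationary point carrying the limit value.

  Let \<open>F\<close> be the objective and \<open>\<Phi>\<^sub>\<rho> x\<close> the minimum over \<open>y \<in> X\<close> of \<open>F y + \<rho>/2 |y - x|\<^sup>2\<close>, the Moreau
  envelope of \<open>F\<close> restricted to \<open>X\<close>. Then \<open>\<Phi>\<^sub>\<rho> \<le> F\<close> on \<open>X\<close>, the gap \<open>F - \<Phi>\<^sub>\<rho>\<close> is at most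
  \<open>L\<^sup>2 / (2\<rho>)\<close> for an \<open>L\<close>-Lipschitz \<open>F\<close>, and a point of \<open>X\<close> where the gap vanishes minimises
  \<open>F + \<rho>/2 |\<cdot> - x|\<^sup>2\<close> over \<open>X\<close>. If \<open>\<rho>\<close> dominates the weak convexity constant of the risk, this is a
  convex problem near \<open>x\<close>, and the sum rule for subgradients turns minimality into stationarity
  (\<open>moreau_env_fixed_point_stationary\<close>).

  Comparing the model subproblem at \<open>x\<^sub>k\<close> with the proximal point \<open>y\<close> of \<open>x\<^sub>k\<close>
  (\<open>convex_prox_step_inequality\<close>) and averaging over the fresh sample, one obtains a drift
  inequality: conditionally on the past, \<open>\<Phi>\<^sub>\<rho> (x\<^sub>k\<^sub>+\<^sub>1) - \<Phi>\<^sub>\<rho> (x\<^sub>k)\<close> has mean at most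
  \<open>- \<rho> \<alpha>\<^sub>k (F - \<Phi>\<^sub>\<rho>) (x\<^sub>k) + C \<alpha>\<^sub>k\<^sup>2\<close>, as soon as \<open>\<rho>\<close> is large enough to dominate
  the mean model error and to keep proximal points in the range where that error is controlled
  (\<open>envelope_drift\<close>). Two consequences hold almost surely. First, \<open>\<Phi>\<^sub>\<rho> (x\<^sub>k)\<close> is a bounded
  supermartingale up to a summable error, hence converges; as this is so for a sequence of
  \<open>\<rho>\<close> tending to infinity, along which \<open>\<Phi>\<^sub>\<rho>\<close> tends to \<open>F\<close> uniformly, \<open>F (x\<^sub>k)\<close> converges too. Second,
  \<open>\<alpha>\<^sub>k (F - \<Phi>\<^sub>\<rho>) (x\<^sub>k)\<close> is summable while \<open>\<alpha>\<^sub>k\<close> is not, so the gap tends to 0 along a subsequence and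
  vanishes at a limit point of that subsequence. This limit point is stationary and has the limit
  value of \<open>F (x\<^sub>k)\<close>.
\<close>

section \<open>Subgradients of convex functions\<close>

text \<open>The first-order optimality condition for minimising \<open>h1 + h2\<close> over \<open>X\<close>, with the subgradient of the
  sum split into one for each summand. A single separation yields all three conclusions: the three
  points at which \<open>X\<close>, \<open>h1\<close> and \<open>h2\<close> are looked at are decoupled by shifts \<open>a\<close> and \<open>b\<close>, and minimality
  says that the origin is not among the triples of two shifts and a strict upper bound on the
  increase of \<open>h1 + h2\<close>.\<close>

lemma convex_sum_rule_at_minimizer:
  fixes h1 h2 :: "'a::euclidean_space \<Rightarrow> real"
  assumes X: "convex X" "xb \<in> X" and r: "r > 0"
    and h1: "convex_on (ball xb r) h1" and h2: "convex_on (ball xb r) h2"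
    and min: "\<And>y. y \<in> X \<inter> ball xb r \<Longrightarrow> h1 xb + h2 xb \<le> h1 y + h2 y"
  obtains u v where "\<And>z. z \<in> ball xb r \<Longrightarrow> h1 z \<ge> h1 xb + u \<bullet> (z - xb)"
    and "\<And>z. z \<in> ball xb r \<Longrightarrow> h2 z \<ge> h2 xb + v \<bullet> (z - xb)"
    and "\<And>y. y \<in> X \<Longrightarrow> (u + v) \<bullet> (y - xb) \<ge> 0"
proof -
  have shrink: "r / (2 * (norm d + 1)) * norm d \<le> r / 2" if "r > 0" for d :: 'a
  proof -
    have "norm d / (norm d + 1) \<le> 1" by (simp add: add_nonneg_pos)
    then have "r / 2 * (norm d / (norm d + 1)) \<le> r / 2 * 1" using that by (intro mult_left_mono) auto
    then show ?thesis by simp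
  qed
  define B where "B = ball xb r"
  define c where "c = h1 xb + h2 xb"
  define C where "C = {(a, b, t::real). \<exists>y\<in>X \<inter> B. y + a \<in> B \<and> y + b \<in> B \<and> h1 (y + a) + h2 (y + b) < t + c}"
  have cB: "convex B" and xbB: "xb \<in> B" using r by (auto simp: B_def)
  have CI: "(a, b, t) \<in> C"
    if "y \<in> X" "y \<in> B" "y + a \<in> B" "y + b \<in> B" "h1 (y + a) + h2 (y + b) < t + c" for a b t y
    using that unfolding C_def by auto
  have convC: "convex C"
    unfolding convex_def
  proof (intro ballI allI impI)
    fix p1 p2 :: "'a \<times> 'a \<times> real" and s s' :: real
    assume p: "p1 \<in> C" "p2 \<in> C" and s: "0 \<le> s" "0 \<le> s'" "s + s' = 1"
    obtain a1 b1 t1 y1 where 1: "p1 = (a1, b1, t1)" "y1 \<in> X" "y1 \<in> B" "y1 + a1 \<in> B" "y1 + b1 \<in> B"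
        "h1 (y1 + a1) + h2 (y1 + b1) < t1 + c"
      using p(1) unfolding C_def by auto
    obtain a2 b2 t2 y2 where 2: "p2 = (a2, b2, t2)" "y2 \<in> X" "y2 \<in> B" "y2 + a2 \<in> B" "y2 + b2 \<in> B"
        "h1 (y2 + a2) + h2 (y2 + b2) < t2 + c"
      using p(2) unfolding C_def by auto
    let ?y = "s *\<^sub>R y1 + s' *\<^sub>R y2"
    have ea: "?y + (s *\<^sub>R a1 + s' *\<^sub>R a2) = s *\<^sub>R (y1 + a1) + s' *\<^sub>R (y2 + a2)"
      and eb: "?y + (s *\<^sub>R b1 + s' *\<^sub>R b2) = s *\<^sub>R (y1 + b1) + s' *\<^sub>R (y2 + b2)"
      by (simp_all add: algebra_simps)
    have "s *\<^sub>R p1 + s' *\<^sub>R p2 = (s *\<^sub>R a1 + s' *\<^sub>R a2, s *\<^sub>R b1 + s' *\<^sub>R b2, s * t1 + s' * t2)"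
      using 1 2 by simp
    also have "\<dots> \<in> C"
    proof (rule CI[of ?y])
      show "?y \<in> X" using X(1) 1 2 s by (simp add: convexD)
      show "?y \<in> B" using cB 1 2 s by (simp add: convexD)
      show "?y + (s *\<^sub>R a1 + s' *\<^sub>R a2) \<in> B" unfolding ea using cB 1 2 s by (simp add: convexD)
      show "?y + (s *\<^sub>R b1 + s' *\<^sub>R b2) \<in> B" unfolding eb using cB 1 2 s by (simp add: convexD)
      have "h1 (?y + (s *\<^sub>R a1 + s' *\<^sub>R a2)) \<le> s * h1 (y1 + a1) + s' * h1 (y2 + a2)"
        unfolding ea using h1 1 2 s unfolding convex_on_def B_def by blast
      moreover have "h2 (?y + (s *\<^sub>R b1 + s' *\<^sub>R b2)) \<le> s * h2 (y1 + b1) + s' * h2 (y2 + b2)"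
        unfolding eb using h2 1 2 s unfolding convex_on_def B_def by blast
      moreover have "s * (h1 (y1 + a1) + h2 (y1 + b1)) + s' * (h1 (y2 + a2) + h2 (y2 + b2))
          < s * (t1 + c) + s' * (t2 + c)"
      proof (cases "s = 0")
        case True
        then show ?thesis using s 2 by simp
      next
        case False
        then have "s * (h1 (y1 + a1) + h2 (y1 + b1)) < s * (t1 + c)"
          using s(1) 1(6) by (intro mult_strict_left_mono) linarith+
        moreover have "s' * (h1 (y2 + a2) + h2 (y2 + b2)) \<le> s' * (t2 + c)"
          using s(2) 2(6) by (intro mult_left_mono) linarith+
        ultimately show ?thesis by (rule add_less_le_mono)
      qed
      moreover have "s * (t1 + c) + s' * (t2 + c) = s * t1 + s' * t2 + c"
      proof -
        have "s * c + s' * c = c" using s(3) by (metis distrib_right mult_1)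
        then show ?thesis by (simp add: distrib_left)
      qed
      ultimately show "h1 (?y + (s *\<^sub>R a1 + s' *\<^sub>R a2)) + h2 (?y + (s *\<^sub>R b1 + s' *\<^sub>R b2))
          < s * t1 + s' * t2 + c"
        by (simp add: algebra_simps)
    qed
    finally show "s *\<^sub>R p1 + s' *\<^sub>R p2 \<in> C" .
  qed
  have "0 \<notin> C"
    using min unfolding C_def c_def B_def zero_prod_def by fastforce
  from separating_hyperplane_set_0[OF convC this]
  obtain w where w: "w \<noteq> 0" "\<And>z. z \<in> C \<Longrightarrow> 0 \<le> w \<bullet> z" by auto
  obtain p q \<tau> where wp: "w = (p, q, \<tau>)" by (cases w) auto
  have sep: "0 \<le> p \<bullet> a + q \<bullet> b + \<tau> * t"
    if "y \<in> X" "y \<in> B" "y + a \<in> B" "y + b \<in> B" "h1 (y + a) + h2 (y + b) < t + c" for a b t y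
    using w(2)[OF CI[OF that]] by (simp add: wp inner_Pair algebra_simps)
  have \<tau>0: "\<tau> \<ge> 0" using sep[of xb 0 0 1] X xbB by (simp add: c_def)
  \<comment> \<open>A vertical hyperplane would have to support a neighbourhood of \<open>(0, 0)\<close> in the shifts, so its
    normal would vanish.\<close>
  have "\<tau> \<noteq> 0"
  proof
    assume \<tau>: "\<tau> = 0"
    have small: "\<exists>\<eta>>0. xb - \<eta> *\<^sub>R d \<in> B" for d :: 'a
    proof (intro exI[of _ "r / (2 * (norm d + 1))"] conjI)
      have "r / (2 * (norm d + 1)) * norm d \<le> r / 2"
        using r by (rule shrink)
      moreover have "norm ((r / (2 * (norm d + 1))) *\<^sub>R d) = r / (2 * (norm d + 1)) * norm d" using r by simp
      ultimately have "norm ((r / (2 * (norm d + 1))) *\<^sub>R d) < r" using r by linarith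
      moreover have "dist xb (xb - w) = norm w" for w by (simp add: dist_norm)
      ultimately show "xb - (r / (2 * (norm d + 1))) *\<^sub>R d \<in> B" unfolding B_def mem_ball by metis
    qed (use r in \<open>simp add: add_nonneg_pos\<close>)
    obtain \<eta> where \<eta>: "\<eta> > 0" "xb - \<eta> *\<^sub>R p \<in> B" using small by blast
    have "0 \<le> p \<bullet> (- \<eta> *\<^sub>R p)"
      using sep[of xb "- \<eta> *\<^sub>R p" 0 "h1 (xb - \<eta> *\<^sub>R p) + h2 xb + 1 - c"] X xbB \<eta> \<tau> by simp
    then have p0: "p = 0" using \<eta> by (simp add: mult_le_0_iff) (metis inner_gt_zero_iff not_less)
    obtain \<eta>' where \<eta>': "\<eta>' > 0" "xb - \<eta>' *\<^sub>R q \<in> B" using small by blast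
    have "0 \<le> q \<bullet> (- \<eta>' *\<^sub>R q)"
      using sep[of xb 0 "- \<eta>' *\<^sub>R q" "h1 xb + h2 (xb - \<eta>' *\<^sub>R q) + 1 - c"] X xbB \<eta>' \<tau> by simp
    then have "q = 0" using \<eta>' by (simp add: mult_le_0_iff) (metis inner_gt_zero_iff not_less)
    then show False using w(1) p0 \<tau> by (simp add: wp zero_prod_def)
  qed
  with \<tau>0 have \<tau>: "\<tau> > 0" by simp
  define u v where "u = - (1 / \<tau>) *\<^sub>R p" and "v = - (1 / \<tau>) *\<^sub>R q"
  have pu: "p = - \<tau> *\<^sub>R u" and qv: "q = - \<tau> *\<^sub>R v" using \<tau> by (simp_all add: u_def v_def)
  show thesis
  proof (rule that[of u v])
    fix z assume "z \<in> ball xb r"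
    then have z: "z \<in> B" by (simp add: B_def)
    show "h1 xb + u \<bullet> (z - xb) \<le> h1 z"
    proof (rule field_le_epsilon)
      fix e :: real assume "e > 0"
      then have "0 \<le> p \<bullet> (z - xb) + \<tau> * (h1 z - h1 xb + e)"
        using sep[of xb "z - xb" 0 "h1 z - h1 xb + e"] X xbB z by (simp add: c_def)
      then have "0 \<le> \<tau> * (h1 z - h1 xb + e - u \<bullet> (z - xb))" by (simp add: pu algebra_simps)
      then show "h1 xb + u \<bullet> (z - xb) \<le> h1 z + e" using \<tau> by (simp add: zero_le_mult_iff)
    qed
    show "h2 xb + v \<bullet> (z - xb) \<le> h2 z"
    proof (rule field_le_epsilon)
      fix e :: real assume "e > 0"
      then have "0 \<le> q \<bullet> (z - xb) + \<tau> * (h2 z - h2 xb + e)"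
        using sep[of xb 0 "z - xb" "h2 z - h2 xb + e"] X xbB z by (simp add: c_def)
      then have "0 \<le> \<tau> * (h2 z - h2 xb + e - v \<bullet> (z - xb))" by (simp add: qv algebra_simps)
      then show "h2 xb + v \<bullet> (z - xb) \<le> h2 z + e" using \<tau> by (simp add: zero_le_mult_iff)
    qed
  next
    have near: "(u + v) \<bullet> (y - xb) \<ge> 0" if y: "y \<in> X" "y \<in> B" for y
    proof (rule field_le_epsilon)
      fix e :: real assume "e > 0"
      then have "0 \<le> p \<bullet> (xb - y) + q \<bullet> (xb - y) + \<tau> * e"
        using sep[of y "xb - y" "xb - y" e] y xbB by (simp add: c_def)
      then have "0 \<le> \<tau> * ((u + v) \<bullet> (y - xb) + e)" by (simp add: pu qv algebra_simps)
      then show "0 \<le> (u + v) \<bullet> (y - xb) + e" using \<tau> by (simp add: zero_le_mult_iff)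
    qed
    fix y assume y: "y \<in> X"
    define t where "t = min 1 (r / (2 * (norm (y - xb) + 1)))"
    have t: "0 < t" "t \<le> 1" using r by (auto simp: t_def add_nonneg_pos)
    have "t * norm (y - xb) \<le> r / (2 * (norm (y - xb) + 1)) * norm (y - xb)"
      by (intro mult_right_mono) (auto simp: t_def)
    also have "\<dots> \<le> r / 2" using r by (rule shrink)
    finally have "xb + t *\<^sub>R (y - xb) \<in> B" using r t by (simp add: B_def dist_norm)
    moreover have "xb + t *\<^sub>R (y - xb) \<in> X"
      using convexD_alt[OF X(1) X(2) y, of t] t by (simp add: algebra_simps)
    ultimately have "0 \<le> t * ((u + v) \<bullet> (y - xb))" using near[of "xb + t *\<^sub>R (y - xb)"] by simp
    then show "0 \<le> (u + v) \<bullet> (y - xb)" using t by (simp add: zero_le_mult_iff)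
  qed
qed

lemma convex_on_subgradient_exists:
  fixes h :: "'a::euclidean_space \<Rightarrow> real"
  assumes "r > 0" "convex_on (ball y r) h"
  obtains u where "\<And>z. z \<in> ball y r \<Longrightarrow> h z \<ge> h y + u \<bullet> (z - y)"
proof (rule convex_sum_rule_at_minimizer[of "{y}" y r h "\<lambda>_. 0"])
  show "convex_on (ball y r) (\<lambda>_. 0::real)" by (simp add: convex_on_def)
qed (use assms that in auto)

lemma proximal_subgradient_in_frechet_subdiff:
  fixes h :: "'a::euclidean_space \<Rightarrow> real"
  assumes r: "r > 0" and g: "\<And>z. z \<in> ball y r \<Longrightarrow> h z + c * (norm (z - y))\<^sup>2 \<ge> h y + g \<bullet> (z - y)"
  shows "g \<in> frechet_subdiff (\<lambda>z. ereal (h z)) y"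
proof -
  have "((\<lambda>z. - c * norm (z - y)) \<longlongrightarrow> - c * norm (y - y)) (at y)"
    by (intro tendsto_intros)
  then have lim: "((\<lambda>z. - c * norm (z - y)) \<longlongrightarrow> 0) (at y)" by simp
  have "(\<lambda>z. - c * (norm (z - y))\<^sup>2) \<in> o[at y](\<lambda>z. norm (z - y))"
  proof (rule smalloI_tendsto)
    show "((\<lambda>z. - c * (norm (z - y))\<^sup>2 / norm (z - y)) \<longlongrightarrow> 0) (at y)"
      by (rule Lim_transform_eventually[OF lim])
        (auto simp: eventually_at_filter power2_eq_square)
    show "\<forall>\<^sub>F z in at y. norm (z - y) \<noteq> 0" by (simp add: eventually_at_filter)
  qed
  moreover have "\<forall>\<^sub>F z in at y. z \<in> ball y r"
    using r by (intro eventually_at_in_open') auto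
  then have "\<forall>\<^sub>F z in at y. ereal (h z) \<ge> ereal (h y) + ereal (g \<bullet> (z - y) + (- c * (norm (z - y))\<^sup>2))"
    by eventually_elim (use g in \<open>force simp: algebra_simps\<close>)
  ultimately show ?thesis
    unfolding frechet_subdiff_def
    by (intro CollectI conjI exI[of _ "\<lambda>z. - c * (norm (z - y))\<^sup>2"]) auto
qed

text \<open>On a segment issuing from \<open>x\<close> a convex function lies below its chord, while the error term in the
  Frechet inequality is of smaller order than the distance; dividing by the distance makes the
  local inequality global.\<close>

lemma ereal_convex_frechet_subgradient_ineq:
  fixes h :: "'a::euclidean_space \<Rightarrow> ereal"
  assumes cv: "ereal_convex h" and hx: "h x = ereal a" and hy: "h y \<le> ereal b"
    and g: "g \<in> frechet_subdiff h x"
  shows "a + g \<bullet> (y - x) \<le> b"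
proof (cases "y = x")
  case True
  then show ?thesis using hx hy by simp
next
  case False
  obtain \<rho> where \<rho>: "\<rho> \<in> o[at x](\<lambda>y. norm (y - x))"
    and low: "\<forall>\<^sub>F z in at x. h z \<ge> h x + ereal (g \<bullet> (z - x) + \<rho> z)"
    using g unfolding frechet_subdiff_def by auto
  show ?thesis
  proof (rule field_le_epsilon)
    fix e :: real assume e: "e > 0"
    define c where "c = e / norm (y - x)"
    have c: "c > 0" using e False by (simp add: c_def)
    have "\<forall>\<^sub>F z in at x. norm (\<rho> z) \<le> c * norm (norm (z - x))"
      using landau_o.smallD[OF \<rho> c] .
    with low have "\<forall>\<^sub>F z in at x. h z \<ge> h x + ereal (g \<bullet> (z - x) + \<rho> z) \<and> \<bar>\<rho> z\<bar> \<le> c * norm (z - x)"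
      by eventually_elim auto
    moreover have "filterlim (\<lambda>t. x + t *\<^sub>R (y - x)) (at x) (at_right (0::real))"
      unfolding filterlim_at
    proof
      have "((\<lambda>t. x + t *\<^sub>R (y - x)) \<longlongrightarrow> x + 0 *\<^sub>R (y - x)) (at_right (0::real))"
        by (intro tendsto_intros)
      then show "((\<lambda>t. x + t *\<^sub>R (y - x)) \<longlongrightarrow> x) (at_right (0::real))" by simp
      show "\<forall>\<^sub>F t in at_right (0::real). x + t *\<^sub>R (y - x) \<in> UNIV \<and> x + t *\<^sub>R (y - x) \<noteq> x"
        using False by (auto simp: eventually_at_filter)
    qed
    ultimately have "\<forall>\<^sub>F t in at_right (0::real). h (x + t *\<^sub>R (y - x)) \<ge> h x +
        ereal (g \<bullet> (x + t *\<^sub>R (y - x) - x) + \<rho> (x + t *\<^sub>R (y - x))) \<and>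
        \<bar>\<rho> (x + t *\<^sub>R (y - x))\<bar> \<le> c * norm (x + t *\<^sub>R (y - x) - x)"
      by (rule eventually_compose_filterlim)
    moreover have "\<forall>\<^sub>F t in at_right (0::real). 0 < t \<and> t < 1"
      by (auto simp: eventually_at intro!: exI[of _ 1])
    ultimately have "\<forall>\<^sub>F t in at_right (0::real). h (x + t *\<^sub>R (y - x)) \<ge> h x +
        ereal (g \<bullet> (x + t *\<^sub>R (y - x) - x) + \<rho> (x + t *\<^sub>R (y - x))) \<and>
        \<bar>\<rho> (x + t *\<^sub>R (y - x))\<bar> \<le> c * norm (x + t *\<^sub>R (y - x) - x) \<and> 0 < t \<and> t < 1"
      by eventually_elim auto
    then obtain t where t: "0 < t" "t < 1"
      and lo: "h (x + t *\<^sub>R (y - x)) \<ge> h x + ereal (g \<bullet> (t *\<^sub>R (y - x)) + \<rho> (x + t *\<^sub>R (y - x)))"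
      and rr: "\<bar>\<rho> (x + t *\<^sub>R (y - x))\<bar> \<le> c * (t * norm (y - x))"
      using eventually_happens'[of "at_right (0::real)"] by force
    have "(1 - t) *\<^sub>R (x, a) + t *\<^sub>R (y, b) \<in> {(y, t::real). h y \<le> ereal t}"
      using cv[unfolded ereal_convex_def] hx hy t by (intro convexD) auto
    then have "h (x + t *\<^sub>R (y - x)) \<le> ereal ((1 - t) * a + t * b)" by (simp add: algebra_simps)
    with lo have "h x + ereal (g \<bullet> (t *\<^sub>R (y - x)) + \<rho> (x + t *\<^sub>R (y - x))) \<le> ereal ((1 - t) * a + t * b)"
      by (rule order_trans)
    then have "a + t * (g \<bullet> (y - x)) + \<rho> (x + t *\<^sub>R (y - x)) \<le> (1 - t) * a + t * b"
      by (simp add: hx)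
    moreover have ct: "c * (t * norm (y - x)) = t * e" using False by (simp add: c_def)
    have "\<bar>\<rho> (x + t *\<^sub>R (y - x))\<bar> \<le> t * e" using rr unfolding ct .
    then have "- (t * e) \<le> \<rho> (x + t *\<^sub>R (y - x))" by linarith
    ultimately have "t * (a + g \<bullet> (y - x)) \<le> t * (b + e)"
      by (simp only: distrib_left left_diff_distrib mult_1)
    then show "a + g \<bullet> (y - x) \<le> b + e" using t by simp
  qed
qed

section \<open>Lipschitz bounds from bounded subgradients\<close>

lemma norm_convex_combination_sq:
  fixes a b :: "'a::real_inner"
  shows "(norm ((1 - t) *\<^sub>R a + t *\<^sub>R b))\<^sup>2
    = (1 - t) * (norm a)\<^sup>2 + t * (norm b)\<^sup>2 - t * (1 - t) * (norm (a - b))\<^sup>2"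
  by (simp only: power2_norm_eq_inner) (simp add: inner_simps inner_commute algebra_simps)

lemma convex_on_norm_sq:
  fixes x :: "'a::real_inner"
  assumes "convex S" "c \<ge> 0"
  shows "convex_on S (\<lambda>z. c * (norm (z - x))\<^sup>2)"
proof (rule convex_onI)
  fix t :: real and a b assume t: "0 < t" "t < 1"
  have e: "(1 - t) *\<^sub>R a + t *\<^sub>R b - x = (1 - t) *\<^sub>R (a - x) + t *\<^sub>R (b - x)" by (simp add: algebra_simps)
  have "(norm ((1 - t) *\<^sub>R a + t *\<^sub>R b - x))\<^sup>2 \<le> (1 - t) * (norm (a - x))\<^sup>2 + t * (norm (b - x))\<^sup>2"
    unfolding e norm_convex_combination_sq using t by simp
  then have "c * (norm ((1 - t) *\<^sub>R a + t *\<^sub>R b - x))\<^sup>2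
      \<le> c * ((1 - t) * (norm (a - x))\<^sup>2 + t * (norm (b - x))\<^sup>2)"
    using assms(2) by (rule mult_left_mono)
  then show "c * (norm ((1 - t) *\<^sub>R a + t *\<^sub>R b - x))\<^sup>2
      \<le> (1 - t) * (c * (norm (a - x))\<^sup>2) + t * (c * (norm (b - x))\<^sup>2)"
    by (simp add: algebra_simps)
qed (rule assms)

lemma convex_on_weak_mono:
  fixes x :: "'a::real_inner"
  assumes h: "convex_on S (\<lambda>z. h z + l / 2 * (norm (z - x))\<^sup>2)" and "l \<le> l'"
  shows "convex_on S (\<lambda>z. h z + l' / 2 * (norm (z - x))\<^sup>2)"
proof -
  have "convex_on S (\<lambda>z. (h z + l / 2 * (norm (z - x))\<^sup>2) + (l' - l) / 2 * (norm (z - x))\<^sup>2)"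
    using assms(2) by (intro convex_on_add[OF h] convex_on_norm_sq convex_on_imp_convex[OF h]) auto
  then show ?thesis by (simp add: algebra_simps diff_divide_distrib)
qed

text \<open>Cutting the segment into \<open>n\<close> equal pieces multiplies a quadratic error by \<open>1/n\<close>, so it disappears in
  the limit.\<close>

lemma locally_almost_lipschitz_imp_lipschitz:
  fixes h :: "'a::real_normed_vector \<Rightarrow> real"
  assumes X: "convex X" "y \<in> X" "z \<in> X" and d: "d > 0"
    and loc: "\<And>y z. y \<in> X \<Longrightarrow> z \<in> X \<Longrightarrow> norm (z - y) \<le> d \<Longrightarrow>
      h y - h z \<le> M * norm (z - y) + c * (norm (z - y))\<^sup>2"
  shows "h y - h z \<le> M * norm (z - y)"
proof -
  define N where "N = norm (z - y)"
  obtain n0 :: nat where n0: "N / d < real n0" using reals_Archimedean2 by blast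
  have bound: "h y - h z \<le> M * N + c * N\<^sup>2 / real n" if n: "n \<ge> Suc n0" for n
  proof -
    define p where "p i = y + (real i / real n) *\<^sub>R (z - y)" for i
    have n1: "real n > 0" "real n0 \<le> real n" using n by auto
    have pX: "p i \<in> X" if "i \<le> n" for i
    proof -
      have "real i / real n \<le> 1" using that n1 by simp
      then show ?thesis
        using convexD_alt[OF X, of "real i / real n"] by (simp add: p_def algebra_simps)
    qed
    have step: "norm (p (Suc i) - p i) = N / real n" for i
    proof -
      have "p (Suc i) - p i = (1 / real n) *\<^sub>R (z - y)"
        by (simp add: p_def add_divide_distrib scaleR_left_distrib)
      then show ?thesis using n1 by (simp add: N_def)
    qed
    have small: "N / real n \<le> d"
    proof -
      have "N < real n0 * d" using n0 d by (simp add: field_simps)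
      also have "\<dots> \<le> real n * d" using n1 d by simp
      finally show ?thesis using n1 by (simp add: field_simps)
    qed
    have "h y - h z = (\<Sum>i<n. h (p i) - h (p (Suc i)))"
      using n1 by (subst sum_lessThan_telescope') (simp add: p_def)
    also have "\<dots> \<le> (\<Sum>i<n. M * (N / real n) + c * (N / real n)\<^sup>2)"
    proof (rule sum_mono)
      fix i assume "i \<in> {..<n}"
      then show "h (p i) - h (p (Suc i)) \<le> M * (N / real n) + c * (N / real n)\<^sup>2"
        using loc[of "p i" "p (Suc i)"] pX[of i] pX[of "Suc i"] small unfolding step by auto
    qed
    also have "\<dots> = M * N + c * N\<^sup>2 / real n"
      using n1 by (simp add: field_simps power2_eq_square)
    finally show ?thesis .
  qed
  have "(\<lambda>n. M * N + (c * N\<^sup>2) * (1 / real n)) \<longlonglongrightarrow> M * N + (c * N\<^sup>2) * 0"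
    by (intro tendsto_intros lim_1_over_n)
  then have "(\<lambda>n. M * N + c * N\<^sup>2 / real n) \<longlonglongrightarrow> M * N" by simp
  then have "h y - h z \<le> M * N"
    by (rule tendsto_lowerbound) (use bound in \<open>auto simp: eventually_sequentially\<close>)
  then show ?thesis by (simp add: N_def)
qed

text \<open>Subgradients of a weakly convex function exist at every interior point, and each of them gives a
  one-sided Lipschitz estimate up to a quadratic error. The weak convexity constant therefore does not
  enter the Lipschitz constant; this matters because it has only a first moment.\<close>

lemma weakly_convex_bounded_subgradients_lipschitz:
  fixes h :: "'a::euclidean_space \<Rightarrow> real"
  assumes X: "convex X" "y \<in> X" "z \<in> X" and r: "r > 0"
    and wc: "\<And>y. y \<in> X \<Longrightarrow> convex_on (ball y r) (\<lambda>z. h z + l / 2 * (norm (z - y))\<^sup>2)"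
    and M: "\<And>y g. y \<in> X \<Longrightarrow> g \<in> frechet_subdiff (\<lambda>z. ereal (h z)) y \<Longrightarrow> norm g \<le> M"
  shows "\<bar>h y - h z\<bar> \<le> M * norm (y - z)"
proof -
  have one: "h y - h z \<le> M * norm (z - y)" if yz: "y \<in> X" "z \<in> X" for y z
  proof (rule locally_almost_lipschitz_imp_lipschitz[OF X(1) yz, of "r / 2" h M "l / 2"])
    fix y z assume yz: "y \<in> X" "z \<in> X" "norm (z - y) \<le> r / 2"
    obtain u where u: "\<And>z. z \<in> ball y r \<Longrightarrow>
        h y + l / 2 * (norm (y - y))\<^sup>2 + u \<bullet> (z - y) \<le> h z + l / 2 * (norm (z - y))\<^sup>2"
      using convex_on_subgradient_exists[OF r wc[OF yz(1)]] by metis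
    have "u \<in> frechet_subdiff (\<lambda>z. ereal (h z)) y"
      by (rule proximal_subgradient_in_frechet_subdiff[OF r, where c = "l / 2"]) (use u in auto)
    then have "norm u \<le> M" using M yz by blast
    then have "\<bar>u \<bullet> (z - y)\<bar> \<le> M * norm (z - y)"
      using Cauchy_Schwarz_ineq2[of u "z - y"] by (meson mult_right_mono norm_ge_zero order_trans)
    moreover have "z \<in> ball y r" using yz r by (simp add: dist_norm norm_minus_commute)
    ultimately show "h y - h z \<le> M * norm (z - y) + l / 2 * (norm (z - y))\<^sup>2"
      using u[of z] by auto
  qed (use r in auto)
  show ?thesis using one[OF X(2,3)] one[OF X(3,2)] by (simp add: norm_minus_commute)
qed

text \<open>A subgradient at a point of \<open>X\<close> is no longer than the oscillation of \<open>\<phi>\<close> on the unit neighbourhood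
  of \<open>X\<close>.\<close>

lemma convex_on_lipschitz_on_compact:
  fixes \<phi> :: "'a::euclidean_space \<Rightarrow> real"
  assumes \<phi>: "convex_on UNIV \<phi>" and X: "convex X" "compact X"
  obtains L where "L \<ge> 0" "\<And>y z. y \<in> X \<Longrightarrow> z \<in> X \<Longrightarrow> \<bar>\<phi> y - \<phi> z\<bar> \<le> L * norm (y - z)"
proof -
  define K where "K = {x + y | x y. x \<in> X \<and> y \<in> cball (0::'a) 1}"
  have "compact K" unfolding K_def using X by (intro compact_sums) auto
  moreover have "continuous_on UNIV \<phi>" using \<phi> by (intro convex_on_continuous) auto
  ultimately have "bounded (\<phi> ` K)"
    by (meson compact_continuous_image compact_imp_bounded continuous_on_subset subset_UNIV)
  then obtain b where b: "\<And>x. x \<in> K \<Longrightarrow> \<bar>\<phi> x\<bar> \<le> b"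
    unfolding bounded_iff by auto
  define L where "L = max 0 (2 * b)"
  have one: "\<phi> y - \<phi> z \<le> L * norm (z - y)" if yz: "y \<in> X" "z \<in> X" for y z
  proof (rule locally_almost_lipschitz_imp_lipschitz[OF X(1) yz, of 1 \<phi> L 0])
    fix y z assume yz: "y \<in> X" "z \<in> X" "norm (z - y) \<le> 1"
    obtain u where u: "\<And>z. z \<in> ball y 2 \<Longrightarrow> \<phi> y + u \<bullet> (z - y) \<le> \<phi> z"
      using convex_on_subgradient_exists[of 2 y \<phi>] convex_on_subset[OF \<phi>] by auto
    have "norm u \<le> L"
    proof (cases "u = 0")
      case False
      have n: "norm ((1 / norm u) *\<^sub>R u) = 1" using False by simp
      then have "y + (1 / norm u) *\<^sub>R u \<in> ball y 2" by (simp add: dist_norm del: norm_scaleR)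
      then have "\<phi> y + norm u \<le> \<phi> (y + (1 / norm u) *\<^sub>R u)"
        using u[of "y + (1 / norm u) *\<^sub>R u"] False
        by (simp add: power2_norm_eq_inner[symmetric] power2_eq_square)
      moreover have "y + (1 / norm u) *\<^sub>R u \<in> K" unfolding K_def
        using yz(1) n by (intro CollectI exI[of _ y] exI[of _ "(1 / norm u) *\<^sub>R u"] conjI refl)
          (simp_all only: mem_cball_0)
      moreover have "y + 0 \<in> K" unfolding K_def using yz(1) by fastforce
      ultimately show ?thesis using b[of y] b[of "y + (1 / norm u) *\<^sub>R u"]
        unfolding L_def by (simp add: abs_le_iff max_def)
    qed (simp add: L_def)
    then have "\<bar>u \<bullet> (z - y)\<bar> \<le> L * norm (z - y)"
      using Cauchy_Schwarz_ineq2[of u "z - y"] by (meson mult_right_mono norm_ge_zero order_trans)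
    moreover have "z \<in> ball y 2" using yz by (simp add: dist_norm norm_minus_commute)
    ultimately show "\<phi> y - \<phi> z \<le> L * norm (z - y) + 0 * (norm (z - y))\<^sup>2"
      using u[of z] by auto
  qed auto
  show thesis
  proof (rule that[of L])
    show "L \<ge> 0" by (simp add: L_def)
    fix y z assume "y \<in> X" "z \<in> X"
    then show "\<bar>\<phi> y - \<phi> z\<bar> \<le> L * norm (y - z)"
      using one[of y z] one[of z y] by (simp add: norm_minus_commute)
  qed
qed

section \<open>One proximal step on a convex model\<close>

text \<open>The subproblem is \<open>1/\<alpha>\<close>-strongly convex, so any competitor \<open>y\<close> loses at least the corresponding
  quadratic term against the minimiser \<open>x'\<close>. The value at \<open>x'\<close> is bounded below by its linearisation
  at \<open>x\<close>; since \<open>x'\<close> pays \<open>|x' - x|\<^sup>2 / (2\<alpha>)\<close> for moving, the decrease that a slope of at most \<open>M + L\<close>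
  permits is of order \<open>\<alpha>\<close>, which becomes \<open>\<alpha>\<^sup>2\<close> after multiplication by \<open>2\<alpha>\<close>.\<close>

lemma convex_prox_step_inequality:
  fixes h :: "'a::euclidean_space \<Rightarrow> ereal"
  assumes X: "convex X" "x \<in> X" "y \<in> X" and \<alpha>: "\<alpha> > 0"
    and step: "is_arg_min (\<lambda>y. h y + ereal (\<phi> y) + ereal (1 / (2 * \<alpha>) * (norm (y - x))\<^sup>2)) (\<lambda>y. y \<in> X) x'"
    and cv: "ereal_convex h" and ninf: "\<And>y. h y \<noteq> -\<infinity>"
    and hx: "h x = ereal fx" and hy: "h y \<le> ereal b"
    and g: "g \<in> frechet_subdiff h x" "norm g \<le> M"
    and \<phi>: "convex_on UNIV \<phi>" and L: "\<And>y z. y \<in> X \<Longrightarrow> z \<in> X \<Longrightarrow> \<bar>\<phi> y - \<phi> z\<bar> \<le> L * norm (y - z)"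
  shows "(norm (y - x'))\<^sup>2 \<le> (norm (y - x))\<^sup>2 - 2 * \<alpha> * (fx + \<phi> x - b - \<phi> y) + \<alpha>\<^sup>2 * (M + L)\<^sup>2"
proof -
  define q where "q = 1 / (2 * \<alpha>)"
  have q: "q > 0" using \<alpha> by (simp add: q_def)
  have x'X: "x' \<in> X"
    and mini: "\<And>z. z \<in> X \<Longrightarrow> h x' + ereal (\<phi> x') + ereal (q * (norm (x' - x))\<^sup>2)
      \<le> h z + ereal (\<phi> z) + ereal (q * (norm (z - x))\<^sup>2)"
    using step unfolding is_arg_min_def q_def[symmetric] by (auto simp: not_less)
  have "h x' + ereal (\<phi> x') + ereal (q * (norm (x' - x))\<^sup>2) < \<infinity>"
    using order.strict_trans1[OF mini[OF X(2)], of \<infinity>] by (simp add: hx)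
  then obtain a where a: "h x' = ereal a" using ninf[of x'] by (cases "h x'") auto
  have mini': "a + \<phi> x' + q * (norm (x' - x))\<^sup>2 \<le> c + \<phi> z + q * (norm (z - x))\<^sup>2"
    if "z \<in> X" "h z \<le> ereal c" for z c
  proof -
    have "ereal (a + \<phi> x' + q * (norm (x' - x))\<^sup>2) \<le> h z + ereal (\<phi> z) + ereal (q * (norm (z - x))\<^sup>2)"
      using mini[OF that(1)] by (simp add: a)
    also have "\<dots> \<le> ereal c + ereal (\<phi> z) + ereal (q * (norm (z - x))\<^sup>2)"
      using that(2) by (intro add_mono) auto
    finally show ?thesis by simp
  qed
  define A where "A = a + \<phi> x' + q * (norm (x' - x))\<^sup>2"
  define B where "B = b + \<phi> y + q * (norm (y - x))\<^sup>2"
  define d where "d = q * (norm (x' - y))\<^sup>2"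
  have d0: "d \<ge> 0" using q by (simp add: d_def)
  \<comment> \<open>Strong convexity at the minimiser: compare \<open>x'\<close> with points of the segment from \<open>x'\<close> to \<open>y\<close>.\<close>
  have three: "A + (1 - t) * d \<le> B" if t: "0 < t" "t < 1" for t
  proof -
    let ?z = "(1 - t) *\<^sub>R x' + t *\<^sub>R y"
    have zX: "?z \<in> X" using X x'X t by (intro convexD) auto
    have "(1 - t) *\<^sub>R (x', a) + t *\<^sub>R (y, b) \<in> {(y, t::real). h y \<le> ereal t}"
      using cv[unfolded ereal_convex_def] a hy t by (intro convexD) auto
    then have "h ?z \<le> ereal ((1 - t) * a + t * b)" by simp
    then have "A \<le> (1 - t) * a + t * b + \<phi> ?z + q * (norm (?z - x))\<^sup>2"
      using mini'[OF zX] by (simp add: A_def)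
    moreover have "\<phi> ?z \<le> (1 - t) * \<phi> x' + t * \<phi> y"
      using convex_onD[OF \<phi>] t by auto
    moreover have "?z - x = (1 - t) *\<^sub>R (x' - x) + t *\<^sub>R (y - x)" by (simp add: algebra_simps)
    then have nz: "(norm (?z - x))\<^sup>2 = (1 - t) * (norm (x' - x))\<^sup>2 + t * (norm (y - x))\<^sup>2
        - t * (1 - t) * (norm (x' - y))\<^sup>2"
      by (simp add: norm_convex_combination_sq)
    then have "q * (norm (?z - x))\<^sup>2 = (1 - t) * (q * (norm (x' - x))\<^sup>2) + t * (q * (norm (y - x))\<^sup>2)
        - t * (1 - t) * d"
      unfolding nz d_def by (simp only: algebra_simps)
    ultimately have "A \<le> (1 - t) * A + t * B - t * (1 - t) * d"
      by (simp add: A_def B_def algebra_simps)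
    then have "t * (A + (1 - t) * d) \<le> t * B" by (simp add: algebra_simps)
    then show ?thesis using t by simp
  qed
  have "A + d \<le> B"
  proof (rule field_le_epsilon)
    fix e :: real assume e: "e > 0"
    define t where "t = min (1 / 2) (e / (d + 1))"
    have "t * d \<le> e / (d + 1) * d" using d0 by (intro mult_right_mono) (auto simp: t_def)
    also have "\<dots> \<le> e" using d0 e by (simp add: field_simps)
    finally have "t * d \<le> e" .
    moreover have "0 < t" "t < 1" using e d0 by (auto simp: t_def)
    ultimately show "A + d \<le> B + e" using three[of t] by (simp add: algebra_simps)
  qed
  moreover have "A \<ge> fx + \<phi> x - \<alpha> / 2 * (M + L)\<^sup>2"
  proof -
    let ?n = "norm (x' - x)"
    have "fx + g \<bullet> (x' - x) \<le> a"
      using ereal_convex_frechet_subgradient_ineq[OF cv hx _ g(1)] a by simp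
    moreover have "\<bar>g \<bullet> (x' - x)\<bar> \<le> M * ?n"
      using Cauchy_Schwarz_ineq2[of g "x' - x"] g(2) by (meson mult_right_mono norm_ge_zero order_trans)
    moreover have "\<bar>\<phi> x' - \<phi> x\<bar> \<le> L * ?n" using L x'X X by blast
    moreover have "0 \<le> q * (?n - \<alpha> * (M + L))\<^sup>2" using q by simp
    then have "0 \<le> q * ?n\<^sup>2 - (M + L) * ?n + \<alpha> / 2 * (M + L)\<^sup>2"
      using \<alpha> by (simp add: q_def power2_eq_square field_simps)
    then have "- (M * ?n) - L * ?n + q * ?n\<^sup>2 \<ge> - (\<alpha> / 2 * (M + L)\<^sup>2)" by (simp add: algebra_simps)
    ultimately show ?thesis by (simp add: A_def)
  qed
  ultimately have "q * (norm (x' - y))\<^sup>2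
      \<le> q * (norm (y - x))\<^sup>2 - (fx + \<phi> x - b - \<phi> y) + \<alpha> / 2 * (M + L)\<^sup>2"
    by (simp add: B_def d_def)
  then have "2 * \<alpha> * (q * (norm (x' - y))\<^sup>2)
      \<le> 2 * \<alpha> * (q * (norm (y - x))\<^sup>2 - (fx + \<phi> x - b - \<phi> y) + \<alpha> / 2 * (M + L)\<^sup>2)"
    using \<alpha> by (intro mult_left_mono) auto
  moreover have "2 * \<alpha> * (q * w) = w" for w using \<alpha> by (simp add: q_def)
  moreover have "2 * \<alpha> * (\<alpha> / 2 * w) = \<alpha>\<^sup>2 * w" for w by (simp add: power2_eq_square)
  ultimately show ?thesis
    by (simp only: distrib_left[of "2 * \<alpha>"] right_diff_distrib[of "2 * \<alpha>"] norm_minus_commute[of y x'])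
qed

section \<open>The Moreau envelope on a compact set\<close>

definition moreau_env :: "'a::real_normed_vector set \<Rightarrow> ('a \<Rightarrow> real) \<Rightarrow> real \<Rightarrow> 'a \<Rightarrow> real" where
  "moreau_env X F \<rho> x = (INF y\<in>X. F y + \<rho> / 2 * (norm (y - x))\<^sup>2)"

lemma moreau_env_attained:
  fixes X :: "'a::euclidean_space set"
  assumes X: "compact X" "X \<noteq> {}" and F: "continuous_on X F"
  obtains y where "y \<in> X" "moreau_env X F \<rho> x = F y + \<rho> / 2 * (norm (y - x))\<^sup>2"
    and "\<And>z. z \<in> X \<Longrightarrow> moreau_env X F \<rho> x \<le> F z + \<rho> / 2 * (norm (z - x))\<^sup>2"
proof -
  have "continuous_on X (\<lambda>y. F y + \<rho> / 2 * (norm (y - x))\<^sup>2)" by (intro continuous_intros F)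
  then obtain y where y: "y \<in> X"
    "\<And>z. z \<in> X \<Longrightarrow> F y + \<rho> / 2 * (norm (y - x))\<^sup>2 \<le> F z + \<rho> / 2 * (norm (z - x))\<^sup>2"
    using continuous_attains_inf[OF X] by blast
  then have "moreau_env X F \<rho> x = F y + \<rho> / 2 * (norm (y - x))\<^sup>2"
    unfolding moreau_env_def by (intro cInf_eq_minimum) auto
  then show thesis using that y by metis
qed

lemma moreau_env_le:
  fixes X :: "'a::euclidean_space set"
  assumes "compact X" "continuous_on X F" "z \<in> X"
  shows "moreau_env X F \<rho> x \<le> F z + \<rho> / 2 * (norm (z - x))\<^sup>2"
  using moreau_env_attained[OF assms(1) _ assms(2), of \<rho> x] assms(3) by blast

text \<open>Up to the term \<open>\<rho>/2 |x|\<^sup>2\<close> the envelope is an infimum of affine functions of \<open>x\<close> with slopes bounded by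
  \<open>\<rho>\<close> times the size of \<open>X\<close>.\<close>

lemma continuous_on_moreau_env:
  fixes X :: "'a::euclidean_space set"
  assumes X: "compact X" "X \<noteq> {}" and F: "continuous_on X F" and \<rho>: "\<rho> \<ge> 0"
  shows "continuous_on UNIV (moreau_env X F \<rho>)"
proof -
  obtain R where R: "\<And>y. y \<in> X \<Longrightarrow> norm y \<le> R"
    using compact_imp_bounded[OF X(1)] by (auto simp: bounded_iff)
  define \<psi> where "\<psi> x = moreau_env X F \<rho> x - \<rho> / 2 * (norm x)\<^sup>2" for x
  have aff: "F y + \<rho> / 2 * (norm (y - x))\<^sup>2
      = (F y + \<rho> / 2 * (norm y)\<^sup>2 - \<rho> * (y \<bullet> x)) + \<rho> / 2 * (norm x)\<^sup>2" for x y
    by (simp only: power2_norm_eq_inner) (simp add: inner_simps inner_commute field_simps)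
  have one: "\<psi> x \<le> \<psi> z + \<rho> * R * norm (x - z)" for x z
  proof -
    obtain y where y: "y \<in> X" "moreau_env X F \<rho> z = F y + \<rho> / 2 * (norm (y - z))\<^sup>2"
      using moreau_env_attained[OF X F] by metis
    have "\<psi> x \<le> F y + \<rho> / 2 * (norm y)\<^sup>2 - \<rho> * (y \<bullet> x)"
      using moreau_env_le[OF X(1) F y(1), of \<rho> x] unfolding aff \<psi>_def by simp
    moreover have "\<psi> z = F y + \<rho> / 2 * (norm y)\<^sup>2 - \<rho> * (y \<bullet> z)"
      using y(2) unfolding aff \<psi>_def by simp
    moreover have "\<rho> * (y \<bullet> z - y \<bullet> x) \<le> \<rho> * (R * norm (x - z))"
    proof (rule mult_left_mono[OF _ \<rho>])
      have "\<bar>y \<bullet> (z - x)\<bar> \<le> R * norm (z - x)"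
        using Cauchy_Schwarz_ineq2[of y "z - x"] R[OF y(1)]
        by (meson mult_right_mono norm_ge_zero order_trans)
      then show "y \<bullet> z - y \<bullet> x \<le> R * norm (x - z)"
        by (simp add: inner_diff_right norm_minus_commute)
    qed
    ultimately show ?thesis by (simp add: algebra_simps)
  qed
  have "(\<rho> * R)-lipschitz_on UNIV \<psi>"
  proof (rule lipschitz_onI)
    fix x z
    show "dist (\<psi> x) (\<psi> z) \<le> \<rho> * R * dist x z"
      using one[of x z] one[of z x] by (simp add: dist_norm norm_minus_commute abs_le_iff)
    show "0 \<le> \<rho> * R" using X(2) R \<rho> by (metis all_not_in_conv mult_nonneg_nonneg norm_ge_zero order_trans)
  qed
  then have "continuous_on UNIV (\<lambda>x. \<psi> x + \<rho> / 2 * (norm x)\<^sup>2)"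
    by (intro continuous_intros lipschitz_on_continuous_on)
  then show ?thesis by (simp add: \<psi>_def)
qed

lemma moreau_env_gap_bounds:
  fixes X :: "'a::euclidean_space set"
  assumes X: "compact X" "x \<in> X" and F: "continuous_on X F" and \<rho>: "\<rho> > 0"
    and L: "\<And>y z. y \<in> X \<Longrightarrow> z \<in> X \<Longrightarrow> \<bar>F y - F z\<bar> \<le> L * norm (y - z)"
  shows "moreau_env X F \<rho> x \<le> F x" "F x - moreau_env X F \<rho> x \<le> L\<^sup>2 / (2 * \<rho>)"
proof -
  show "moreau_env X F \<rho> x \<le> F x" using moreau_env_le[OF X(1) F X(2), of \<rho> x] by simp
  obtain y where y: "y \<in> X" "moreau_env X F \<rho> x = F y + \<rho> / 2 * (norm (y - x))\<^sup>2"
    using moreau_env_attained[OF X(1) _ F] X(2) by blast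
  let ?n = "norm (y - x)"
  have "F x - F y \<le> L * ?n" using L[OF X(2) y(1)] by (simp add: norm_minus_commute)
  moreover have "0 \<le> (\<rho> * ?n - L)\<^sup>2 / (2 * \<rho>)" using \<rho> by simp
  then have "L * ?n - \<rho> / 2 * ?n\<^sup>2 \<le> L\<^sup>2 / (2 * \<rho>)"
    using \<rho> by (simp add: power2_eq_square field_simps)
  ultimately show "F x - moreau_env X F \<rho> x \<le> L\<^sup>2 / (2 * \<rho>)" using y(2) by linarith
qed

text \<open>Proximal points may be replaced, at an arbitrarily small cost, by members of a fixed countable
  set. Choosing the first suitable member is a measurable selection that takes countably many values,
  so it can be inserted into \<open>f (\<cdot>) s\<close> although \<open>f\<close> is measurable only in \<open>s\<close>. The
  Lipschitz constant keeps the proximal point within \<open>2 L / \<rho>\<close> of \<open>x\<close>.\<close>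

lemma moreau_env_approx_minimizer_in_dense_sequence:
  fixes X :: "'a::euclidean_space set"
  assumes X: "compact X" "x \<in> X" and F: "continuous_on X F" and \<rho>: "\<rho> > 0"
    and L: "\<And>y z. y \<in> X \<Longrightarrow> z \<in> X \<Longrightarrow> \<bar>F y - F z\<bar> \<le> L * norm (y - z)"
    and L0: "L \<ge> 0" and r: "2 * L / \<rho> < r" and \<eta>: "\<eta> > 0"
    and p: "range p \<subseteq> X" "X \<subseteq> closure (range p)"
  shows "\<exists>n::nat. norm (p n - x) < r \<and> F (p n) + \<rho> / 2 * (norm (p n - x))\<^sup>2 < moreau_env X F \<rho> x + \<eta>"
proof -
  obtain y where y: "y \<in> X" "moreau_env X F \<rho> x = F y + \<rho> / 2 * (norm (y - x))\<^sup>2"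
    using moreau_env_attained[OF X(1) _ F] X(2) by blast
  have "0 \<le> 2 * L / \<rho>" using L0 \<rho> by simp
  then have "r > 0" using r by linarith
  have "norm (y - x) < r"
  proof (cases "y = x")
    case False
    have "\<rho> / 2 * (norm (y - x))\<^sup>2 \<le> F x - F y"
      using moreau_env_le[OF X(1) F X(2), of \<rho> x] y(2) by simp
    also have "\<dots> \<le> L * norm (y - x)" using L[OF X(2) y(1)] by (simp add: norm_minus_commute)
    finally have "\<rho> / 2 * norm (y - x) \<le> L" using False by (simp add: power2_eq_square)
    then have "norm (y - x) \<le> 2 * L / \<rho>" using \<rho> by (simp add: field_simps)
    then show ?thesis using r by simp
  qed (use \<open>r > 0\<close> in simp)
  moreover have "y \<in> closure (range p)" using p y by blast
  then obtain k where k: "\<And>n. k n \<in> range p" "k \<longlonglongrightarrow> y" unfolding closure_sequential by blast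
  have "\<forall>\<^sub>F n in sequentially. k n \<in> X"
    by (rule always_eventually) (use k(1) p(1) in blast)
  then have "((\<lambda>n. F (k n)) \<longlongrightarrow> F y) sequentially"
    by (rule continuous_on_tendsto_compose[OF F k(2) y(1)])
  then have "(\<lambda>n. F (k n) + \<rho> / 2 * (norm (k n - x))\<^sup>2) \<longlonglongrightarrow> F y + \<rho> / 2 * (norm (y - x))\<^sup>2"
    by (intro tendsto_intros k)
  moreover have "(\<lambda>n. norm (k n - x)) \<longlonglongrightarrow> norm (y - x)" by (intro tendsto_intros k)
  ultimately have "\<forall>\<^sub>F n in sequentially. norm (k n - x) < r"
    "\<forall>\<^sub>F n in sequentially. F (k n) + \<rho> / 2 * (norm (k n - x))\<^sup>2 < moreau_env X F \<rho> x + \<eta>"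
    using order_tendstoD(2) y(2) \<eta> by force+
  then have "\<forall>\<^sub>F n in sequentially. norm (k n - x) < r \<and>
    F (k n) + \<rho> / 2 * (norm (k n - x))\<^sup>2 < moreau_env X F \<rho> x + \<eta>"
    by eventually_elim auto
  then obtain n where "norm (k n - x) < r" "F (k n) + \<rho> / 2 * (norm (k n - x))\<^sup>2 < moreau_env X F \<rho> x + \<eta>"
    using eventually_happens' sequentially_bot by blast
  then show ?thesis using k(1)[of n] by auto
qed

text \<open>If \<open>x\<close> is its own proximal point, it minimises over \<open>X\<close> the sum of the locally convex function
  \<open>risk + \<rho>/2 |\<cdot> - x|\<^sup>2\<close> and \<open>\<phi>\<close>. The quadratic term is of second order at \<open>x\<close>, so a subgradient of the
  first summand is a Frechet subgradient of the risk itself.\<close>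

lemma moreau_env_fixed_point_stationary:
  fixes X :: "'a::euclidean_space set" and f :: "'a \<Rightarrow> 's \<Rightarrow> real"
  assumes X: "convex X" "compact X" "x \<in> X" and r: "r > 0"
    and wc: "convex_on (ball x r) (\<lambda>z. risk P f z + l / 2 * (norm (z - x))\<^sup>2)" and l: "l \<le> \<rho>"
    and \<phi>: "convex_on UNIV \<phi>" and F: "continuous_on X (objective P f \<phi>)"
    and fix_pt: "moreau_env X (objective P f \<phi>) \<rho> x = objective P f \<phi> x"
  shows "x \<in> stationary_set P X f \<phi>"
proof -
  have cv: "convex_on (ball x r) (\<lambda>z. risk P f z + \<rho> / 2 * (norm (z - x))\<^sup>2)"
    by (rule convex_on_weak_mono[OF wc l])
  have \<phi>b: "convex_on (ball x r) \<phi>" using \<phi> by (rule convex_on_subset) auto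
  obtain u v where u: "\<And>z. z \<in> ball x r \<Longrightarrow>
        risk P f x + \<rho> / 2 * (norm (x - x))\<^sup>2 + u \<bullet> (z - x) \<le> risk P f z + \<rho> / 2 * (norm (z - x))\<^sup>2"
    and v: "\<And>z. z \<in> ball x r \<Longrightarrow> \<phi> x + v \<bullet> (z - x) \<le> \<phi> z"
    and uv: "\<And>y. y \<in> X \<Longrightarrow> 0 \<le> (u + v) \<bullet> (y - x)"
  proof (rule convex_sum_rule_at_minimizer[OF X(1,3) r cv \<phi>b])
    fix y assume "y \<in> X \<inter> ball x r"
    then show "risk P f x + \<rho> / 2 * (norm (x - x))\<^sup>2 + \<phi> x
        \<le> risk P f y + \<rho> / 2 * (norm (y - x))\<^sup>2 + \<phi> y"
      using moreau_env_le[OF X(2) F, of y \<rho> x] fix_pt by (simp add: objective_def)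
  qed metis
  have "u \<in> frechet_subdiff (\<lambda>z. ereal (risk P f z)) x"
    by (rule proximal_subgradient_in_frechet_subdiff[OF r, where c = "\<rho> / 2"]) (use u in auto)
  moreover have "v \<in> frechet_subdiff (\<lambda>z. ereal (\<phi> z)) x"
    by (rule proximal_subgradient_in_frechet_subdiff[OF r, where c = 0]) (use v in auto)
  ultimately show ?thesis unfolding stationary_set_def using X(3) uv by blast
qed

section \<open>Almost sure convergence of bounded supermartingales\<close>

text \<open>The strategy behind Doob's upcrossing inequality: buy when the price \<open>y\<close> is at most \<open>a\<close>, sell when it
  is at least \<open>b\<close>. Whether the asset is held from time \<open>n\<close> to time \<open>n + 1\<close> is decided by the prices up to
  time \<open>n\<close>.\<close>

primrec holding :: "real \<Rightarrow> real \<Rightarrow> (nat \<Rightarrow> real) \<Rightarrow> nat \<Rightarrow> bool" where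
  "holding a b y 0 = (y 0 \<le> a)"
| "holding a b y (Suc n) = (if holding a b y n then y (Suc n) < b else y (Suc n) \<le> a)"

definition gain :: "real \<Rightarrow> real \<Rightarrow> (nat \<Rightarrow> real) \<Rightarrow> nat \<Rightarrow> real" where
  "gain a b y n = (\<Sum>k<n. of_bool (holding a b y k) * (y (Suc k) - y k))"

definition upcrossings :: "real \<Rightarrow> real \<Rightarrow> (nat \<Rightarrow> real) \<Rightarrow> nat \<Rightarrow> nat" where
  "upcrossings a b y n = (\<Sum>k<n. of_bool (holding a b y k \<and> \<not> holding a b y (Suc k)))"

lemma holding_if_below: "a < b \<Longrightarrow> y n \<le> a \<Longrightarrow> holding a b y n"
  by (cases n) auto

lemma not_holding_if_above: "a < b \<Longrightarrow> b \<le> y n \<Longrightarrow> \<not> holding a b y n"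
  by (cases n) auto

lemma gain_Suc: "gain a b y (Suc n) = gain a b y n + of_bool (holding a b y n) * (y (Suc n) - y n)"
  by (simp add: gain_def)

lemma upcrossings_Suc:
  "upcrossings a b y (Suc n) = upcrossings a b y n + of_bool (holding a b y n \<and> \<not> holding a b y (Suc n))"
  unfolding upcrossings_def by (simp only: sum.lessThan_Suc)

text \<open>Each completed upcrossing earns \<open>b - a\<close>, and the asset still held was bought at a price of at most \<open>a\<close>.\<close>

lemma gain_ge_upcrossings:
  assumes "a < b"
  shows "gain a b y n \<ge> (b - a) * real (upcrossings a b y n) + of_bool (holding a b y n) * (y n - a)"
proof (induction n)
  case 0
  then show ?case by (simp add: gain_def upcrossings_def)
next
  case (Suc n)
  show ?case
  proof (cases "holding a b y n")
    case True
    then show ?thesis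
      using Suc.IH by (cases "y (Suc n) < b") (simp_all add: gain_Suc upcrossings_Suc distrib_left)
  next
    case False
    then show ?thesis
      using Suc.IH by (cases "y (Suc n) \<le> a") (simp_all add: gain_Suc upcrossings_Suc)
  qed
qed

lemma gain_ge:
  assumes "a < b" "y n \<ge> 0"
  shows "gain a b y n \<ge> - \<bar>a\<bar>"
proof -
  have "0 \<le> (b - a) * real (upcrossings a b y n)" using assms by simp
  moreover have "- \<bar>a\<bar> \<le> of_bool (holding a b y n) * (y n - a)" using assms by auto
  ultimately show ?thesis using gain_ge_upcrossings[OF assms(1), of y n] by linarith
qed

lemma upcrossings_mono: "m \<le> n \<Longrightarrow> upcrossings a b y m \<le> upcrossings a b y n"
  unfolding upcrossings_def by (intro sum_mono2) auto

lemma gain_at_top_if_oscillating: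
  assumes ab: "a < b" and y: "\<And>n. y n \<ge> 0"
    and lo: "\<exists>\<^sub>\<infinity>n. y n \<le> a" and hi: "\<exists>\<^sub>\<infinity>n. b \<le> y n"
  shows "filterlim (gain a b y) at_top sequentially"
proof -
  have "\<exists>n. upcrossings a b y n \<ge> N" for N
  proof (induction N)
    case (Suc N)
    then obtain n where n: "upcrossings a b y n \<ge> N" by blast
    obtain k where k: "k \<ge> n" "y k \<le> a" using lo unfolding INFM_nat_le by blast
    obtain j where j: "j \<ge> k" "b \<le> y j" using hi unfolding INFM_nat_le by blast
    have hk: "holding a b y k" and hj: "\<not> holding a b y j"
      using holding_if_below[of a b y k] not_holding_if_above[of a b y j] ab k(2) j(2) by auto
    have "\<exists>i\<ge>k. holding a b y i \<and> \<not> holding a b y (Suc i)"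
    proof (rule ccontr)
      assume none: "\<not> ?thesis"
      have "holding a b y i" if "i \<ge> k" for i
        using that by (induction rule: dec_induct) (use hk none in blast)+
      then show False using hj j(1) by blast
    qed
    then obtain i where i: "i \<ge> k" "holding a b y i" "\<not> holding a b y (Suc i)" by blast
    have "upcrossings a b y (Suc i) = upcrossings a b y i + 1"
      using i by (simp only: upcrossings_Suc) simp
    moreover have "upcrossings a b y i \<ge> N" using upcrossings_mono[of n i] i k n by (meson order_trans)
    ultimately show ?case by (intro exI[of _ "Suc i"]) simp
  qed simp
  note unb = this
  have low: "(b - a) * real (upcrossings a b y n) - \<bar>a\<bar> \<le> gain a b y n" for n
  proof -
    have "- \<bar>a\<bar> \<le> of_bool (holding a b y n) * (y n - a)" using y[of n] by auto
    then show ?thesis using gain_ge_upcrossings[OF ab, of y n] by linarith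
  qed
  show ?thesis
    unfolding filterlim_at_top
  proof
    fix Z :: real
    obtain N :: nat where N: "(Z + \<bar>a\<bar>) / (b - a) < real N" using reals_Archimedean2 by blast
    obtain n where n: "upcrossings a b y n \<ge> N" using unb by blast
    have "Z \<le> gain a b y k" if "k \<ge> n" for k
    proof -
      have "real N \<le> real (upcrossings a b y k)" using n upcrossings_mono[OF that, of a b y] by linarith
      then have "(b - a) * real N \<le> (b - a) * real (upcrossings a b y k)"
        using ab by (intro mult_left_mono) auto
      moreover have "Z + \<bar>a\<bar> < (b - a) * real N" using N ab by (simp add: field_simps)
      ultimately show ?thesis using low[of k] by linarith
    qed
    then show "\<forall>\<^sub>F n in sequentially. Z \<le> gain a b y n" unfolding eventually_sequentially by blast
  qed
qed

lemma convergent_if_no_rational_oscillation: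
  fixes y :: "nat \<Rightarrow> real"
  assumes K: "\<And>n. 0 \<le> y n" "\<And>n. y n \<le> K"
    and osc: "\<And>a b. a \<in> \<rat> \<Longrightarrow> b \<in> \<rat> \<Longrightarrow> a < b \<Longrightarrow> \<not> ((\<exists>\<^sub>\<infinity>n. y n \<le> a) \<and> (\<exists>\<^sub>\<infinity>n. b \<le> y n))"
  shows "convergent y"
proof -
  let ?l = "liminf (\<lambda>n. ereal (y n))" and ?u = "limsup (\<lambda>n. ereal (y n))"
  have "?l \<le> ?u" by (rule Liminf_le_Limsup) simp
  moreover have "\<not> ?l < ?u"
  proof
    assume "?l < ?u"
    then obtain c where c: "?l < ereal c" "ereal c < ?u" using ereal_dense2 by blast
    obtain d where d: "ereal c < ereal d" "ereal d < ?u" using ereal_dense2[OF c(2)] by blast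
    have cd: "c < d" using d by simp
    then obtain a where a: "a \<in> \<rat>" "c < a" "a < d" using Rats_dense_in_real by blast
    then obtain b where b: "b \<in> \<rat>" "a < b" "b < d" using Rats_dense_in_real by blast
    have "\<exists>\<^sub>\<infinity>n. y n \<le> a"
    proof (rule ccontr)
      assume "\<not> ?thesis"
      then have "\<forall>\<^sub>F n in sequentially. ereal a \<le> ereal (y n)"
        unfolding frequently_def cofinite_eq_sequentially by (auto elim: eventually_mono)
      then have "ereal a \<le> ?l" by (rule Liminf_bounded)
      then have "ereal a < ereal c" using c(1) by (rule le_less_trans)
      then show False using a by simp
    qed
    moreover have "\<exists>\<^sub>\<infinity>n. b \<le> y n"
    proof (rule ccontr)
      assume "\<not> ?thesis"
      then have "\<forall>\<^sub>F n in sequentially. ereal (y n) \<le> ereal b"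
        unfolding frequently_def cofinite_eq_sequentially by (auto elim: eventually_mono)
      then have "?u \<le> ereal b" by (rule Limsup_bounded)
      with d(2) have "ereal d < ereal b" by (rule less_le_trans)
      then show False using b by simp
    qed
    ultimately show False using osc a b by blast
  qed
  ultimately have eq: "?l = ?u" by simp
  have "0 \<le> ?l" by (rule Liminf_bounded) (simp add: K)
  moreover have "?u \<le> ereal K" by (rule Limsup_bounded) (simp add: K)
  ultimately have "?l \<noteq> \<infinity>" "?l \<noteq> - \<infinity>" using eq by auto
  then obtain L where L: "?l = ereal L" by (cases ?l) auto
  have "(\<lambda>n. ereal (y n)) \<longlonglongrightarrow> ereal L"
    using eq L by (intro Liminf_eq_Limsup) auto
  then show ?thesis unfolding convergent_def by auto
qed

text \<open>The strategy earns nothing on average against a supermartingale and never loses more than \<open>|a|\<close>. On a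
  path that oscillates across \<open>[a, b]\<close> forever its gain tends to infinity, so by Fatou's lemma such
  paths are negligible. The supermartingale property is stated by integrals over events of the past,
  which avoids conditional expectations.\<close>

lemma (in prob_space) bounded_supermartingale_AE_convergent:
  fixes Y :: "nat \<Rightarrow> 'a \<Rightarrow> real"
  assumes G: "\<And>k. subalgebra M (G k)" "\<And>k. sets (G k) \<subseteq> sets (G (Suc k))"
    and Y: "\<And>k. Y k \<in> borel_measurable (G k)"
    and bnd: "\<And>k \<omega>. \<omega> \<in> space M \<Longrightarrow> 0 \<le> Y k \<omega>" "\<And>k \<omega>. \<omega> \<in> space M \<Longrightarrow> Y k \<omega> \<le> K"
    and super: "\<And>k A. A \<in> sets (G k) \<Longrightarrow> (LINT \<omega>|M. indicator A \<omega> * (Y (Suc k) \<omega> - Y k \<omega>)) \<le> 0"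
  shows "AE \<omega> in M. convergent (\<lambda>k. Y k \<omega>)"
proof -
  have YM: "Y k \<in> borel_measurable M" for k using measurable_from_subalg[OF G(1) Y] .
  have spG: "space (G k) = space M" for k using G(1) by (simp add: subalgebra_def)
  have "AE \<omega> in M. \<not> ((\<exists>\<^sub>\<infinity>n. Y n \<omega> \<le> a) \<and> (\<exists>\<^sub>\<infinity>n. b \<le> Y n \<omega>))" if ab: "a < b" for a b
  proof -
    let ?H = "\<lambda>k. {\<omega> \<in> space M. holding a b (\<lambda>n. Y n \<omega>) k}"
    let ?g = "\<lambda>n \<omega>. gain a b (\<lambda>n. Y n \<omega>) n"
    have H: "?H k \<in> sets (G k)" for k
    proof (induction k)
      case 0
      have "?H 0 = {\<omega> \<in> space (G 0). Y 0 \<omega> \<le> a}" by (auto simp: spG)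
      then show ?case using Y[of 0] by simp
    next
      case (Suc k)
      then have h: "?H k \<in> sets (G (Suc k))" using G(2) by blast
      have "?H (Suc k) = (?H k \<inter> {\<omega> \<in> space (G (Suc k)). Y (Suc k) \<omega> < b}) \<union>
          ({\<omega> \<in> space (G (Suc k)). Y (Suc k) \<omega> \<le> a} - ?H k)"
        by (auto simp: spG)
      moreover have "{\<omega> \<in> space (G (Suc k)). Y (Suc k) \<omega> < b} \<in> sets (G (Suc k))"
        "{\<omega> \<in> space (G (Suc k)). Y (Suc k) \<omega> \<le> a} \<in> sets (G (Suc k))"
        using Y[of "Suc k"] by simp_all
      ultimately show ?case using h by auto
    qed
    have HM: "?H k \<in> sets M" for k using H G(1) by (auto simp: subalgebra_def)
    have int: "integrable M (\<lambda>\<omega>. indicator (?H k) \<omega> * (Y (Suc k) \<omega> - Y k \<omega>))" for k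
    proof (rule integrable_const_bound[where B = "\<bar>K\<bar>"])
      show "AE \<omega> in M. norm (indicator (?H k) \<omega> * (Y (Suc k) \<omega> - Y k \<omega>)) \<le> \<bar>K\<bar>"
      proof (rule AE_I2)
        fix \<omega> assume "\<omega> \<in> space M"
        then show "norm (indicator (?H k) \<omega> * (Y (Suc k) \<omega> - Y k \<omega>)) \<le> \<bar>K\<bar>"
          using bnd(1)[of \<omega> k] bnd(1)[of \<omega> "Suc k"] bnd(2)[of \<omega> k] bnd(2)[of \<omega> "Suc k"]
          by (cases "\<omega> \<in> ?H k") (simp_all add: abs_if)
      qed
    qed (use HM YM in measurable)
    have geq: "?g n \<omega> = (\<Sum>k<n. indicator (?H k) \<omega> * (Y (Suc k) \<omega> - Y k \<omega>))" if "\<omega> \<in> space M" for n \<omega>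
      unfolding gain_def using that by (intro sum.cong) (auto simp: indicator_def)
    have gint: "integrable M (?g n)" for n
      by (subst Bochner_Integration.integrable_cong[OF refl geq]) (assumption, intro Bochner_Integration.integrable_sum int)
    have Eg: "(LINT \<omega>|M. ?g n \<omega>) \<le> 0" for n
    proof -
      have "(LINT \<omega>|M. ?g n \<omega>) = (\<Sum>k<n. LINT \<omega>|M. indicator (?H k) \<omega> * (Y (Suc k) \<omega> - Y k \<omega>))"
        by (subst Bochner_Integration.integral_cong[OF refl geq])
          (assumption, intro Bochner_Integration.integral_sum int)
      also have "\<dots> \<le> 0" by (intro sum_nonpos super H)
      finally show ?thesis .
    qed
    have gm: "?g n \<in> borel_measurable M" for n using gint by auto
    have gm': "(\<lambda>\<omega>. ennreal (?g n \<omega> + \<bar>a\<bar>)) \<in> borel_measurable M" for n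
      by (intro measurable_compose[OF _ measurable_ennreal] borel_measurable_add gm borel_measurable_const)
    have pos: "0 \<le> ?g n \<omega> + \<bar>a\<bar>" if "\<omega> \<in> space M" for n \<omega>
      using gain_ge[of a b "\<lambda>n. Y n \<omega>" n] ab bnd(1)[OF that, of n] by simp
    have "(\<integral>\<^sup>+\<omega>. liminf (\<lambda>n. ennreal (?g n \<omega> + \<bar>a\<bar>)) \<partial>M) \<le> liminf (\<lambda>n. \<integral>\<^sup>+\<omega>. ennreal (?g n \<omega> + \<bar>a\<bar>) \<partial>M)"
      by (intro nn_integral_liminf gm')
    also have "\<dots> \<le> liminf (\<lambda>n::nat. ennreal \<bar>a\<bar>)"
    proof (intro Liminf_mono always_eventually allI)
      fix n
      have "(\<integral>\<^sup>+\<omega>. ennreal (?g n \<omega> + \<bar>a\<bar>) \<partial>M) = ennreal (LINT \<omega>|M. ?g n \<omega> + \<bar>a\<bar>)"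
        using gint pos by (intro nn_integral_eq_integral) auto
      also have "(LINT \<omega>|M. ?g n \<omega> + \<bar>a\<bar>) = (LINT \<omega>|M. ?g n \<omega>) + \<bar>a\<bar>"
        using gint by (simp add: prob_space)
      finally show "(\<integral>\<^sup>+\<omega>. ennreal (?g n \<omega> + \<bar>a\<bar>) \<partial>M) \<le> ennreal \<bar>a\<bar>"
        using Eg[of n] by (simp add: ennreal_leI)
    qed
    also have "\<dots> < \<infinity>" by (simp add: Liminf_const)
    finally have fin: "(\<integral>\<^sup>+\<omega>. liminf (\<lambda>n. ennreal (?g n \<omega> + \<bar>a\<bar>)) \<partial>M) \<noteq> \<infinity>" by simp
    have "AE \<omega> in M. liminf (\<lambda>n. ennreal (?g n \<omega> + \<bar>a\<bar>)) \<noteq> \<infinity>"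
      by (intro nn_integral_PInf_AE[OF _ fin] borel_measurable_liminf gm')
    then show ?thesis
    proof (rule AE_mp, intro AE_I2 impI notI)
      fix \<omega> assume \<omega>: "\<omega> \<in> space M" and ne: "liminf (\<lambda>n. ennreal (?g n \<omega> + \<bar>a\<bar>)) \<noteq> \<infinity>"
        and osc: "(\<exists>\<^sub>\<infinity>n. Y n \<omega> \<le> a) \<and> (\<exists>\<^sub>\<infinity>n. b \<le> Y n \<omega>)"
      have "filterlim (gain a b (\<lambda>n. Y n \<omega>)) at_top sequentially"
        using osc bnd(1)[OF \<omega>] by (intro gain_at_top_if_oscillating[OF ab]) auto
      then have "filterlim (\<lambda>n. \<bar>a\<bar> + ?g n \<omega>) at_top sequentially"
        by (intro filterlim_tendsto_add_at_top[OF tendsto_const])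
      then have "((\<lambda>n. ennreal (?g n \<omega> + \<bar>a\<bar>)) \<longlongrightarrow> \<infinity>) sequentially"
        by (simp add: ennreal_tendsto_top_eq_at_top add.commute infinity_ennreal_def)
      then have "liminf (\<lambda>n. ennreal (?g n \<omega> + \<bar>a\<bar>)) = \<infinity>"
        by (intro lim_imp_Liminf) auto
      then show False using ne by simp
    qed
  qed
  then have "AE \<omega> in M. \<forall>a\<in>\<rat>. \<forall>b\<in>\<rat>. a < b \<longrightarrow> \<not> ((\<exists>\<^sub>\<infinity>n. Y n \<omega> \<le> a) \<and> (\<exists>\<^sub>\<infinity>n. b \<le> Y n \<omega>))"
    by (simp add: AE_ball_countable countable_rat)
  then show ?thesis
  proof (rule AE_mp, intro AE_I2 impI)
    fix \<omega> assume \<omega>: "\<omega> \<in> space M"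
      and no_osc: "\<forall>a\<in>\<rat>. \<forall>b\<in>\<rat>. a < b \<longrightarrow> \<not> ((\<exists>\<^sub>\<infinity>n. Y n \<omega> \<le> a) \<and> (\<exists>\<^sub>\<infinity>n. b \<le> Y n \<omega>))"
    show "convergent (\<lambda>k. Y k \<omega>)"
      using no_osc
      by (intro convergent_if_no_rational_oscillation[where K = K] bnd[OF \<omega>]) simp_all
  qed
qed

text \<open>Adding the sum of all future errors turns \<open>Y\<close> into a supermartingale and changes it only by a
  deterministic convergent sequence.\<close>

lemma (in prob_space) almost_supermartingale_AE_convergent:
  fixes Y :: "nat \<Rightarrow> 'a \<Rightarrow> real"
  assumes G: "\<And>k. subalgebra M (G k)" "\<And>k. sets (G k) \<subseteq> sets (G (Suc k))"
    and Y: "\<And>k. Y k \<in> borel_measurable (G k)"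
    and bnd: "\<And>k \<omega>. \<omega> \<in> space M \<Longrightarrow> \<bar>Y k \<omega>\<bar> \<le> K"
    and e: "summable e" "\<And>k. e k \<ge> 0"
    and super: "\<And>k A. A \<in> sets (G k) \<Longrightarrow>
      (LINT \<omega>|M. indicator A \<omega> * (Y (Suc k) \<omega> - Y k \<omega>)) \<le> e k * prob A"
  shows "AE \<omega> in M. convergent (\<lambda>k. Y k \<omega>)"
proof -
  have YM: "Y k \<in> borel_measurable M" for k using measurable_from_subalg[OF G(1) Y] .
  define T where "T k = K + suminf e - sum e {..<k}" for k
  have sume: "sum e {..<k} \<le> suminf e" "0 \<le> sum e {..<k}" for k
    using e by (auto intro: sum_le_suminf sum_nonneg)
  have "AE \<omega> in M. convergent (\<lambda>k. Y k \<omega> + T k)"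
  proof (rule bounded_supermartingale_AE_convergent[where G = G and K = "2 * K + suminf e"])
    show "subalgebra M (G k)" "sets (G k) \<subseteq> sets (G (Suc k))" for k using G by auto
    show "(\<lambda>\<omega>. Y k \<omega> + T k) \<in> borel_measurable (G k)" for k using Y by measurable
    fix k \<omega> assume "\<omega> \<in> space M"
    then show "0 \<le> Y k \<omega> + T k" "Y k \<omega> + T k \<le> 2 * K + suminf e"
      using bnd[of \<omega> k] sume[of k] unfolding T_def by linarith+
  next
    fix k A assume A: "A \<in> sets (G k)"
    then have AM: "A \<in> sets M" using G(1) by (auto simp: subalgebra_def)
    have TS: "T (Suc k) = T k - e k" by (simp add: T_def)
    have eq: "indicator A \<omega> * (Y (Suc k) \<omega> + T (Suc k) - (Y k \<omega> + T k))
        = indicator A \<omega> * (Y (Suc k) \<omega> - Y k \<omega>) - e k * indicator A \<omega>" for \<omega>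
      unfolding TS by (simp add: algebra_simps)
    have int: "integrable M (\<lambda>\<omega>. indicator A \<omega> * (Y (Suc k) \<omega> - Y k \<omega>))"
    proof (rule integrable_const_bound[where B = "2 * K"])
      show "AE \<omega> in M. norm (indicator A \<omega> * (Y (Suc k) \<omega> - Y k \<omega>)) \<le> 2 * K"
      proof (rule AE_I2)
        fix \<omega> assume "\<omega> \<in> space M"
        then show "norm (indicator A \<omega> * (Y (Suc k) \<omega> - Y k \<omega>)) \<le> 2 * K"
          using bnd[of \<omega> k] bnd[of \<omega> "Suc k"] by (auto simp: indicator_def)
      qed
    qed (use AM YM in measurable)
    have intA: "integrable M (indicator A :: _ \<Rightarrow> real)"
      using AM by (intro integrable_real_indicator) (auto simp: emeasure_eq_measure)
    show "(LINT \<omega>|M. indicator A \<omega> * (Y (Suc k) \<omega> + T (Suc k) - (Y k \<omega> + T k))) \<le> 0"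
      unfolding eq using super[OF A] int AM intA
      by (subst Bochner_Integration.integral_diff) (auto simp: Int_absorb2 sets.sets_into_space)
  qed
  then show ?thesis
  proof (rule AE_mp, intro AE_I2 impI)
    fix \<omega> assume c: "convergent (\<lambda>k. Y k \<omega> + T k)"
    have "T \<longlonglongrightarrow> K + suminf e - suminf e" unfolding T_def
      using summable_LIMSEQ[OF e(1)] by (intro tendsto_intros)
    then have "convergent T" by (rule convergentI)
    from convergent_diff[OF c this] show "convergent (\<lambda>k. Y k \<omega>)" by simp
  qed
qed

section \<open>Integrating out the next sample\<close>

text \<open>For independent \<open>Z\<close> and \<open>T\<close> the mean of \<open>V (Z, T)\<close> may be computed by freezing \<open>Z\<close>. Independence is
  expressed by the joint distribution, so that \<open>Z\<close> and \<open>T\<close> may take values in different types.\<close>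

lemma (in prob_space) indep_var_freezing_le:
  fixes V :: "'z \<Rightarrow> 's \<Rightarrow> real"
  assumes Zm[measurable]: "Z \<in> measurable M N" and Tm[measurable]: "T \<in> measurable M P"
    and d: "distr M P T = P"
    and pr: "distr M N Z \<Otimes>\<^sub>M P = distr M (N \<Otimes>\<^sub>M P) (\<lambda>\<omega>. (Z \<omega>, T \<omega>))"
    and V: "(\<lambda>(z, s). V z s) \<in> borel_measurable (N \<Otimes>\<^sub>M P)"
    and A: "A \<in> sets N" "\<And>\<omega>. \<omega> \<in> space M \<Longrightarrow> Z \<omega> \<in> A"
    and B: "integrable P B" "AE s in P. \<forall>z\<in>A. \<bar>V z s\<bar> \<le> B s"
    and c: "c \<in> borel_measurable N" "\<And>z. z \<in> A \<Longrightarrow> \<bar>c z\<bar> \<le> C" "\<And>z. z \<in> A \<Longrightarrow> (LINT s|P. V z s) \<le> c z"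
  shows "integrable M (\<lambda>\<omega>. V (Z \<omega>) (T \<omega>))"
    and "(LINT \<omega>|M. V (Z \<omega>) (T \<omega>)) \<le> (LINT \<omega>|M. c (Z \<omega>))"
proof -
  have pm[measurable]: "(\<lambda>\<omega>. (Z \<omega>, T \<omega>)) \<in> measurable M (N \<Otimes>\<^sub>M P)" by measurable
  have VM: "(\<lambda>\<omega>. V (Z \<omega>) (T \<omega>)) \<in> borel_measurable M"
    using measurable_compose[OF pm V] by simp
  have "AE s in distr M P T. \<forall>z\<in>A. \<bar>V z s\<bar> \<le> B s" by (subst d) (rule B(2))
  from AE_distrD[OF Tm this] have ae: "AE \<omega> in M. \<forall>z\<in>A. \<bar>V z (T \<omega>)\<bar> \<le> B (T \<omega>)" .
  have "integrable (distr M P T) B" using B(1) d by simp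
  then have BT: "integrable M (\<lambda>\<omega>. B (T \<omega>))" by (rule integrable_distr[OF Tm])
  show int: "integrable M (\<lambda>\<omega>. V (Z \<omega>) (T \<omega>))"
  proof (rule Bochner_Integration.integrable_bound[OF BT VM])
    show "AE \<omega> in M. norm (V (Z \<omega>) (T \<omega>)) \<le> norm (B (T \<omega>))"
      using ae AE_space by eventually_elim (use A(2) in force)
  qed
  have intp: "integrable (distr M N Z \<Otimes>\<^sub>M P) (\<lambda>(z, s). V z s)"
    unfolding pr using int V by (subst integrable_distr_eq) auto
  interpret Z: prob_space "distr M N Z" by (rule prob_space_distr) measurable
  interpret P: prob_space P using prob_space_distr[OF Tm] d by simp
  interpret pair_sigma_finite "distr M N Z" P ..
  have cint: "integrable (distr M N Z) c"
    using c A by (subst integrable_distr_eq) (auto intro!: integrable_const_bound[where B = C])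
  have "(LINT \<omega>|M. V (Z \<omega>) (T \<omega>)) = integral\<^sup>L (distr M N Z \<Otimes>\<^sub>M P) (\<lambda>(z, s). V z s)"
    unfolding pr using V by (subst integral_distr) auto
  also have "\<dots> = (LINT z|distr M N Z. LINT s|P. V z s)"
    using integral_fst'[OF intp] by simp
  also have "\<dots> \<le> (LINT z|distr M N Z. c z)"
  proof (rule integral_mono_AE)
    show "integrable (distr M N Z) (\<lambda>z. LINT s|P. V z s)" using integrable_fst'[OF intp] by simp
    have "{z \<in> space N. z \<in> A} = A" using sets.sets_into_space[OF A(1)] by blast
    then have "AE z in distr M N Z. z \<in> A"
      using A by (subst AE_distr_iff[OF Zm]) simp_all
    then show "AE z in distr M N Z. (LINT s|P. V z s) \<le> c z"
      by (rule AE_mp) (use c in auto)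
  qed (rule cint)
  also have "\<dots> = (LINT \<omega>|M. c (Z \<omega>))" using c by (subst integral_distr) auto
  finally show "(LINT \<omega>|M. V (Z \<omega>) (T \<omega>)) \<le> (LINT \<omega>|M. c (Z \<omega>))" .
qed

lemma space_sample_algebra [simp]: "space (sample_algebra \<Omega> P S k) = space \<Omega>"
  by (simp add: sample_algebra_def)

lemma subalgebra_sample_algebra:
  assumes "\<And>k. S k \<in> measurable \<Omega> P"
  shows "subalgebra \<Omega> (sample_algebra \<Omega> P S k)"
  unfolding subalgebra_def
proof
  show "sets (sample_algebra \<Omega> P S k) \<subseteq> sets \<Omega>"
    unfolding sample_algebra_def by (rule sets_image_in_sets[OF refl]) (intro measurable_restrict assms)
qed simp

lemma sample_algebra_mono:
  assumes S: "\<And>k. S k \<in> measurable \<Omega> P"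
  shows "sets (sample_algebra \<Omega> P S k) \<subseteq> sets (sample_algebra \<Omega> P S (Suc k))"
proof -
  let ?t = "\<lambda>k \<omega>. \<lambda>i\<in>{..<k}. S i \<omega>"
  have "?t (Suc k) \<in> measurable \<Omega> (PiM {..<Suc k} (\<lambda>_. P))"
    using S by (intro measurable_restrict)
  then have "?t (Suc k) \<in> space \<Omega> \<rightarrow> space (PiM {..<Suc k} (\<lambda>_. P))"
    unfolding measurable_def by blast
  then have "?t (Suc k) \<in> measurable (sample_algebra \<Omega> P S (Suc k)) (PiM {..<Suc k} (\<lambda>_. P))"
    unfolding sample_algebra_def by (rule measurable_vimage_algebra1)
  moreover have "(\<lambda>f. restrict f {..<k}) \<in> measurable (PiM {..<Suc k} (\<lambda>_. P)) (PiM {..<k} (\<lambda>_. P))"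
    by (rule measurable_restrict_subset) auto
  ultimately have "(\<lambda>\<omega>. restrict (?t (Suc k) \<omega>) {..<k}) \<in> measurable (sample_algebra \<Omega> P S (Suc k)) (PiM {..<k} (\<lambda>_. P))"
    by (rule measurable_compose)
  moreover have "restrict (?t (Suc k) \<omega>) {..<k} = ?t k \<omega>" for \<omega> by (auto simp: restrict_def)
  ultimately have "?t k \<in> measurable (sample_algebra \<Omega> P S (Suc k)) (PiM {..<k} (\<lambda>_. P))" by simp
  then show ?thesis
    unfolding sample_algebra_def[of _ _ _ k] by (intro sets_image_in_sets) auto
qed

text \<open>Whatever is a function of the first \<open>k\<close> samples generates a smaller sigma-algebra than they do, so it
  inherits their independence of the next sample.\<close>

lemma (in prob_space) past_next_sample_joint_distr:
  assumes S: "indep_vars (\<lambda>_. P) S UNIV" and d: "distr M P (S k) = P"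
    and Z: "Z \<in> measurable (sample_algebra M P S k) N"
  shows "distr M N Z \<Otimes>\<^sub>M P = distr M (N \<Otimes>\<^sub>M P) (\<lambda>\<omega>. (Z \<omega>, S k \<omega>))"
proof -
  let ?t = "\<lambda>\<omega>. \<lambda>i\<in>{..<k}. S i \<omega>" and ?u = "\<lambda>\<omega>. \<lambda>i\<in>{k}. S i \<omega>"
  have Sm[measurable]: "S k \<in> measurable M P" for k using S by (auto simp: indep_vars_def)
  have "indep_var (PiM {..<k} (\<lambda>_. P)) ?t (PiM {k} (\<lambda>_. P)) ?u"
    using S by (rule indep_var_restrict) auto
  then have ind: "indep_set (sigma_sets (space M) {?t -` A \<inter> space M | A. A \<in> sets (PiM {..<k} (\<lambda>_. P))})
      (sigma_sets (space M) {?u -` A \<inter> space M | A. A \<in> sets (PiM {k} (\<lambda>_. P))})"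
    unfolding indep_var_eq by blast
  have "?t \<in> measurable M (PiM {..<k} (\<lambda>_. P))" using Sm by (intro measurable_restrict)
  then have tsp: "?t \<in> space M \<rightarrow> space (PiM {..<k} (\<lambda>_. P))"
    unfolding measurable_def by blast
  have ZM[measurable]: "Z \<in> measurable M N"
    using measurable_from_subalg[OF subalgebra_sample_algebra[OF Sm] Z] .
  interpret Z: prob_space "distr M N Z" by (rule prob_space_distr) measurable
  interpret P: prob_space P using prob_space_distr[OF Sm[of k]] d by simp
  show ?thesis
  proof (rule pair_measure_eqI)
    fix A B assume "A \<in> sets (distr M N Z)" and B: "B \<in> sets P"
    then have A: "A \<in> sets N" by simp
    have "Z -` A \<inter> space M \<in> sets (sample_algebra M P S k)"
      using measurable_sets[OF Z A] by simp
    also have "\<dots> = {?t -` A \<inter> space M | A. A \<in> sets (PiM {..<k} (\<lambda>_. P))}"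
      unfolding sample_algebra_def using tsp by (rule sets_vimage_algebra2)
    finally have 1: "Z -` A \<inter> space M
        \<in> sigma_sets (space M) {?t -` A \<inter> space M | A. A \<in> sets (PiM {..<k} (\<lambda>_. P))}"
      by (rule sigma_sets.Basic)
    have "{f \<in> space (PiM {k} (\<lambda>_. P)). f k \<in> B} \<in> sets (PiM {k} (\<lambda>_. P))" using B by measurable
    moreover have "S k -` B \<inter> space M = ?u -` {f \<in> space (PiM {k} (\<lambda>_. P)). f k \<in> B} \<inter> space M"
      using sets.sets_into_space[OF B] by (auto simp: space_PiM)
    ultimately have 2: "S k -` B \<inter> space M
        \<in> sigma_sets (space M) {?u -` A \<inter> space M | A. A \<in> sets (PiM {k} (\<lambda>_. P))}"
      by (intro sigma_sets.Basic) blast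
    have "prob ((Z -` A \<inter> space M) \<inter> (S k -` B \<inter> space M))
        = prob (Z -` A \<inter> space M) * prob (S k -` B \<inter> space M)"
      using indep_setD[OF ind 1 2] .
    moreover have "(\<lambda>\<omega>. (Z \<omega>, S k \<omega>)) -` (A \<times> B) \<inter> space M
        = (Z -` A \<inter> space M) \<inter> (S k -` B \<inter> space M)" by auto
    moreover have "emeasure P B = emeasure (distr M P (S k)) B" using d by simp
    ultimately show "emeasure (distr M N Z) A * emeasure P B
        = emeasure (distr M (N \<Otimes>\<^sub>M P) (\<lambda>\<omega>. (Z \<omega>, S k \<omega>))) (A \<times> B)"
      using A B by (simp add: emeasure_distr emeasure_eq_measure ennreal_mult)
  qed (simp_all add: Z.sigma_finite_measure_axioms P.sigma_finite_measure_axioms)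
qed

section \<open>Uniform regularity over the compact set\<close>

text \<open>The sum of the finitely many bounds serves for all members at once and remains integrable.\<close>

lemma finite_family_integrable_bound:
  assumes "finite K"
    and "\<And>c. c \<in> K \<Longrightarrow> \<exists>l. integrable P l \<and> (\<forall>s\<in>space P. 0 \<le> l s \<and> Q c s (l s))"
    and mono: "\<And>c s a b. Q c s a \<Longrightarrow> a \<le> b \<Longrightarrow> Q c s (b :: real)"
  shows "\<exists>l. integrable P l \<and> (\<forall>s\<in>space P. 0 \<le> l s \<and> (\<forall>c\<in>K. Q c s (l s)))"
proof -
  obtain l where l: "\<And>c. c \<in> K \<Longrightarrow> integrable P (l c)"
    "\<And>c s. c \<in> K \<Longrightarrow> s \<in> space P \<Longrightarrow> 0 \<le> l c s \<and> Q c s (l c s)"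
    using assms(2) by metis
  have Q: "Q c s (\<Sum>c\<in>K. l c s)" if "c \<in> K" "s \<in> space P" for c s
  proof (rule mono)
    show "Q c s (l c s)" using l(2) that by blast
    show "l c s \<le> (\<Sum>c\<in>K. l c s)" by (rule member_le_sum) (use that assms(1) l(2) in auto)
  qed
  show ?thesis
  proof (intro exI[of _ "\<lambda>s. \<Sum>c\<in>K. l c s"] conjI ballI)
    show "integrable P (\<lambda>s. \<Sum>c\<in>K. l c s)" using l(1) by (rule Bochner_Integration.integrable_sum)
    show "0 \<le> (\<Sum>c\<in>K. l c s)" if "s \<in> space P" for s using l(2) that by (simp add: sum_nonneg)
  qed (rule Q)
qed

lemma compact_finite_net:
  fixes X :: "'a::metric_space set"
  assumes "compact X" "e > 0"
  obtains K where "finite K" "K \<subseteq> X" "\<And>x. x \<in> X \<Longrightarrow> \<exists>c\<in>K. dist c x < e"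
proof -
  obtain K where "finite K" "K \<subseteq> X" "X \<subseteq> (\<Union>c\<in>K. ball c e)"
    using seq_compact_imp_totally_bounded[of X] assms compact_imp_seq_compact by blast
  then show thesis using that by (auto simp: subset_eq)
qed

text \<open>The conditions of the theorem are local. Covering the compact set by finitely many of the
  neighbourhoods turns each of them into a statement with one random constant for the whole of \<open>X\<close>. For
  the subgradient bound the constants are combined by the Euclidean norm, which keeps the square
  integrable.\<close>

lemma cond_L_uniform_bound:
  fixes X :: "'a::euclidean_space set"
  assumes "cond_L P X f" "compact X"
  obtains Mf :: "'s \<Rightarrow> real" where "Mf \<in> borel_measurable P" "\<And>s. 0 \<le> Mf s" "integrable P (\<lambda>s. (Mf s)\<^sup>2)"
    and "AE s in P. \<forall>y\<in>X. \<forall>g\<in>frechet_subdiff (\<lambda>z. ereal (f z s)) y. norm g \<le> Mf s"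
proof -
  obtain e where e: "e > 0" and M: "\<And>c. c \<in> X \<Longrightarrow> local_lip X f e c \<in> borel_measurable P"
    and fin: "\<And>c. c \<in> X \<Longrightarrow> (\<integral>\<^sup>+ s. (local_lip X f e c s)\<^sup>2 \<partial>P) < \<infinity>"
    using assms(1) unfolding cond_L_def by (metis order_refl)
  obtain K where K: "finite K" "K \<subseteq> X" "\<And>x. x \<in> X \<Longrightarrow> \<exists>c\<in>K. dist c x < e"
    using compact_finite_net[OF assms(2) e] by metis
  define R where "R c s = enn2real (local_lip X f e c s)" for c s
  define Mf where "Mf s = sqrt (\<Sum>c\<in>K. (R c s)\<^sup>2)" for s
  have Rm: "R c \<in> borel_measurable P" if "c \<in> K" for c
    unfolding R_def using M K that by (intro measurable_compose[OF _ borel_measurable_enn2real]) auto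
  have Rle: "ennreal (R c s) \<le> local_lip X f e c s" for c s
    unfolding R_def by (cases "local_lip X f e c s") auto
  have Rint: "integrable P (\<lambda>s. (R c s)\<^sup>2)" if c: "c \<in> K" for c
  proof (rule integrableI_bounded)
    have "(\<integral>\<^sup>+ s. ennreal (norm ((R c s)\<^sup>2)) \<partial>P) \<le> (\<integral>\<^sup>+ s. (local_lip X f e c s)\<^sup>2 \<partial>P)"
    proof (rule nn_integral_mono)
      fix s
      have "ennreal (norm ((R c s)\<^sup>2)) = (ennreal (R c s))\<^sup>2"
        by (simp add: R_def ennreal_power)
      also have "\<dots> \<le> (local_lip X f e c s)\<^sup>2" using Rle by (intro power_mono) auto
      finally show "ennreal (norm ((R c s)\<^sup>2)) \<le> (local_lip X f e c s)\<^sup>2" .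
    qed
    also have "\<dots> < \<infinity>" using fin c K(2) by blast
    finally show "(\<integral>\<^sup>+ s. ennreal (norm ((R c s)\<^sup>2)) \<partial>P) < \<infinity>" .
  qed (use Rm[OF c] in measurable)
  have sq: "(Mf s)\<^sup>2 = (\<Sum>c\<in>K. (R c s)\<^sup>2)" for s
    unfolding Mf_def by (simp add: sum_nonneg)
  have RM: "R c s \<le> Mf s" if "c \<in> K" for c s
  proof -
    have "(R c s)\<^sup>2 \<le> (\<Sum>c\<in>K. (R c s)\<^sup>2)" using K(1) that by (intro member_le_sum) auto
    then show ?thesis unfolding Mf_def by (rule real_le_rsqrt)
  qed
  have "AE s in P. \<forall>c\<in>K. local_lip X f e c s \<noteq> \<infinity>"
  proof (rule AE_finite_allI[OF K(1)])
    fix c assume c: "c \<in> K"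
    then have cX: "c \<in> X" using K by blast
    have "(\<lambda>s. (local_lip X f e c s)\<^sup>2) \<in> borel_measurable P" using M[OF cX] by measurable
    then have "AE s in P. (local_lip X f e c s)\<^sup>2 \<noteq> \<infinity>"
      using fin[OF cX] by (intro nn_integral_PInf_AE) auto
    then show "AE s in P. local_lip X f e c s \<noteq> \<infinity>"
      by (rule AE_mp) (auto intro!: AE_I2 simp: power2_eq_square ennreal_top_mult)
  qed
  then have ae: "AE s in P. \<forall>y\<in>X. \<forall>g\<in>frechet_subdiff (\<lambda>z. ereal (f z s)) y. norm g \<le> Mf s"
  proof (rule AE_mp, intro AE_I2 impI ballI)
    fix s y g assume finc: "\<forall>c\<in>K. local_lip X f e c s \<noteq> \<infinity>"
      and y: "y \<in> X" and g: "g \<in> frechet_subdiff (\<lambda>z. ereal (f z s)) y"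
    obtain c where c: "c \<in> K" "dist c y < e" using K(3)[OF y] by blast
    have "ennreal (norm g) \<le> local_lip X f e c s"
      unfolding local_lip_def
      by (rule SUP_upper2[of y]) (use y c g in \<open>auto simp: dist_norm norm_minus_commute intro: SUP_upper\<close>)
    also have "\<dots> = ennreal (R c s)"
      unfolding R_def using finc c by (simp add: less_top)
    finally have "norm g \<le> R c s" by (simp add: R_def)
    then show "norm g \<le> Mf s" using RM[OF c(1), of s] by linarith
  qed
  show thesis
  proof (rule that[of Mf])
    show "Mf \<in> borel_measurable P"
      unfolding Mf_def using Rm by (intro measurable_compose[OF _ borel_measurable_sqrt]
        borel_measurable_sum borel_measurable_power) auto
    show "0 \<le> Mf s" for s unfolding Mf_def by (simp add: sum_nonneg)
    show "integrable P (\<lambda>s. (Mf s)\<^sup>2)" unfolding sq using Rint by (intro Bochner_Integration.integrable_sum)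
  qed (rule ae)
qed

text \<open>Balls of half the radius around a point of \<open>X\<close> stay inside the ball of a nearby centre.\<close>

lemma cond_W_uniform:
  fixes X :: "'a::euclidean_space set" and f :: "'a \<Rightarrow> 's \<Rightarrow> real"
  assumes "cond_W P X f" "compact X"
  obtains r l where "r > 0" "integrable P l"
    and "\<And>s y. s \<in> space P \<Longrightarrow> y \<in> X \<Longrightarrow> convex_on (ball y r) (\<lambda>z. f z s + l s / 2 * (norm (z - y))\<^sup>2)"
proof -
  let ?Q = "\<lambda>e c s d. \<forall>x0. convex_on (cball c e) (\<lambda>y. f y s + d / 2 * (norm (y - x0))\<^sup>2)"
  from assms(1)[unfolded cond_W_def] obtain e where e: "e > 0"
    and all: "\<forall>\<epsilon>. 0 < \<epsilon> \<and> \<epsilon> \<le> e \<longrightarrow> (\<forall>c\<in>X. \<exists>l. integrable P l \<and> (\<forall>s\<in>space P. 0 \<le> l s \<and> ?Q \<epsilon> c s (l s)))"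
    by blast
  have W: "\<exists>l. integrable P l \<and> (\<forall>s\<in>space P. 0 \<le> l s \<and> ?Q e c s (l s))" if "c \<in> X" for c
    using all[THEN spec[of _ e]] e that by simp
  obtain K where K: "finite K" "K \<subseteq> X" "\<And>x. x \<in> X \<Longrightarrow> \<exists>c\<in>K. dist c x < e / 2"
    using compact_finite_net[OF assms(2), of "e / 2"] e by auto
  have "\<exists>l. integrable P l \<and> (\<forall>s\<in>space P. 0 \<le> l s \<and> (\<forall>c\<in>K. ?Q e c s (l s)))"
  proof (rule finite_family_integrable_bound[OF K(1)])
    fix c assume "c \<in> K"
    with K(2) show "\<exists>l. integrable P l \<and> (\<forall>s\<in>space P. 0 \<le> l s \<and> ?Q e c s (l s))"
      by (intro W) blast
  next
    fix c s and a b :: real assume Q: "?Q e c s a" and ab: "a \<le> b"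
    show "?Q e c s b" by (intro allI convex_on_weak_mono[OF Q[rule_format] ab])
  qed
  then obtain l where l: "integrable P l"
    and l': "\<forall>s\<in>space P. 0 \<le> l s \<and> (\<forall>c\<in>K. ?Q e c s (l s))"
    by (elim exE conjE)
  show thesis
  proof (rule that[of "e / 2" l])
    fix s y assume s: "s \<in> space P" and y: "y \<in> X"
    obtain c where c: "c \<in> K" "dist c y < e / 2" using K(3)[OF y] by blast
    have sub: "ball y (e / 2) \<subseteq> cball c e"
    proof
      fix z assume "z \<in> ball y (e / 2)"
      then show "z \<in> cball c e" using c(2) dist_triangle[of c z y] by simp
    qed
    show "convex_on (ball y (e / 2)) (\<lambda>z. f z s + l s / 2 * (norm (z - y))\<^sup>2)"
      by (rule convex_on_subset[OF l'[rule_format, OF s, THEN conjunct2, rule_format, OF c(1), of y] sub])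
        simp
  qed (use e l in auto)
qed

lemma cond_Civ_uniform:
  fixes X :: "'a::euclidean_space set" and f :: "'a \<Rightarrow> 's \<Rightarrow> real"
  assumes "cond_Civ P X f m" "compact X"
  obtains r \<delta> where "r > 0" "integrable P \<delta>"
    and "\<And>s x y. s \<in> space P \<Longrightarrow> x \<in> X \<Longrightarrow> norm (y - x) < r \<Longrightarrow>
      m x y s \<le> ereal (f y s + 1 / 2 * \<delta> s * (norm (y - x))\<^sup>2)"
    and "\<And>s. s \<in> space P \<Longrightarrow> 0 \<le> \<delta> s"
proof -
  let ?Q = "\<lambda>e c s d. \<forall>x\<in>X \<inter> cball c e. \<forall>y\<in>cball c e.
                 ereal (f y s) \<ge> m x y s - ereal (1 / 2 * d * (norm (y - x))\<^sup>2)"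
  from assms(1)[unfolded cond_Civ_def] obtain e where e: "e > 0"
    and all: "\<forall>\<epsilon>. 0 < \<epsilon> \<and> \<epsilon> \<le> e \<longrightarrow> (\<forall>c\<in>X. \<exists>l. integrable P l \<and> (\<forall>s\<in>space P. 0 \<le> l s \<and> ?Q \<epsilon> c s (l s)))"
    by blast
  have W: "\<exists>l. integrable P l \<and> (\<forall>s\<in>space P. 0 \<le> l s \<and> ?Q e c s (l s))" if "c \<in> X" for c
    using all[THEN spec[of _ e]] e that by simp
  obtain K where K: "finite K" "K \<subseteq> X" "\<And>x. x \<in> X \<Longrightarrow> \<exists>c\<in>K. dist c x < e / 2"
    using compact_finite_net[OF assms(2), of "e / 2"] e by auto
  have "\<exists>\<delta>. integrable P \<delta> \<and> (\<forall>s\<in>space P. 0 \<le> \<delta> s \<and> (\<forall>c\<in>K. ?Q e c s (\<delta> s)))"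
  proof (rule finite_family_integrable_bound[OF K(1)])
    fix c assume "c \<in> K"
    then show "\<exists>\<delta>. integrable P \<delta> \<and> (\<forall>s\<in>space P. 0 \<le> \<delta> s \<and> ?Q e c s (\<delta> s))"
      using W K(2) by blast
  next
    fix c s and a b :: real assume Q: "?Q e c s a" and ab: "a \<le> b"
    show "?Q e c s b"
    proof (intro ballI)
      fix x y assume xy: "x \<in> X \<inter> cball c e" "y \<in> cball c e"
      have "1 / 2 * a * (norm (y - x))\<^sup>2 \<le> 1 / 2 * b * (norm (y - x))\<^sup>2"
        using ab by (intro mult_right_mono) auto
      then have "m x y s - ereal (1 / 2 * b * (norm (y - x))\<^sup>2) \<le> m x y s - ereal (1 / 2 * a * (norm (y - x))\<^sup>2)"
        by (intro ereal_minus_mono) auto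
      also have "\<dots> \<le> ereal (f y s)" using Q xy by blast
      finally show "m x y s - ereal (1 / 2 * b * (norm (y - x))\<^sup>2) \<le> ereal (f y s)" .
    qed
  qed
  then obtain \<delta> where \<delta>: "integrable P \<delta>"
    and \<delta>': "\<forall>s\<in>space P. 0 \<le> \<delta> s \<and> (\<forall>c\<in>K. ?Q e c s (\<delta> s))"
    by (elim exE conjE)
  show thesis
  proof (rule that[of "e / 2" \<delta>])
    fix s x y assume s: "s \<in> space P" and x: "x \<in> X" and y: "norm (y - x) < e / 2"
    obtain c where c: "c \<in> K" "dist c x < e / 2" using K(3)[OF x] by blast
    have "x \<in> cball c e" using c(2) e by simp
    moreover have "y \<in> cball c e"
      using c(2) y dist_triangle[of c y x] by (simp add: dist_norm norm_minus_commute)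
    ultimately have "m x y s - ereal (1 / 2 * \<delta> s * (norm (y - x))\<^sup>2) \<le> ereal (f y s)"
      using \<delta>'[rule_format, OF s, THEN conjunct2, rule_format, OF c(1)] x by blast
    then show "m x y s \<le> ereal (f y s + 1 / 2 * \<delta> s * (norm (y - x))\<^sup>2)"
      by (cases "m x y s") auto
  qed (use e \<delta> \<delta>' in auto)
qed

lemma convex_on_risk:
  fixes f :: "'a::euclidean_space \<Rightarrow> 's \<Rightarrow> real"
  assumes P: "prob_space P" and int: "\<And>y. integrable P (f y)" "integrable P l"
    and cv: "\<And>s. s \<in> space P \<Longrightarrow> convex_on B (\<lambda>z. f z s + l s / 2 * (norm (z - x))\<^sup>2)" and B: "convex B"
  shows "convex_on B (\<lambda>z. risk P f z + (LINT s|P. l s) / 2 * (norm (z - x))\<^sup>2)"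
proof -
  have i: "integrable P (\<lambda>s. f z s + l s / 2 * c)" for z c
    by (intro Bochner_Integration.integrable_add integrable_mult_left integrable_divide int)
  have e: "risk P f z + (LINT s|P. l s) / 2 * c = (LINT s|P. f z s + l s / 2 * c)" for z c
  proof -
    have "integrable P (\<lambda>s. l s / 2 * c)" by (intro integrable_mult_left integrable_divide int)
    then have "(LINT s|P. f z s + l s / 2 * c) = (LINT s|P. f z s) + (LINT s|P. l s / 2 * c)"
      by (rule Bochner_Integration.integral_add[OF int(1)])
    then show ?thesis by (simp add: risk_def)
  qed
  show ?thesis
    unfolding e
  proof (rule convex_onI[OF _ B])
    fix t :: real and a b assume t: "0 < t" "t < 1" and ab: "a \<in> B" "b \<in> B"
    let ?h = "\<lambda>z s. f z s + l s / 2 * (norm (z - x))\<^sup>2"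
    have "(LINT s|P. ?h ((1 - t) *\<^sub>R a + t *\<^sub>R b) s) \<le> (LINT s|P. (1 - t) * ?h a s + t * ?h b s)"
    proof (rule integral_mono)
      show "integrable P (\<lambda>s. (1 - t) * ?h a s + t * ?h b s)"
        by (intro Bochner_Integration.integrable_add integrable_mult_right i)
      show "?h ((1 - t) *\<^sub>R a + t *\<^sub>R b) s \<le> (1 - t) * ?h a s + t * ?h b s" if "s \<in> space P" for s
        using convex_onD[OF cv[OF that], of t a b] t ab by simp
    qed (rule i)
    also have "\<dots> = (LINT s|P. (1 - t) * ?h a s) + (LINT s|P. t * ?h b s)"
      by (intro Bochner_Integration.integral_add integrable_mult_right i)
    also have "\<dots> = (1 - t) * (LINT s|P. ?h a s) + t * (LINT s|P. ?h b s)"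
      by (simp only: integral_mult_right_zero)
    finally show "(LINT s|P. ?h ((1 - t) *\<^sub>R a + t *\<^sub>R b) s)
        \<le> (1 - t) * (LINT s|P. ?h a s) + t * (LINT s|P. ?h b s)" .
  qed
qed

section \<open>Limits of deterministic sequences\<close>

text \<open>Otherwise \<open>\<alpha> k\<close> would eventually be at most \<open>\<alpha> k * d k / e\<close>, the term of a convergent series.\<close>

lemma small_terms_if_weighted_sum_finite:
  fixes \<alpha> d :: "nat \<Rightarrow> real"
  assumes "\<And>k. \<alpha> k > 0" "\<And>k. d k \<ge> 0"
    and inf: "(\<Sum>k. ennreal (\<alpha> k)) = \<infinity>" and fin: "(\<Sum>k. ennreal (\<alpha> k * d k)) \<noteq> \<infinity>" and e: "e > 0"
  shows "\<exists>k\<ge>n. d k < e"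
proof (rule ccontr)
  assume "\<not> ?thesis"
  then have ge: "d k \<ge> e" if "k \<ge> n" for k using that by (meson not_le)
  have "ennreal (\<alpha> (k + n)) \<le> ennreal (1 / e) * ennreal (\<alpha> (k + n) * d (k + n))" for k
  proof -
    have "\<alpha> (k + n) * e \<le> \<alpha> (k + n) * d (k + n)"
      using ge[of "k + n"] assms(1)[of "k + n"] by (intro mult_left_mono) auto
    then have "\<alpha> (k + n) \<le> 1 / e * (\<alpha> (k + n) * d (k + n))" using e by (simp add: field_simps)
    then have "ennreal (\<alpha> (k + n)) \<le> ennreal (1 / e * (\<alpha> (k + n) * d (k + n)))" by (rule ennreal_leI)
    also have "\<dots> = ennreal (1 / e) * ennreal (\<alpha> (k + n) * d (k + n))"
      by (rule ennreal_mult) (use e assms(2) less_imp_le[OF assms(1)] in simp_all)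
    finally show ?thesis .
  qed
  then have "(\<Sum>k. ennreal (\<alpha> (k + n))) \<le> (\<Sum>k. ennreal (1 / e) * ennreal (\<alpha> (k + n) * d (k + n)))"
    by (intro suminf_le) auto
  also have "\<dots> = ennreal (1 / e) * (\<Sum>k. ennreal (\<alpha> (k + n) * d (k + n)))" by simp
  also have "\<dots> < \<infinity>"
  proof -
    have "(\<Sum>k. ennreal (\<alpha> (k + n) * d (k + n))) \<le> (\<Sum>k. ennreal (\<alpha> k * d k))"
      using suminf_offset[of "\<lambda>k. ennreal (\<alpha> k * d k)" n] by simp
    also have "\<dots> < \<infinity>" using fin by (simp add: less_top)
    finally show ?thesis by (simp add: ennreal_mult_less_top)
  qed
  finally have "(\<Sum>k. ennreal (\<alpha> (k + n))) < \<infinity>" .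
  moreover have "(\<Sum>k. ennreal (\<alpha> k)) = (\<Sum>k. ennreal (\<alpha> (k + n))) + (\<Sum>k<n. ennreal (\<alpha> k))"
    by (rule suminf_offset) simp
  moreover have "(\<Sum>k<n. ennreal (\<alpha> k)) < \<infinity>"
    using less_imp_le[OF assms(1)] by (simp add: sum_ennreal)
  ultimately show False using inf by (metis ennreal_add_eq_top infinity_ennreal_def less_irrefl)
qed

lemma limit_point_with_zero_gap:
  fixes y :: "nat \<Rightarrow> 'a::euclidean_space"
  assumes X: "compact X" "\<And>k. y k \<in> X" and F: "continuous_on X F" "(\<lambda>k. F (y k)) \<longlonglongrightarrow> v"
    and D: "continuous_on X D" and small: "\<And>e n. e > 0 \<Longrightarrow> \<exists>k\<ge>n. D (y k) < (e :: real)"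
  shows "\<exists>z\<in>X. F z = (v :: real) \<and> D z \<le> 0"
proof -
  have "\<forall>j. \<exists>k. k \<ge> j \<and> D (y k) < 1 / real (Suc j)"
    using small[of "1 / real (Suc j)" j for j] by simp
  then obtain \<kappa> where \<kappa>: "\<And>j. \<kappa> j \<ge> j" "\<And>j. D (y (\<kappa> j)) < 1 / real (Suc j)"
    by metis
  have "seq_compact X" using X(1) by (rule compact_imp_seq_compact)
  then obtain z s where z: "z \<in> X" and s: "strict_mono s" and lim: "((\<lambda>j. y (\<kappa> j)) \<circ> s) \<longlonglongrightarrow> z"
    using X(2) seq_compactE[of X "\<lambda>j. y (\<kappa> j)"] by blast
  have lim': "(\<lambda>j. y (\<kappa> (s j))) \<longlonglongrightarrow> z" using lim by (simp add: comp_def)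
  have inX: "\<forall>\<^sub>F j in sequentially. y (\<kappa> (s j)) \<in> X" using X(2) by simp
  have top: "filterlim (\<lambda>j. \<kappa> (s j)) at_top sequentially"
  proof (rule filterlim_at_top_mono[OF filterlim_ident])
    show "\<forall>\<^sub>F j in sequentially. j \<le> \<kappa> (s j)"
      using \<kappa>(1) seq_suble[OF s] by (intro always_eventually allI) (meson order_trans)
  qed
  have "(\<lambda>j. F (y (\<kappa> (s j)))) \<longlonglongrightarrow> v" using filterlim_compose[OF F(2) top] .
  moreover have "(\<lambda>j. F (y (\<kappa> (s j)))) \<longlonglongrightarrow> F z"
    using continuous_on_tendsto_compose[OF F(1) lim' z inX] .
  ultimately have "F z = v" using LIMSEQ_unique by blast
  moreover have "D z \<le> 0"
  proof (rule LIMSEQ_le)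
    show "(\<lambda>j. D (y (\<kappa> (s j)))) \<longlonglongrightarrow> D z" using continuous_on_tendsto_compose[OF D lim' z inX] .
    show "(\<lambda>j. 1 / real (Suc (s j))) \<longlonglongrightarrow> 0"
      using filterlim_compose[OF LIMSEQ_Suc[OF lim_1_over_n] filterlim_subseq[OF s]] by simp
    show "\<exists>N. \<forall>j\<ge>N. D (y (\<kappa> (s j))) \<le> 1 / real (Suc (s j))" using \<kappa>(2) by (blast intro: less_imp_le)
  qed
  ultimately show ?thesis using z by blast
qed

lemma convergent_if_uniformly_approximated:
  fixes a :: "nat \<Rightarrow> real"
  assumes "\<And>e. e > 0 \<Longrightarrow> \<exists>b. convergent b \<and> (\<forall>k. \<bar>a k - b k\<bar> \<le> e)"
  shows "convergent a"
proof (rule Cauchy_convergent, rule CauchyI)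
  fix e :: real assume e: "e > 0"
  then obtain b where b: "convergent b" "\<And>k. \<bar>a k - b k\<bar> \<le> e / 4"
    using assms[of "e / 4"] by auto
  obtain M where M: "\<And>m n. m \<ge> M \<Longrightarrow> n \<ge> M \<Longrightarrow> norm (b m - b n) < e / 4"
    using CauchyD[OF convergent_Cauchy[OF b(1)], of "e / 4"] e by auto
  have "norm (a m - a n) < e" if "m \<ge> M" "n \<ge> M" for m n
    using M[OF that] b(2)[of m] b(2)[of n] e unfolding real_norm_def by linarith
  then show "\<exists>M. \<forall>m\<ge>M. \<forall>n\<ge>M. norm (a m - a n) < e" by blast
qed

section \<open>Descent of the envelope along the iterates\<close>

text \<open>What the drift argument uses of the method: Lipschitz samples with a square integrable constant and
  the one-step inequality against every nearby competitor \<open>y\<close>, with an integrable model error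
  \<open>\<delta>\<close>.\<close>

locale prox_descent = P: prob_space P + \<Omega>: prob_space \<Omega>
  for P :: "'s measure" and \<Omega> :: "'w measure" +
  fixes X :: "'a::euclidean_space set" and f :: "'a \<Rightarrow> 's \<Rightarrow> real" and \<phi> :: "'a \<Rightarrow> real"
    and \<alpha> :: "nat \<Rightarrow> real" and S :: "nat \<Rightarrow> 'w \<Rightarrow> 's" and x :: "nat \<Rightarrow> 'w \<Rightarrow> 'a"
    and Mf \<delta> :: "'s \<Rightarrow> real" and L r :: real
  assumes X: "compact X" "X \<noteq> {}"
    and f: "\<And>y. integrable P (f y)"
    and \<phi>m: "\<phi> \<in> borel_measurable borel"
    and L: "0 \<le> L" "\<And>y z. y \<in> X \<Longrightarrow> z \<in> X \<Longrightarrow> \<bar>\<phi> y - \<phi> z\<bar> \<le> L * norm (y - z)"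
    and Mf: "Mf \<in> borel_measurable P" "\<And>s. 0 \<le> Mf s" "integrable P (\<lambda>s. (Mf s)\<^sup>2)"
    and lip: "AE s in P. \<forall>y\<in>X. \<forall>z\<in>X. \<bar>f y s - f z s\<bar> \<le> Mf s * norm (y - z)"
    and \<delta>: "integrable P \<delta>" "\<And>s. s \<in> space P \<Longrightarrow> 0 \<le> \<delta> s"
    and \<alpha>: "\<And>k. 0 < \<alpha> k" "(\<Sum>k. ennreal (\<alpha> k)) = \<infinity>" "summable (\<lambda>k. (\<alpha> k)\<^sup>2)"
    and S: "\<Omega>.indep_vars (\<lambda>_. P) S UNIV" "\<And>k. distr \<Omega> P (S k) = P"
    and x: "\<And>k. x k \<in> borel_measurable (sample_algebra \<Omega> P S k)" "\<And>k \<omega>. \<omega> \<in> space \<Omega> \<Longrightarrow> x k \<omega> \<in> X"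
    and r: "0 < r"
    and step: "\<And>k. AE \<omega> in \<Omega>. \<forall>y\<in>X. norm (y - x k \<omega>) < r \<longrightarrow>
      (norm (y - x (Suc k) \<omega>))\<^sup>2 \<le> (norm (y - x k \<omega>))\<^sup>2
        - 2 * \<alpha> k * (f (x k \<omega>) (S k \<omega>) + \<phi> (x k \<omega>) - f y (S k \<omega>) - \<phi> y)
        + \<alpha> k * \<delta> (S k \<omega>) * (norm (y - x k \<omega>))\<^sup>2 + (\<alpha> k)\<^sup>2 * (Mf (S k \<omega>) + L)\<^sup>2"
begin

abbreviation F :: "'a \<Rightarrow> real" where "F \<equiv> objective P f \<phi>"

definition LF :: real where "LF = (LINT s|P. Mf s) + L"

abbreviation \<Phi> :: "real \<Rightarrow> 'a \<Rightarrow> real" where "\<Phi> \<equiv> moreau_env X F"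

lemma S_measurable [measurable]: "S k \<in> measurable \<Omega> P"
  using S(1) by (auto simp: \<Omega>.indep_vars_def)

lemma x_measurable [measurable]: "x k \<in> borel_measurable \<Omega>"
  using measurable_from_subalg[OF subalgebra_sample_algebra[OF S_measurable] x(1)] .

lemma Mf_integrable: "integrable P Mf"
  using P.square_integrable_imp_integrable[OF Mf(1,3)] .

lemma risk_lipschitz:
  assumes "y \<in> X" "z \<in> X"
  shows "\<bar>risk P f y - risk P f z\<bar> \<le> (LINT s|P. Mf s) * norm (y - z)"
proof -
  have "\<bar>risk P f y - risk P f z\<bar> = \<bar>LINT s|P. f y s - f z s\<bar>"
    using f by (simp add: risk_def)
  also have "\<dots> \<le> (LINT s|P. \<bar>f y s - f z s\<bar>)" by (rule integral_abs_bound)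
  also have "\<dots> \<le> (LINT s|P. Mf s * norm (y - z))"
  proof (rule integral_mono_AE)
    show "AE s in P. \<bar>f y s - f z s\<bar> \<le> Mf s * norm (y - z)"
      using lip by eventually_elim (use assms in blast)
    show "integrable P (\<lambda>s. \<bar>f y s - f z s\<bar>)"
      by (intro integrable_abs Bochner_Integration.integrable_diff f)
  qed (intro integrable_mult_left Mf_integrable)
  finally show ?thesis by simp
qed

lemma F_lipschitz:
  assumes "y \<in> X" "z \<in> X"
  shows "\<bar>F y - F z\<bar> \<le> LF * norm (y - z)"
  using risk_lipschitz[OF assms] L(2)[OF assms] unfolding objective_def LF_def distrib_right by linarith

lemma LF_nonneg: "0 \<le> LF"
  unfolding LF_def using L(1) Mf(2) by (simp add: integral_nonneg)

lemma F_continuous: "continuous_on X F"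
proof -
  have "LF-lipschitz_on X F"
    using F_lipschitz LF_nonneg by (intro lipschitz_onI) (auto simp: dist_norm)
  then show ?thesis by (rule lipschitz_on_continuous_on)
qed

lemma \<Phi>_continuous: "0 \<le> \<rho> \<Longrightarrow> continuous_on UNIV (\<Phi> \<rho>)"
  by (rule continuous_on_moreau_env[OF X F_continuous])

lemma \<Phi>_bounded:
  assumes "0 < \<rho>"
  shows "\<exists>b. \<forall>y\<in>X. \<bar>\<Phi> \<rho> y\<bar> \<le> b"
proof -
  have "compact (\<Phi> \<rho> ` X)"
    using assms X by (intro compact_continuous_image continuous_on_subset[OF \<Phi>_continuous]) auto
  then have "bounded (\<Phi> \<rho> ` X)" by (rule compact_imp_bounded)
  then show ?thesis by (auto simp: bounded_iff)
qed

lemma gap_bounds: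
  assumes "0 < \<rho>" "y \<in> X"
  shows "0 \<le> F y - \<Phi> \<rho> y" "F y - \<Phi> \<rho> y \<le> LF\<^sup>2 / (2 * \<rho>)"
  using moreau_env_gap_bounds[OF X(1) assms(2) F_continuous assms(1) F_lipschitz] by auto

text \<open>For a competitor \<open>y\<close> near \<open>x\<^sub>k\<close> the envelope at \<open>x\<^sub>k\<^sub>+\<^sub>1\<close> is at most \<open>F y + \<rho>/2 |y - x\<^sub>k\<^sub>+\<^sub>1|\<^sup>2\<close>. With \<open>y\<close> the
  proximal point of \<open>x\<^sub>k\<close>, the one-step inequality bounds the change from \<open>\<Phi>\<^sub>\<rho> (x\<^sub>k)\<close> by
  \<open>\<rho>/2\<close> times a quantity of mean \<open>- 2\<alpha> (F x\<^sub>k - F y) + \<alpha> E\<delta> |y - x\<^sub>k|\<^sup>2 + O(\<alpha>\<^sup>2)\<close>. Here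
  \<open>F x\<^sub>k - F y\<close> is the gap plus \<open>\<rho>/2 |y - x\<^sub>k|\<^sup>2\<close>, and the second part absorbs the model error
  because \<open>\<rho> \<ge> E\<delta>\<close>. The condition \<open>2 LF / \<rho> < r\<close> keeps \<open>y\<close> in the range where the model error is
  controlled.\<close>

lemma envelope_drift:
  assumes \<rho>: "0 < \<rho>" "(LINT s|P. \<delta> s) \<le> \<rho>" "2 * LF / \<rho> < r"
  shows "\<exists>C\<ge>0. \<forall>k. \<forall>A\<in>sets (sample_algebra \<Omega> P S k).
    (LINT \<omega>|\<Omega>. indicator A \<omega> * (\<Phi> \<rho> (x (Suc k) \<omega>) - \<Phi> \<rho> (x k \<omega>)))
      \<le> - \<rho> * \<alpha> k * (LINT \<omega>|\<Omega>. indicator A \<omega> * (F (x k \<omega>) - \<Phi> \<rho> (x k \<omega>))) + C * (\<alpha> k)\<^sup>2 * \<Omega>.prob A"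
proof -
  obtain T where T: "countable T" "T \<subseteq> X" "X \<subseteq> closure T" using separable by blast
  have "T \<noteq> {}" using T X by auto
  define p where "p = from_nat_into T"
  have "range p = T" unfolding p_def using T \<open>T \<noteq> {}\<close> by (simp add: range_from_nat_into)
  then have p: "range p \<subseteq> X" "X \<subseteq> closure (range p)" using T by auto
  have pX: "p n \<in> X" for n using p(1) by blast
  obtain R where R: "\<And>y. y \<in> X \<Longrightarrow> norm y \<le> R"
    using compact_imp_bounded[OF X(1)] by (auto simp: bounded_iff)
  have diam: "norm (y - z) \<le> 2 * R" if "y \<in> X" "z \<in> X" for y z
    using norm_triangle_ineq4[of y z] R[OF that(1)] R[OF that(2)] by linarith
  define \<mu> where "\<mu> = (LINT s|P. Mf s)"
  define K2 where "K2 = (LINT s|P. (Mf s + L)\<^sup>2)"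
  define Q where "Q = 1 + (\<Sum>k. (\<alpha> k)\<^sup>2)"
  have \<mu>0: "0 \<le> \<mu>" unfolding \<mu>_def using Mf(2) by (simp add: integral_nonneg)
  have K20: "0 \<le> K2" unfolding K2_def by (simp add: integral_nonneg)
  have Q0: "0 \<le> Q" unfolding Q_def by (intro add_nonneg_nonneg suminf_nonneg \<alpha>) auto
  have \<alpha>Q: "\<alpha> k \<le> Q" for k
  proof -
    have "(\<alpha> k)\<^sup>2 \<le> (\<Sum>k. (\<alpha> k)\<^sup>2)" using sum_le_suminf[OF \<alpha>(3), of "{k}"] by simp
    moreover have "\<alpha> k \<le> 1 + (\<alpha> k)\<^sup>2" using sum_power2_ge_zero[of "\<alpha> k - 1/2" 0]
      by (simp add: power2_eq_square algebra_simps)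
    ultimately show ?thesis by (simp add: Q_def)
  qed
  have iK2: "integrable P (\<lambda>s. (Mf s + L)\<^sup>2)"
    unfolding power2_sum
    by (intro Bochner_Integration.integrable_add integrable_mult_left integrable_mult_right Mf Mf_integrable) auto
  define C0 where "C0 = \<rho> / 2 * (2 * Q + 4 * \<mu> + K2) + 1"
  have C00: "0 \<le> C0" unfolding C0_def using \<rho> Q0 \<mu>0 K20 by simp
  have \<Phi>m: "\<Phi> \<rho> \<in> borel_measurable borel"
    using \<Phi>_continuous \<rho> by (intro borel_measurable_continuous_onI) auto
  show ?thesis
  proof (intro exI[of _ C0] conjI allI ballI C00)
    fix k A assume A: "A \<in> sets (sample_algebra \<Omega> P S k)"
    define a where "a = \<alpha> k"
    have a: "0 < a" "a \<le> Q" using \<alpha> \<alpha>Q by (auto simp: a_def)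
    \<comment> \<open>The proximal point of \<open>y\<close> is replaced by a nearby member of a dense sequence, at a cost of \<open>a\<^sup>2\<close>.\<close>
    define sel where "sel y = (LEAST n. norm (p n - y) < r \<and>
        F (p n) + \<rho> / 2 * (norm (p n - y))\<^sup>2 < \<Phi> \<rho> y + a\<^sup>2)" for y
    \<comment> \<open>Likewise \<open>y\<close> itself, wherever it is inserted into a sample function; by the Lipschitz bound this costs
      at most \<open>a * Mf s\<close>, again of order \<open>a\<^sup>2\<close> after multiplication by \<open>a\<close>.\<close>
    define app where "app y = (LEAST n. norm (p n - y) < a)" for y
    have sel_m[measurable]: "sel \<in> measurable borel (count_space UNIV)"
      unfolding sel_def using \<Phi>m by measurable
    have app_m[measurable]: "app \<in> measurable borel (count_space UNIV)"
      unfolding app_def by measurable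
    have sel: "norm (p (sel y) - y) < r"
      "F (p (sel y)) + \<rho> / 2 * (norm (p (sel y) - y))\<^sup>2 < \<Phi> \<rho> y + a\<^sup>2" if y: "y \<in> X" for y
    proof -
      have "\<exists>n. norm (p n - y) < r \<and> F (p n) + \<rho> / 2 * (norm (p n - y))\<^sup>2 < \<Phi> \<rho> y + a\<^sup>2"
        by (rule moreau_env_approx_minimizer_in_dense_sequence[OF X(1) y F_continuous \<rho>(1) F_lipschitz
              LF_nonneg \<rho>(3) _ p]) (use a in auto)
      from LeastI_ex[OF this]
      show "norm (p (sel y) - y) < r"
        "F (p (sel y)) + \<rho> / 2 * (norm (p (sel y) - y))\<^sup>2 < \<Phi> \<rho> y + a\<^sup>2"
        unfolding sel_def by auto
    qed
    have app: "norm (p (app y) - y) < a" if y: "y \<in> X" for y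
    proof -
      have "\<exists>n. norm (p n - y) < a"
        using p(2) y a(1) by (fastforce simp: closure_approachable dist_norm)
      from LeastI_ex[OF this] show ?thesis unfolding app_def .
    qed
    \<comment> \<open>\<open>V (x k, indicator A) (S k)\<close> bounds the change of the envelope on the event \<open>A\<close>, up to \<open>a\<^sup>2\<close>.\<close>
    define V where "V = (\<lambda>(y, h) s. h * (\<rho> / 2 * (
        - 2 * a * (f (p (app y)) s + \<phi> y - f (p (sel y)) s - \<phi> (p (sel y))) + 2 * a\<^sup>2 * Mf s
        + a * (norm (p (sel y) - y))\<^sup>2 * \<delta> s + a\<^sup>2 * (Mf s + L)\<^sup>2)))"
    define B where "B s = \<rho> / 2 * (2 * a * (Mf s * (2 * R) + L * (2 * R)) + 2 * a\<^sup>2 * Mf s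
        + a * r\<^sup>2 * \<delta> s + a\<^sup>2 * (Mf s + L)\<^sup>2)" for s
    \<comment> \<open>The risk is only known to be continuous on \<open>X\<close>, so the gap is cut off there to make it measurable.\<close>
    define G where "G y = indicator X y *\<^sub>R (F y - \<Phi> \<rho> y)" for y
    define c where "c = (\<lambda>(y, h). h * (- \<rho> * a * G y + (C0 - 1) * a\<^sup>2))"
    define Z where "Z \<omega> = (x k \<omega>, indicator A \<omega> :: real)" for \<omega>
    let ?N = "borel \<Otimes>\<^sub>M borel :: ('a \<times> real) measure"
    let ?A = "X \<times> {0..1::real}"
    have Zk: "Z \<in> measurable (sample_algebra \<Omega> P S k) ?N"
      unfolding Z_def using x(1) A by measurable
    have Zm: "Z \<in> measurable \<Omega> ?N"
      using measurable_from_subalg[OF subalgebra_sample_algebra[of S \<Omega> P, OF S_measurable] Zk] .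
    have joint: "distr \<Omega> ?N Z \<Otimes>\<^sub>M P = distr \<Omega> (?N \<Otimes>\<^sub>M P) (\<lambda>\<omega>. (Z \<omega>, S k \<omega>))"
      by (rule \<Omega>.past_next_sample_joint_distr[OF S(1) S(2) Zk])
    have fm[measurable]: "f y \<in> borel_measurable P" for y using f by auto
    have \<delta>m[measurable]: "\<delta> \<in> borel_measurable P" using \<delta> by auto
    note Mf(1)[measurable] \<phi>m[measurable]
    have Vm: "(\<lambda>(z, s). V z s) \<in> borel_measurable (?N \<Otimes>\<^sub>M P)"
    proof -
      have 1: "(\<lambda>w. f (p (app (fst (fst w)))) (snd w)) \<in> borel_measurable (?N \<Otimes>\<^sub>M P)"
        by (rule measurable_compose_countable[where g = "\<lambda>w. app (fst (fst w))"]) measurable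
      have 2: "(\<lambda>w. f (p (sel (fst (fst w)))) (snd w)) \<in> borel_measurable (?N \<Otimes>\<^sub>M P)"
        by (rule measurable_compose_countable[where g = "\<lambda>w. sel (fst (fst w))"]) measurable
      have 3: "(\<lambda>w. \<phi> (p (sel (fst (fst w))))) \<in> borel_measurable (?N \<Otimes>\<^sub>M P)"
        by (rule measurable_compose_countable[where g = "\<lambda>w. sel (fst (fst w))"]) measurable
      have 4: "(\<lambda>w. norm (p (sel (fst (fst w))) - fst (fst w))) \<in> borel_measurable (?N \<Otimes>\<^sub>M P)"
        by (rule measurable_compose_countable[where g = "\<lambda>w. sel (fst (fst w))"]) measurable
      note [measurable] = 1 2 3 4
      show ?thesis unfolding V_def case_prod_beta by measurable
    qed
    have AN: "?A \<in> sets ?N" using X(1) by (intro pair_measureI) (auto dest: compact_imp_closed)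
    have ZA: "Z \<omega> \<in> ?A" if "\<omega> \<in> space \<Omega>" for \<omega>
      using x(2)[OF that] by (auto simp: Z_def indicator_def)
    have Bi: "integrable P B"
      unfolding B_def
      by (intro integrable_mult_right Bochner_Integration.integrable_add integrable_mult_left
          Mf_integrable \<delta> iK2) auto
    have VB: "AE s in P. \<forall>z\<in>?A. \<bar>V z s\<bar> \<le> B s"
      using lip AE_space
    proof eventually_elim
      fix s assume lp: "\<forall>y\<in>X. \<forall>z\<in>X. \<bar>f y s - f z s\<bar> \<le> Mf s * norm (y - z)" and s: "s \<in> space P"
      show "\<forall>z\<in>?A. \<bar>V z s\<bar> \<le> B s"
      proof safe
        fix y :: 'a and h :: real assume y: "y \<in> X" and h: "h \<in> {0..1}"
        let ?d = "f (p (app y)) s + \<phi> y - f (p (sel y)) s - \<phi> (p (sel y))"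
        let ?e = "2 * a\<^sup>2 * Mf s + a * (norm (p (sel y) - y))\<^sup>2 * \<delta> s + a\<^sup>2 * (Mf s + L)\<^sup>2"
        have "\<bar>f (p (app y)) s - f (p (sel y)) s\<bar> \<le> Mf s * (2 * R)"
          using lp[rule_format, OF pX pX] diam[OF pX pX] Mf(2) by (meson mult_left_mono order_trans)
        moreover have "\<bar>\<phi> y - \<phi> (p (sel y))\<bar> \<le> L * (2 * R)"
          using L(2)[OF y pX] diam[OF y pX] L(1) by (meson mult_left_mono order_trans)
        ultimately have "\<bar>?d\<bar> \<le> Mf s * (2 * R) + L * (2 * R)" by linarith
        then have "2 * a * \<bar>?d\<bar> \<le> 2 * a * (Mf s * (2 * R) + L * (2 * R))"
          using a by (intro mult_left_mono) auto
        then have d: "\<bar>- 2 * a * ?d\<bar> \<le> 2 * a * (Mf s * (2 * R) + L * (2 * R))"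
          using a by (simp add: abs_mult)
        have "(norm (p (sel y) - y))\<^sup>2 \<le> r\<^sup>2"
          using sel(1)[OF y] by (intro power_mono) auto
        then have "a * (norm (p (sel y) - y))\<^sup>2 * \<delta> s \<le> a * r\<^sup>2 * \<delta> s"
          using a \<delta>(2)[OF s] by (intro mult_right_mono mult_left_mono) auto
        moreover have "0 \<le> ?e" using a \<delta>(2)[OF s] Mf(2) by (intro add_nonneg_nonneg mult_nonneg_nonneg) auto
        ultimately have "\<bar>- 2 * a * ?d + ?e\<bar> \<le> 2 * a * (Mf s * (2 * R) + L * (2 * R)) + 2 * a\<^sup>2 * Mf s
            + a * r\<^sup>2 * \<delta> s + a\<^sup>2 * (Mf s + L)\<^sup>2"
          using d by linarith
        then have "\<rho> / 2 * \<bar>- 2 * a * ?d + ?e\<bar> \<le> B s"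
          unfolding B_def using \<rho> by (intro mult_left_mono) auto
        moreover have "\<bar>V (y, h) s\<bar> = h * (\<rho> / 2 * \<bar>- 2 * a * ?d + ?e\<bar>)"
        proof -
          have "V (y, h) s = h * (\<rho> / 2 * (- 2 * a * ?d + ?e))"
            by (simp only: V_def prod.case add.assoc)
          moreover have "\<bar>h * (\<rho> / 2 * w)\<bar> = h * (\<rho> / 2 * \<bar>w\<bar>)" for w
            using h \<rho>(1) by (simp add: abs_mult)
          ultimately show ?thesis by (simp only:)
        qed
        moreover have "h * (\<rho> / 2 * \<bar>- 2 * a * ?d + ?e\<bar>) \<le> 1 * (\<rho> / 2 * \<bar>- 2 * a * ?d + ?e\<bar>)"
          using h \<rho> by (intro mult_right_mono) auto
        ultimately show "\<bar>V (y, h) s\<bar> \<le> B s" by linarith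
      qed
    qed
    have Gm[measurable]: "G \<in> borel_measurable borel"
      unfolding G_def using X(1) \<rho>
      by (intro borel_measurable_continuous_on_indicator continuous_intros F_continuous
          continuous_on_subset[OF \<Phi>_continuous]) (auto dest: compact_imp_closed)
    have G: "G y = F y - \<Phi> \<rho> y" if "y \<in> X" for y using that by (simp add: G_def)
    have Gb: "0 \<le> G y" "G y \<le> LF\<^sup>2 / (2 * \<rho>)" if "y \<in> X" for y
      using gap_bounds[OF \<rho>(1) that] G[OF that] by auto
    have cm: "c \<in> borel_measurable ?N" unfolding c_def by measurable
    have cb: "\<bar>c z\<bar> \<le> \<rho> * a * (LF\<^sup>2 / (2 * \<rho>)) + (C0 - 1) * a\<^sup>2" if zA: "z \<in> ?A" for z
    proof -
      obtain y h where z: "z = (y, h)" "y \<in> X" "0 \<le> h" "h \<le> 1" using zA by auto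
      have \<rho>a: "0 \<le> \<rho> * a" using \<rho>(1) a(1) by simp
      have 1: "\<rho> * a * G y \<le> \<rho> * a * (LF\<^sup>2 / (2 * \<rho>))" "0 \<le> \<rho> * a * G y"
        using mult_left_mono[OF Gb(2)[OF z(2)] \<rho>a] mult_nonneg_nonneg[OF \<rho>a Gb(1)[OF z(2)]] .
      have 2: "0 \<le> (C0 - 1) * a\<^sup>2" unfolding C0_def using \<rho> Q0 \<mu>0 K20 by simp
      have "\<bar>c z\<bar> = h * \<bar>- (\<rho> * a * G y) + (C0 - 1) * a\<^sup>2\<bar>" using z by (simp add: c_def abs_mult)
      also have "\<dots> \<le> 1 * \<bar>- (\<rho> * a * G y) + (C0 - 1) * a\<^sup>2\<bar>" using z by (intro mult_right_mono) auto
      also have "\<dots> \<le> \<rho> * a * (LF\<^sup>2 / (2 * \<rho>)) + (C0 - 1) * a\<^sup>2"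
      proof -
        have "\<bar>- u + w\<bar> \<le> u' + w" if "u \<le> u'" "0 \<le> u" "0 \<le> w" for u u' w :: real
          using that by linarith
        from this[OF 1 2] show ?thesis by simp
      qed
      finally show ?thesis .
    qed
    have mean: "(LINT s|P. V z s) \<le> c z" if zA: "z \<in> ?A" for z
    proof -
      obtain y h where z: "z = (y, h)" "y \<in> X" "0 \<le> h" "h \<le> 1" using zA by auto
      define q where "q = p (sel y)"
      define n where "n = (norm (q - y))\<^sup>2"
      have qX: "q \<in> X" using pX by (simp add: q_def)
      have hf: "has_bochner_integral P (f w) (risk P f w)" for w
        unfolding risk_def by (rule has_bochner_integral_integrable[OF f])
      have hc: "has_bochner_integral P (\<lambda>_. w) w" for w :: real
        by (simp add: has_bochner_integral_iff P.prob_space)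
      have hM: "has_bochner_integral P Mf \<mu>"
        unfolding \<mu>_def by (rule has_bochner_integral_integrable[OF Mf_integrable])
      have hd: "has_bochner_integral P \<delta> (LINT s|P. \<delta> s)"
        by (rule has_bochner_integral_integrable[OF \<delta>(1)])
      have hK: "has_bochner_integral P (\<lambda>s. (Mf s + L)\<^sup>2) K2"
        unfolding K2_def by (rule has_bochner_integral_integrable[OF iK2])
      have "has_bochner_integral P (\<lambda>s. h * (\<rho> / 2 * (
          - 2 * a * (f (p (app y)) s + \<phi> y - f q s - \<phi> q) + 2 * a\<^sup>2 * Mf s + a * n * \<delta> s + a\<^sup>2 * (Mf s + L)\<^sup>2)))
        (h * (\<rho> / 2 * (- 2 * a * (risk P f (p (app y)) + \<phi> y - risk P f q - \<phi> q) + 2 * a\<^sup>2 * \<mu>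
          + a * n * (LINT s|P. \<delta> s) + a\<^sup>2 * K2)))"
        by (intro has_bochner_integral_mult_right has_bochner_integral_add has_bochner_integral_diff
            hf hc hM hd hK)
      then have Vint: "(LINT s|P. V z s) = h * (\<rho> / 2 * (- 2 * a * (risk P f (p (app y)) + \<phi> y - risk P f q - \<phi> q)
          + 2 * a\<^sup>2 * \<mu> + a * n * (LINT s|P. \<delta> s) + a\<^sup>2 * K2))"
        unfolding z V_def q_def n_def by (simp add: has_bochner_integral_iff)
      have "\<bar>risk P f (p (app y)) - risk P f y\<bar> \<le> \<mu> * norm (p (app y) - y)"
        unfolding \<mu>_def by (rule risk_lipschitz[OF pX z(2)])
      also have "\<dots> \<le> \<mu> * a" using app[OF z(2)] \<mu>0 by (intro mult_left_mono) auto
      finally have ra: "risk P f (p (app y)) \<ge> risk P f y - \<mu> * a" by linarith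
      have "G y + \<rho> / 2 * n - a\<^sup>2 \<le> F y - F q"
        using sel(2)[OF z(2)] G[OF z(2)] unfolding q_def n_def by linarith
      then have "G y + \<rho> / 2 * n - a\<^sup>2 - \<mu> * a \<le> risk P f (p (app y)) + \<phi> y - risk P f q - \<phi> q"
        using ra unfolding objective_def by linarith
      then have lower: "2 * a * (G y + \<rho> / 2 * n - a\<^sup>2 - \<mu> * a)
          \<le> 2 * a * (risk P f (p (app y)) + \<phi> y - risk P f q - \<phi> q)"
        using a by (intro mult_left_mono) auto
      have expand: "2 * a * (G y + \<rho> / 2 * n - a\<^sup>2 - \<mu> * a)
          = 2 * (a * G y) + a * n * \<rho> - 2 * (a * a\<^sup>2) - 2 * (\<mu> * a\<^sup>2)"
        by (simp add: algebra_simps power2_eq_square)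
      have cubic: "a * a\<^sup>2 \<le> Q * a\<^sup>2" using a by (intro mult_right_mono) auto
      have quad: "a * n * (LINT s|P. \<delta> s) \<le> a * n * \<rho>"
        using \<rho>(2) a by (intro mult_left_mono) (auto simp: n_def)
      have "- 2 * a * (risk P f (p (app y)) + \<phi> y - risk P f q - \<phi> q)
          + 2 * a\<^sup>2 * \<mu> + a * n * (LINT s|P. \<delta> s) + a\<^sup>2 * K2
          \<le> - 2 * (a * G y) + (2 * (Q * a\<^sup>2) + 4 * (\<mu> * a\<^sup>2) + a\<^sup>2 * K2)"
      proof -
        have "- 2 * a * w = - (2 * a * w)" "2 * a\<^sup>2 * \<mu> = 2 * (\<mu> * a\<^sup>2)" for w by simp_all
        moreover have "- A' + 2 * m + d + k \<le> - 2 * g + (2 * t + 4 * m + k)"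
          if "2 * g + d' - 2 * t' - 2 * m \<le> A'" "t' \<le> t" "d \<le> d'" for A' m d k g t t' d' :: real
          using that by linarith
        note this[OF lower[unfolded expand] cubic quad]
        ultimately show ?thesis by (simp only:)
      qed
      then have "h * (\<rho> / 2 * (- 2 * a * (risk P f (p (app y)) + \<phi> y - risk P f q - \<phi> q)
          + 2 * a\<^sup>2 * \<mu> + a * n * (LINT s|P. \<delta> s) + a\<^sup>2 * K2))
        \<le> h * (\<rho> / 2 * (- 2 * (a * G y) + (2 * (Q * a\<^sup>2) + 4 * (\<mu> * a\<^sup>2) + a\<^sup>2 * K2)))"
        using z \<rho> by (intro mult_left_mono) auto
      also have "\<dots> = c z" unfolding z c_def C0_def by (simp add: algebra_simps)
      finally show ?thesis unfolding Vint .
    qed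
    note freeze = \<Omega>.indep_var_freezing_le[OF Zm S_measurable S(2) joint Vm AN ZA Bi VB cm cb mean]
    have AM: "A \<in> sets \<Omega>"
      using A subalgebra_sample_algebra[of S \<Omega> P, OF S_measurable] by (auto simp: subalgebra_def)
    have iA: "integrable \<Omega> (indicator A :: _ \<Rightarrow> real)"
      using AM by (intro integrable_real_indicator) (auto simp: \<Omega>.emeasure_eq_measure)
    have "AE s in distr \<Omega> P (S k). \<forall>y\<in>X. \<forall>z\<in>X. \<bar>f y s - f z s\<bar> \<le> Mf s * norm (y - z)"
      unfolding S(2) by (rule lip)
    from AE_distrD[OF S_measurable this]
    have lipS: "AE \<omega> in \<Omega>. \<forall>y\<in>X. \<forall>z\<in>X. \<bar>f y (S k \<omega>) - f z (S k \<omega>)\<bar> \<le> Mf (S k \<omega>) * norm (y - z)" .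
    have path: "AE \<omega> in \<Omega>. indicator A \<omega> * (\<Phi> \<rho> (x (Suc k) \<omega>) - \<Phi> \<rho> (x k \<omega>))
        \<le> V (Z \<omega>) (S k \<omega>) + a\<^sup>2 * indicator A \<omega>"
      using lipS step[of k] AE_space
    proof eventually_elim
      fix \<omega> assume lp: "\<forall>y\<in>X. \<forall>z\<in>X. \<bar>f y (S k \<omega>) - f z (S k \<omega>)\<bar> \<le> Mf (S k \<omega>) * norm (y - z)"
        and st: "\<forall>y\<in>X. norm (y - x k \<omega>) < r \<longrightarrow>
          (norm (y - x (Suc k) \<omega>))\<^sup>2 \<le> (norm (y - x k \<omega>))\<^sup>2
            - 2 * \<alpha> k * (f (x k \<omega>) (S k \<omega>) + \<phi> (x k \<omega>) - f y (S k \<omega>) - \<phi> y)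
            + \<alpha> k * \<delta> (S k \<omega>) * (norm (y - x k \<omega>))\<^sup>2 + (\<alpha> k)\<^sup>2 * (Mf (S k \<omega>) + L)\<^sup>2"
        and \<omega>: "\<omega> \<in> space \<Omega>"
      define y where "y = x k \<omega>"
      define s where "s = S k \<omega>"
      define q where "q = p (sel y)"
      define E where "E = - 2 * a * (f (p (app y)) s + \<phi> y - f q s - \<phi> q) + 2 * a\<^sup>2 * Mf s
        + a * (norm (q - y))\<^sup>2 * \<delta> s + a\<^sup>2 * (Mf s + L)\<^sup>2"
      have yX: "y \<in> X" and qX: "q \<in> X" using x(2)[OF \<omega>] pX by (auto simp: y_def q_def)
      have "\<bar>f (p (app y)) s - f y s\<bar> \<le> Mf s * norm (p (app y) - y)"
        using lp pX yX unfolding s_def by blast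
      also have "\<dots> \<le> Mf s * a" using app[OF yX] Mf(2) by (intro mult_left_mono) auto
      finally have "f (p (app y)) s - Mf s * a \<le> f y s" by linarith
      then have "2 * a * (f (p (app y)) s - Mf s * a + \<phi> y - f q s - \<phi> q)
          \<le> 2 * a * (f y s + \<phi> y - f q s - \<phi> q)"
        using a by (intro mult_left_mono) auto
      then have le: "- 2 * a * (f y s + \<phi> y - f q s - \<phi> q)
          \<le> - 2 * a * (f (p (app y)) s + \<phi> y - f q s - \<phi> q) + 2 * a\<^sup>2 * Mf s"
        by (simp add: algebra_simps power2_eq_square)
      have "(norm (q - x (Suc k) \<omega>))\<^sup>2 \<le> (norm (q - y))\<^sup>2 + E"
        using st[rule_format, OF qX] sel(1)[OF yX] le
        unfolding y_def[symmetric] s_def[symmetric] a_def[symmetric] q_def[symmetric] E_def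
        by (simp add: mult.commute mult.left_commute)
      then have "\<rho> / 2 * (norm (q - x (Suc k) \<omega>))\<^sup>2 \<le> \<rho> / 2 * ((norm (q - y))\<^sup>2 + E)"
        using \<rho> by (intro mult_left_mono) auto
      moreover have "\<Phi> \<rho> (x (Suc k) \<omega>) \<le> F q + \<rho> / 2 * (norm (q - x (Suc k) \<omega>))\<^sup>2"
        by (rule moreau_env_le[OF X(1) F_continuous qX])
      moreover have "F q + \<rho> / 2 * (norm (q - y))\<^sup>2 < \<Phi> \<rho> y + a\<^sup>2"
        using sel(2)[OF yX] by (simp add: q_def)
      ultimately have "\<Phi> \<rho> (x (Suc k) \<omega>) - \<Phi> \<rho> y \<le> \<rho> / 2 * E + a\<^sup>2"
        by (simp add: distrib_left)
      moreover have "V (Z \<omega>) (S k \<omega>) = indicator A \<omega> * (\<rho> / 2 * E)"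
        by (simp add: V_def Z_def E_def q_def y_def s_def)
      ultimately show "indicator A \<omega> * (\<Phi> \<rho> (x (Suc k) \<omega>) - \<Phi> \<rho> (x k \<omega>))
          \<le> V (Z \<omega>) (S k \<omega>) + a\<^sup>2 * indicator A \<omega>"
        by (cases "\<omega> \<in> A") (simp_all add: y_def)
    qed
    have \<Phi>xm: "(\<lambda>\<omega>. \<Phi> \<rho> (x j \<omega>)) \<in> borel_measurable \<Omega>" for j
      using measurable_compose[OF x_measurable \<Phi>m] .
    obtain b where b: "\<And>y. y \<in> X \<Longrightarrow> \<bar>\<Phi> \<rho> y\<bar> \<le> b" using \<Phi>_bounded[OF \<rho>(1)] by auto
    have i1: "integrable \<Omega> (\<lambda>\<omega>. indicator A \<omega> * (\<Phi> \<rho> (x (Suc k) \<omega>) - \<Phi> \<rho> (x k \<omega>)))"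
    proof (rule \<Omega>.integrable_const_bound[where B = "2 * b"])
      show "AE \<omega> in \<Omega>. norm (indicator A \<omega> * (\<Phi> \<rho> (x (Suc k) \<omega>) - \<Phi> \<rho> (x k \<omega>))) \<le> 2 * b"
      proof (rule AE_I2)
        fix \<omega> assume "\<omega> \<in> space \<Omega>"
        then show "norm (indicator A \<omega> * (\<Phi> \<rho> (x (Suc k) \<omega>) - \<Phi> \<rho> (x k \<omega>))) \<le> 2 * b"
          using b[OF x(2), of \<omega> k] b[OF x(2), of \<omega> "Suc k"] by (auto simp: indicator_def)
      qed
    qed (use AM \<Phi>xm in measurable)
    have i2: "integrable \<Omega> (\<lambda>\<omega>. indicator A \<omega> * G (x k \<omega>))"
    proof (rule \<Omega>.integrable_const_bound[where B = "LF\<^sup>2 / (2 * \<rho>)"])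
      show "AE \<omega> in \<Omega>. norm (indicator A \<omega> * G (x k \<omega>)) \<le> LF\<^sup>2 / (2 * \<rho>)"
      proof (rule AE_I2)
        fix \<omega> assume "\<omega> \<in> space \<Omega>"
        then show "norm (indicator A \<omega> * G (x k \<omega>)) \<le> LF\<^sup>2 / (2 * \<rho>)"
          using Gb[OF x(2), of \<omega> k] by (auto simp: indicator_def)
      qed
    qed (use AM in measurable)
    have "(LINT \<omega>|\<Omega>. indicator A \<omega> * (\<Phi> \<rho> (x (Suc k) \<omega>) - \<Phi> \<rho> (x k \<omega>)))
        \<le> (LINT \<omega>|\<Omega>. V (Z \<omega>) (S k \<omega>) + a\<^sup>2 * indicator A \<omega>)"
      by (intro integral_mono_AE i1 path Bochner_Integration.integrable_add freeze(1) integrable_mult_right iA)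
    also have "\<dots> = (LINT \<omega>|\<Omega>. V (Z \<omega>) (S k \<omega>)) + a\<^sup>2 * \<Omega>.prob A"
      using freeze(1) iA AM sets.sets_into_space[OF AM] by (simp add: Int_absorb2)
    also have "\<dots> \<le> (LINT \<omega>|\<Omega>. c (Z \<omega>)) + a\<^sup>2 * \<Omega>.prob A" using freeze(2) by simp
    also have "(LINT \<omega>|\<Omega>. c (Z \<omega>))
        = (LINT \<omega>|\<Omega>. (- \<rho> * a) * (indicator A \<omega> * G (x k \<omega>)) + (C0 - 1) * a\<^sup>2 * indicator A \<omega>)"
      by (simp add: c_def Z_def algebra_simps)
    also have "\<dots> = - \<rho> * a * (LINT \<omega>|\<Omega>. indicator A \<omega> * G (x k \<omega>)) + (C0 - 1) * a\<^sup>2 * \<Omega>.prob A"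
      using i2 iA sets.sets_into_space[OF AM]
      by (subst Bochner_Integration.integral_add) (auto simp: Int_absorb2)
    also have "(LINT \<omega>|\<Omega>. indicator A \<omega> * G (x k \<omega>)) = (LINT \<omega>|\<Omega>. indicator A \<omega> * (F (x k \<omega>) - \<Phi> \<rho> (x k \<omega>)))"
      using x(2) by (intro Bochner_Integration.integral_cong) (auto simp: G)
    finally show "(LINT \<omega>|\<Omega>. indicator A \<omega> * (\<Phi> \<rho> (x (Suc k) \<omega>) - \<Phi> \<rho> (x k \<omega>)))
      \<le> - \<rho> * \<alpha> k * (LINT \<omega>|\<Omega>. indicator A \<omega> * (F (x k \<omega>) - \<Phi> \<rho> (x k \<omega>))) + C0 * (\<alpha> k)\<^sup>2 * \<Omega>.prob A"
      by (simp add: a_def algebra_simps)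
  qed
qed

lemma gap_integrable:
  assumes "0 < \<rho>"
  shows "integrable \<Omega> (\<lambda>\<omega>. F (x k \<omega>) - \<Phi> \<rho> (x k \<omega>))"
proof (rule \<Omega>.integrable_const_bound[where B = "LF\<^sup>2 / (2 * \<rho>)"])
  show "AE \<omega> in \<Omega>. norm (F (x k \<omega>) - \<Phi> \<rho> (x k \<omega>)) \<le> LF\<^sup>2 / (2 * \<rho>)"
    using gap_bounds[OF assms x(2)] by (intro AE_I2) auto
  let ?G = "\<lambda>y. indicator X y *\<^sub>R (F y - \<Phi> \<rho> y)"
  have "?G \<in> borel_measurable borel"
    using X(1) assms
    by (intro borel_measurable_continuous_on_indicator continuous_intros F_continuous
        continuous_on_subset[OF \<Phi>_continuous]) (auto dest: compact_imp_closed)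
  then have "(\<lambda>\<omega>. ?G (x k \<omega>)) \<in> borel_measurable \<Omega>"
    by (rule measurable_compose[OF x_measurable])
  then show "(\<lambda>\<omega>. F (x k \<omega>) - \<Phi> \<rho> (x k \<omega>)) \<in> borel_measurable \<Omega>"
    by (rule measurable_cong[THEN iffD1, rotated]) (simp add: x(2))
qed

lemma envelope_AE_convergent:
  assumes \<rho>: "0 < \<rho>" "(LINT s|P. \<delta> s) \<le> \<rho>" "2 * LF / \<rho> < r"
  shows "AE \<omega> in \<Omega>. convergent (\<lambda>k. \<Phi> \<rho> (x k \<omega>))"
proof -
  obtain C where C: "0 \<le> C" and drift: "\<And>k A. A \<in> sets (sample_algebra \<Omega> P S k) \<Longrightarrow>
    (LINT \<omega>|\<Omega>. indicator A \<omega> * (\<Phi> \<rho> (x (Suc k) \<omega>) - \<Phi> \<rho> (x k \<omega>)))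
      \<le> - \<rho> * \<alpha> k * (LINT \<omega>|\<Omega>. indicator A \<omega> * (F (x k \<omega>) - \<Phi> \<rho> (x k \<omega>))) + C * (\<alpha> k)\<^sup>2 * \<Omega>.prob A"
    using envelope_drift[OF \<rho>] by auto
  obtain b where b: "\<And>y. y \<in> X \<Longrightarrow> \<bar>\<Phi> \<rho> y\<bar> \<le> b" using \<Phi>_bounded[OF \<rho>(1)] by auto
  have \<Phi>m: "\<Phi> \<rho> \<in> borel_measurable borel"
    using \<Phi>_continuous \<rho> by (intro borel_measurable_continuous_onI) auto
  show ?thesis
  proof (rule \<Omega>.almost_supermartingale_AE_convergent
      [where G = "sample_algebra \<Omega> P S" and K = b and e = "\<lambda>k. C * (\<alpha> k)\<^sup>2"])
    show "subalgebra \<Omega> (sample_algebra \<Omega> P S k)" for k by (rule subalgebra_sample_algebra) simp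
    show "sets (sample_algebra \<Omega> P S k) \<subseteq> sets (sample_algebra \<Omega> P S (Suc k))" for k
      by (rule sample_algebra_mono) simp
    show "(\<lambda>\<omega>. \<Phi> \<rho> (x k \<omega>)) \<in> borel_measurable (sample_algebra \<Omega> P S k)" for k
      using measurable_compose[OF x(1) \<Phi>m] .
    show "\<bar>\<Phi> \<rho> (x k \<omega>)\<bar> \<le> b" if "\<omega> \<in> space \<Omega>" for k \<omega> using b x(2)[OF that] by blast
    show "summable (\<lambda>k. C * (\<alpha> k)\<^sup>2)" using \<alpha>(3) by (rule summable_mult)
    show "0 \<le> C * (\<alpha> k)\<^sup>2" for k using C by simp
    fix k A assume A: "A \<in> sets (sample_algebra \<Omega> P S k)"
    have "0 \<le> (LINT \<omega>|\<Omega>. indicator A \<omega> * (F (x k \<omega>) - \<Phi> \<rho> (x k \<omega>)))"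
      using gap_bounds(1)[OF \<rho>(1) x(2)] by (intro integral_nonneg_AE AE_I2) simp
    then have "0 \<le> \<rho> * \<alpha> k * (LINT \<omega>|\<Omega>. indicator A \<omega> * (F (x k \<omega>) - \<Phi> \<rho> (x k \<omega>)))"
      using \<rho>(1) less_imp_le[OF \<alpha>(1)[of k]] by (intro mult_nonneg_nonneg) auto
    then show "(LINT \<omega>|\<Omega>. indicator A \<omega> * (\<Phi> \<rho> (x (Suc k) \<omega>) - \<Phi> \<rho> (x k \<omega>))) \<le> C * (\<alpha> k)\<^sup>2 * \<Omega>.prob A"
      using drift[OF A] by simp
  qed
qed

lemma gap_sum_AE_finite:
  assumes \<rho>: "0 < \<rho>" "(LINT s|P. \<delta> s) \<le> \<rho>" "2 * LF / \<rho> < r"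
  shows "AE \<omega> in \<Omega>. (\<Sum>k. ennreal (\<alpha> k * (F (x k \<omega>) - \<Phi> \<rho> (x k \<omega>)))) \<noteq> \<infinity>"
proof -
  obtain C where C: "0 \<le> C" and drift: "\<And>k A. A \<in> sets (sample_algebra \<Omega> P S k) \<Longrightarrow>
    (LINT \<omega>|\<Omega>. indicator A \<omega> * (\<Phi> \<rho> (x (Suc k) \<omega>) - \<Phi> \<rho> (x k \<omega>)))
      \<le> - \<rho> * \<alpha> k * (LINT \<omega>|\<Omega>. indicator A \<omega> * (F (x k \<omega>) - \<Phi> \<rho> (x k \<omega>))) + C * (\<alpha> k)\<^sup>2 * \<Omega>.prob A"
    using envelope_drift[OF \<rho>] by auto
  obtain b where b: "\<And>y. y \<in> X \<Longrightarrow> \<bar>\<Phi> \<rho> y\<bar> \<le> b" using \<Phi>_bounded[OF \<rho>(1)] by auto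
  have \<Phi>m: "\<Phi> \<rho> \<in> borel_measurable borel"
    using \<Phi>_continuous \<rho> by (intro borel_measurable_continuous_onI) auto
  have \<Phi>i: "integrable \<Omega> (\<lambda>\<omega>. \<Phi> \<rho> (x k \<omega>))" for k
    by (rule \<Omega>.integrable_const_bound[where B = b])
      (use b x(2) measurable_compose[OF x_measurable \<Phi>m] in auto)
  define d where "d k = (LINT \<omega>|\<Omega>. F (x k \<omega>) - \<Phi> \<rho> (x k \<omega>))" for k
  define w where "w k = (LINT \<omega>|\<Omega>. \<Phi> \<rho> (x k \<omega>))" for k
  have d0: "0 \<le> d k" for k
    unfolding d_def using gap_bounds(1)[OF \<rho>(1) x(2)] by (intro integral_nonneg_AE AE_I2) simp
  have wb: "\<bar>w k\<bar> \<le> b" for k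
  proof -
    have "\<bar>w k\<bar> \<le> (LINT \<omega>|\<Omega>. \<bar>\<Phi> \<rho> (x k \<omega>)\<bar>)" unfolding w_def by (rule integral_abs_bound)
    also have "\<dots> \<le> (LINT \<omega>|\<Omega>. b)"
      using \<Phi>i b x(2) by (intro integral_mono) auto
    finally show ?thesis by (simp add: \<Omega>.prob_space)
  qed
  have one: "\<rho> * (\<alpha> k * d k) \<le> w k - w (Suc k) + C * (\<alpha> k)\<^sup>2" for k
  proof -
    have "space \<Omega> \<in> sets (sample_algebra \<Omega> P S k)"
      using sets.top[of "sample_algebra \<Omega> P S k"] by simp
    note drift[OF this]
    moreover have "(LINT \<omega>|\<Omega>. indicator (space \<Omega>) \<omega> * (\<Phi> \<rho> (x (Suc k) \<omega>) - \<Phi> \<rho> (x k \<omega>))) = w (Suc k) - w k"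
    proof -
      have "(LINT \<omega>|\<Omega>. indicator (space \<Omega>) \<omega> * (\<Phi> \<rho> (x (Suc k) \<omega>) - \<Phi> \<rho> (x k \<omega>)))
          = (LINT \<omega>|\<Omega>. \<Phi> \<rho> (x (Suc k) \<omega>) - \<Phi> \<rho> (x k \<omega>))"
        by (intro Bochner_Integration.integral_cong) auto
      then show ?thesis unfolding w_def by (simp add: \<Phi>i)
    qed
    moreover have "(LINT \<omega>|\<Omega>. indicator (space \<Omega>) \<omega> * (F (x k \<omega>) - \<Phi> \<rho> (x k \<omega>))) = d k"
      unfolding d_def by (intro Bochner_Integration.integral_cong) auto
    ultimately show ?thesis by (simp add: \<Omega>.prob_space)
  qed
  define K where "K = (2 * b + C * (\<Sum>k. (\<alpha> k)\<^sup>2)) / \<rho>"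
  have partial: "(\<Sum>k<n. \<alpha> k * d k) \<le> K" for n
  proof -
    have "\<rho> * (\<Sum>k<n. \<alpha> k * d k) \<le> (\<Sum>k<n. w k - w (Suc k) + C * (\<alpha> k)\<^sup>2)"
      unfolding sum_distrib_left by (intro sum_mono one)
    also have "\<dots> = w 0 - w n + C * (\<Sum>k<n. (\<alpha> k)\<^sup>2)"
      by (simp add: sum.distrib sum_lessThan_telescope' sum_distrib_left)
    also have "C * (\<Sum>k<n. (\<alpha> k)\<^sup>2) \<le> C * (\<Sum>k. (\<alpha> k)\<^sup>2)"
      using \<alpha>(3) C by (intro mult_left_mono sum_le_suminf) auto
    finally have "\<rho> * (\<Sum>k<n. \<alpha> k * d k) \<le> 2 * b + C * (\<Sum>k. (\<alpha> k)\<^sup>2)"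
      using wb[of 0] wb[of n] by linarith
    then show ?thesis unfolding K_def using \<rho>(1) by (simp add: field_simps)
  qed
  have gm: "(\<lambda>\<omega>. ennreal (\<alpha> k * (F (x k \<omega>) - \<Phi> \<rho> (x k \<omega>)))) \<in> borel_measurable \<Omega>" for k
    using gap_integrable[OF \<rho>(1), of k] by measurable
  have "(\<integral>\<^sup>+\<omega>. (\<Sum>k. ennreal (\<alpha> k * (F (x k \<omega>) - \<Phi> \<rho> (x k \<omega>)))) \<partial>\<Omega>)
      = (\<Sum>k. \<integral>\<^sup>+\<omega>. ennreal (\<alpha> k * (F (x k \<omega>) - \<Phi> \<rho> (x k \<omega>))) \<partial>\<Omega>)"
    by (rule nn_integral_suminf[OF gm])
  also have "\<dots> = (\<Sum>k. ennreal (\<alpha> k * d k))"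
  proof (rule arg_cong[where f = suminf], rule ext)
    fix k
    have "(\<integral>\<^sup>+\<omega>. ennreal (\<alpha> k * (F (x k \<omega>) - \<Phi> \<rho> (x k \<omega>))) \<partial>\<Omega>)
        = ennreal (LINT \<omega>|\<Omega>. \<alpha> k * (F (x k \<omega>) - \<Phi> \<rho> (x k \<omega>)))"
      using gap_integrable[OF \<rho>(1)] gap_bounds(1)[OF \<rho>(1) x(2)] less_imp_le[OF \<alpha>(1)]
      by (intro nn_integral_eq_integral integrable_mult_right AE_I2 mult_nonneg_nonneg) auto
    then show "(\<integral>\<^sup>+\<omega>. ennreal (\<alpha> k * (F (x k \<omega>) - \<Phi> \<rho> (x k \<omega>))) \<partial>\<Omega>) = ennreal (\<alpha> k * d k)"
      by (simp add: d_def)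
  qed
  also have "\<dots> \<le> ennreal K"
    unfolding suminf_eq_SUP
  proof (rule SUP_least)
    fix n
    have "(\<Sum>k<n. ennreal (\<alpha> k * d k)) = ennreal (\<Sum>k<n. \<alpha> k * d k)"
      using d0 less_imp_le[OF \<alpha>(1)] by (intro sum_ennreal mult_nonneg_nonneg) auto
    then show "(\<Sum>k<n. ennreal (\<alpha> k * d k)) \<le> ennreal K" using partial[of n] by (simp add: ennreal_leI)
  qed
  also have "\<dots> < \<infinity>" by simp
  finally have fin: "(\<integral>\<^sup>+\<omega>. (\<Sum>k. ennreal (\<alpha> k * (F (x k \<omega>) - \<Phi> \<rho> (x k \<omega>)))) \<partial>\<Omega>) \<noteq> \<infinity>" by simp
  show ?thesis
    by (rule nn_integral_PInf_AE[OF borel_measurable_suminf_order[OF gm] fin])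
qed

text \<open>Integer shifts of one large \<open>\<rho> 0\<close> give a sequence of envelopes that are all convergent along
  almost every path and that approximate \<open>F\<close> uniformly. The gap for \<open>\<rho> 0\<close> alone yields the
  stationary limit point.\<close>

lemma objective_AE_tendsto_stationary_value:
  assumes cX: "convex X" and c\<phi>: "convex_on UNIV \<phi>" and r': "0 < r'"
    and wc: "\<And>y. y \<in> X \<Longrightarrow> convex_on (ball y r') (\<lambda>z. risk P f z + l / 2 * (norm (z - y))\<^sup>2)"
  shows "AE \<omega> in \<Omega>. \<exists>z\<in>stationary_set P X f \<phi>. (\<lambda>k. F (x k \<omega>)) \<longlonglongrightarrow> F z"
proof -
  define \<rho> where "\<rho> n = 1 + \<bar>LINT s|P. \<delta> s\<bar> + \<bar>l\<bar> + 2 * LF / r + real n" for n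
  have q0: "0 \<le> 2 * LF / r" using LF_nonneg r by simp
  have \<rho>: "0 < \<rho> n" "(LINT s|P. \<delta> s) \<le> \<rho> n" "l \<le> \<rho> n" "real n \<le> \<rho> n" for n
    using q0 unfolding \<rho>_def by linarith+
  have \<rho>r: "2 * LF / \<rho> n < r" for n
  proof -
    have "2 * LF / r < \<rho> n" unfolding \<rho>_def by linarith
    then show ?thesis using r \<rho>(1)[of n] by (simp add: field_simps)
  qed
  have "AE \<omega> in \<Omega>. \<forall>n. convergent (\<lambda>k. \<Phi> (\<rho> n) (x k \<omega>))"
    unfolding AE_all_countable by (intro allI envelope_AE_convergent \<rho> \<rho>r)
  moreover have "AE \<omega> in \<Omega>. (\<Sum>k. ennreal (\<alpha> k * (F (x k \<omega>) - \<Phi> (\<rho> 0) (x k \<omega>)))) \<noteq> \<infinity>"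
    by (intro gap_sum_AE_finite \<rho> \<rho>r)
  ultimately show ?thesis
    using AE_space
  proof eventually_elim
    fix \<omega> assume conv: "\<forall>n. convergent (\<lambda>k. \<Phi> (\<rho> n) (x k \<omega>))"
      and fin: "(\<Sum>k. ennreal (\<alpha> k * (F (x k \<omega>) - \<Phi> (\<rho> 0) (x k \<omega>)))) \<noteq> \<infinity>" and \<omega>: "\<omega> \<in> space \<Omega>"
    note xX = x(2)[OF \<omega>]
    have "convergent (\<lambda>k. F (x k \<omega>))"
    proof (rule convergent_if_uniformly_approximated)
      fix e :: real assume e: "0 < e"
      obtain n :: nat where n: "LF\<^sup>2 / (2 * e) < real n" using reals_Archimedean2 by blast
      have "LF\<^sup>2 / (2 * e) < \<rho> n" using n \<rho>(4)[of n] by linarith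
      then have "LF\<^sup>2 / (2 * \<rho> n) \<le> e" using e \<rho>(1)[of n] by (simp add: field_simps)
      then have "\<bar>F (x k \<omega>) - \<Phi> (\<rho> n) (x k \<omega>)\<bar> \<le> e" for k
        using gap_bounds[OF \<rho>(1)[of n] xX, of k] by linarith
      then show "\<exists>b. convergent b \<and> (\<forall>k. \<bar>F (x k \<omega>) - b k\<bar> \<le> e)"
        using conv by (intro exI[of _ "\<lambda>k. \<Phi> (\<rho> n) (x k \<omega>)"]) auto
    qed
    then obtain v where v: "(\<lambda>k. F (x k \<omega>)) \<longlonglongrightarrow> v" by (auto simp: convergent_def)
    have Dc: "continuous_on X (\<lambda>y. F y - \<Phi> (\<rho> 0) y)"
      using \<rho>(1)[of 0] by (intro continuous_intros F_continuous continuous_on_subset[OF \<Phi>_continuous]) auto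
    obtain z where z: "z \<in> X" "F z = v" "F z - \<Phi> (\<rho> 0) z \<le> 0"
      using limit_point_with_zero_gap[OF X(1) xX F_continuous v Dc
          small_terms_if_weighted_sum_finite[OF \<alpha>(1) gap_bounds(1)[OF \<rho>(1) xX] \<alpha>(2) fin]]
      by blast
    have "\<Phi> (\<rho> 0) z = F z" using z gap_bounds(1)[OF \<rho>(1)[of 0] z(1)] by linarith
    then have "z \<in> stationary_set P X f \<phi>"
      by (rule moreau_env_fixed_point_stationary[OF cX X(1) z(1) r' wc[OF z(1)] \<rho>(3) c\<phi> F_continuous])
    then show "\<exists>z\<in>stationary_set P X f \<phi>. (\<lambda>k. F (x k \<omega>)) \<longlonglongrightarrow> F z"
      using v z by auto
  qed
qed

end

section \<open>Convergence of the objective values\<close>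

theorem theorem2p1:
  fixes P :: "'s measure"
    and \<Omega> :: "'w measure"
    and X :: "'a::euclidean_space set"
    and f :: "'a \<Rightarrow> 's \<Rightarrow> real"
    and \<phi> :: "'a \<Rightarrow> real"
    and m :: "'a \<Rightarrow> 'a \<Rightarrow> 's \<Rightarrow> ereal"
    and \<alpha> :: "nat \<Rightarrow> real"
    and S :: "nat \<Rightarrow> 'w \<Rightarrow> 's"
    and x :: "nat \<Rightarrow> 'w \<Rightarrow> 'a"
    and x0 :: 'a
  assumes "prob_space P" and "prob_space \<Omega>"
    and "X \<noteq> {}" and "closed X" and "convex X" and "compact X"
    and "closed_convex_fun \<phi>"
    and "\<And>y. integrable P (f y)"
    and "cond_L P X f" and "cond_W P X f"
    and "model_family P X m"
    and "cond_Ci P X m" and "cond_Cii P X f m" and "cond_Ciii P X f m" and "cond_Civ P X f m"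
    and "\<And>k. \<alpha> k > 0"
    and "(\<Sum>k. ennreal (\<alpha> k)) = \<infinity>"
    and "summable (\<lambda>k. (\<alpha> k)\<^sup>2)"
    and "prob_space.indep_vars \<Omega> (\<lambda>_. P) S UNIV"
    and "\<And>k. distr \<Omega> P (S k) = P"
    and "x0 \<in> X"
    and "model_based_iterates \<Omega> P X \<phi> m \<alpha> x0 S x"
  shows "AE \<omega> in \<Omega>.
           {liminf (\<lambda>k. ereal (objective P f \<phi> (x k \<omega>))) .. limsup (\<lambda>k. ereal (objective P f \<phi> (x k \<omega>)))}
             \<subseteq> ereal ` objective P f \<phi> ` stationary_set P X f \<phi>"
proof -
  note P = assms(1) and \<Omega> = assms(2) and Xne = assms(3) and cX = assms(5) and X = assms(6)
    and f = assms(8) and m = assms(11) and Ci = assms(12) and Cii = assms(13) and Ciii = assms(14)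
    and S = assms(19) and dS = assms(20)
  interpret P: prob_space P by (rule P)
  interpret \<Omega>: prob_space \<Omega> by (rule \<Omega>)
  have c\<phi>: "convex_on UNIV \<phi>" using assms(7) by (simp add: closed_convex_fun_def)
  have \<phi>m: "\<phi> \<in> borel_measurable borel"
    using convex_on_continuous[OF open_UNIV c\<phi>] by (rule borel_measurable_continuous_onI)
  obtain L where L: "L \<ge> 0" "\<And>y z. y \<in> X \<Longrightarrow> z \<in> X \<Longrightarrow> \<bar>\<phi> y - \<phi> z\<bar> \<le> L * norm (y - z)"
    by (rule convex_on_lipschitz_on_compact[OF c\<phi> cX X]) blast
  obtain Mf where Mf: "Mf \<in> borel_measurable P" "\<And>s. 0 \<le> Mf s" "integrable P (\<lambda>s. (Mf s)\<^sup>2)"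
    and sub: "AE s in P. \<forall>y\<in>X. \<forall>g\<in>frechet_subdiff (\<lambda>z. ereal (f z s)) y. norm g \<le> Mf s"
    by (rule cond_L_uniform_bound[OF assms(9) X]) blast
  obtain r' l where r': "r' > 0" and l: "integrable P l"
    and wc: "\<And>s y. s \<in> space P \<Longrightarrow> y \<in> X \<Longrightarrow> convex_on (ball y r') (\<lambda>z. f z s + l s / 2 * (norm (z - y))\<^sup>2)"
    by (rule cond_W_uniform[OF assms(10) X]) blast
  obtain r \<delta> where r: "r > 0" and \<delta>: "integrable P \<delta>"
    and upper: "\<And>s x y. s \<in> space P \<Longrightarrow> x \<in> X \<Longrightarrow> norm (y - x) < r \<Longrightarrow>
      m x y s \<le> ereal (f y s + 1 / 2 * \<delta> s * (norm (y - x))\<^sup>2)"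
    and \<delta>0: "\<And>s. s \<in> space P \<Longrightarrow> 0 \<le> \<delta> s"
    by (rule cond_Civ_uniform[OF assms(15) X]) blast
  have Sm: "S k \<in> measurable \<Omega> P" for k using S by (auto simp: \<Omega>.indep_vars_def)
  have lip: "AE s in P. \<forall>y\<in>X. \<forall>z\<in>X. \<bar>f y s - f z s\<bar> \<le> Mf s * norm (y - z)"
    using sub AE_space
  proof eventually_elim
    fix s assume b: "\<forall>y\<in>X. \<forall>g\<in>frechet_subdiff (\<lambda>z. ereal (f z s)) y. norm g \<le> Mf s" and s: "s \<in> space P"
    show "\<forall>y\<in>X. \<forall>z\<in>X. \<bar>f y s - f z s\<bar> \<le> Mf s * norm (y - z)"
      by (intro ballI weakly_convex_bounded_subgradients_lipschitz[OF cX _ _ r' wc[OF s]]) (use b in auto)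
  qed
  have start: "x 0 \<omega> = x0" and it: "is_model_step X \<phi> m (\<alpha> k) (x k \<omega>) (S k \<omega>) (x (Suc k) \<omega>)"
    if "\<omega> \<in> space \<Omega>" for \<omega> k
    using assms(22) that unfolding model_based_iterates_def by auto
  have xm: "x k \<in> borel_measurable (sample_algebra \<Omega> P S k)" for k
    using assms(22) unfolding model_based_iterates_def by auto
  have xX: "x k \<omega> \<in> X" if \<omega>: "\<omega> \<in> space \<Omega>" for k \<omega>
  proof (cases k)
    case 0
    then show ?thesis using start[OF \<omega>] assms(21) by simp
  next
    case (Suc j)
    then show ?thesis using it[OF \<omega>, of j] by (simp add: is_model_step_def is_arg_min_def)
  qed
  have step: "AE \<omega> in \<Omega>. \<forall>y\<in>X. norm (y - x k \<omega>) < r \<longrightarrow>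
      (norm (y - x (Suc k) \<omega>))\<^sup>2 \<le> (norm (y - x k \<omega>))\<^sup>2
        - 2 * \<alpha> k * (f (x k \<omega>) (S k \<omega>) + \<phi> (x k \<omega>) - f y (S k \<omega>) - \<phi> y)
        + \<alpha> k * \<delta> (S k \<omega>) * (norm (y - x k \<omega>))\<^sup>2 + (\<alpha> k)\<^sup>2 * (Mf (S k \<omega>) + L)\<^sup>2" for k
  proof -
    have "AE s in distr \<Omega> P (S k). \<forall>y\<in>X. \<forall>g\<in>frechet_subdiff (\<lambda>z. ereal (f z s)) y. norm g \<le> Mf s"
      unfolding dS by (rule sub)
    from AE_distrD[OF Sm this] show ?thesis
      using AE_space
    proof eventually_elim
      fix \<omega> assume b: "\<forall>y\<in>X. \<forall>g\<in>frechet_subdiff (\<lambda>z. ereal (f z (S k \<omega>))) y. norm g \<le> Mf (S k \<omega>)"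
        and \<omega>: "\<omega> \<in> space \<Omega>"
      define w where "w = x k \<omega>"
      define s where "s = S k \<omega>"
      have w: "w \<in> X" and s: "s \<in> space P" using xX[OF \<omega>] measurable_space[OF Sm \<omega>] by (auto simp: w_def s_def)
      have mw: "m w w s = ereal (f w s)" using Cii w s by (auto simp: cond_Cii_def)
      then obtain g where g: "g \<in> frechet_subdiff (\<lambda>z. m w z s) w"
        using Ci w s unfolding cond_Ci_def by fastforce
      then have "g \<in> frechet_subdiff (\<lambda>z. ereal (f z s)) w"
        using Ciii w s unfolding cond_Ciii_def by blast
      then have gM: "norm g \<le> Mf s" using b w by (auto simp: s_def)
      have cv: "ereal_convex (\<lambda>z. m w z s)" using Ci w s by (auto simp: cond_Ci_def)
      have ninf: "m w z s \<noteq> -\<infinity>" for z using m w s by (auto simp: model_family_def)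
      have st: "is_arg_min (\<lambda>y. m w y s + ereal (\<phi> y) + ereal (1 / (2 * \<alpha> k) * (norm (y - w))\<^sup>2))
          (\<lambda>y. y \<in> X) (x (Suc k) \<omega>)"
        using it[OF \<omega>, of k] by (simp only: is_model_step_def w_def s_def)
      have "(norm (y - x (Suc k) \<omega>))\<^sup>2 \<le> (norm (y - w))\<^sup>2
        - 2 * \<alpha> k * (f w s + \<phi> w - f y s - \<phi> y)
        + \<alpha> k * \<delta> s * (norm (y - w))\<^sup>2 + (\<alpha> k)\<^sup>2 * (Mf s + L)\<^sup>2"
        if y: "y \<in> X" "norm (y - w) < r" for y
      proof -
        have "(norm (y - x (Suc k) \<omega>))\<^sup>2 \<le> (norm (y - w))\<^sup>2
            - 2 * \<alpha> k * (f w s + \<phi> w - (f y s + 1 / 2 * \<delta> s * (norm (y - w))\<^sup>2) - \<phi> y)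
            + (\<alpha> k)\<^sup>2 * (Mf s + L)\<^sup>2"
          by (rule convex_prox_step_inequality[OF cX w y(1) assms(16) st cv ninf mw upper[OF s w y(2)]
                g gM c\<phi> L(2)])
        then show ?thesis by (simp add: algebra_simps)
      qed
      then show "\<forall>y\<in>X. norm (y - x k \<omega>) < r \<longrightarrow>
        (norm (y - x (Suc k) \<omega>))\<^sup>2 \<le> (norm (y - x k \<omega>))\<^sup>2
          - 2 * \<alpha> k * (f (x k \<omega>) (S k \<omega>) + \<phi> (x k \<omega>) - f y (S k \<omega>) - \<phi> y)
          + \<alpha> k * \<delta> (S k \<omega>) * (norm (y - x k \<omega>))\<^sup>2 + (\<alpha> k)\<^sup>2 * (Mf (S k \<omega>) + L)\<^sup>2"
        by (simp only: w_def s_def) blast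
    qed
  qed
  interpret prox_descent P \<Omega> X f \<phi> \<alpha> S x Mf \<delta> L r
    by unfold_locales (fact X Xne f \<phi>m L Mf lip \<delta> \<delta>0 assms(16-18) S dS xm xX r step)+
  have "AE \<omega> in \<Omega>. \<exists>z\<in>stationary_set P X f \<phi>. (\<lambda>k. objective P f \<phi> (x k \<omega>)) \<longlonglongrightarrow> objective P f \<phi> z"
    by (rule objective_AE_tendsto_stationary_value[OF cX c\<phi> r' convex_on_risk[OF P f l wc]]) auto
  then show ?thesis
  proof eventually_elim
    fix \<omega> assume "\<exists>z\<in>stationary_set P X f \<phi>. (\<lambda>k. objective P f \<phi> (x k \<omega>)) \<longlonglongrightarrow> objective P f \<phi> z"
    then obtain z where z: "z \<in> stationary_set P X f \<phi>"
      and lim: "(\<lambda>k. objective P f \<phi> (x k \<omega>)) \<longlonglongrightarrow> objective P f \<phi> z" by blast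
    have lim': "(\<lambda>k. ereal (objective P f \<phi> (x k \<omega>))) \<longlonglongrightarrow> ereal (objective P f \<phi> z)"
      using lim by simp
    show "{liminf (\<lambda>k. ereal (objective P f \<phi> (x k \<omega>))) .. limsup (\<lambda>k. ereal (objective P f \<phi> (x k \<omega>)))}
        \<subseteq> ereal ` objective P f \<phi> ` stationary_set P X f \<phi>"
      using z unfolding lim_imp_Liminf[OF sequentially_bot lim'] lim_imp_Limsup[OF sequentially_bot lim']
      by auto
  qed
qed

end
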